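(* Assume the setting and Assumptions 1–5 described in the context, and suppose $\theta=r_B$. Then for each $l=0,1,\dots,\hat\tau-1$, as $n\to\infty$, \[ \bar x(n\hat\tau+l)=\frac{(n\hat\tau+l)^{m_B}}{m_B!}\,\frac{1}{\theta^{n\hat\tau+l}}\,\hat c_l+O\big((n\hat\tau+l)^{m_B-1}\theta^{-(n\hat\tau+l)}\big)e^{\rm t}, \] where \[ \hat c_l=\sum_{m=0}^{L-1}\frac{1}{(\hat\omega_m)^l}\,\frac{x(0)\tilde B(\theta\hat\omega_m)\Delta_M(\hat\omega_m)v(\theta)}{(\theta\hat\omega_m-1)\big\{\frac{d}{dy}\delta(A^*(y))|_{y=\theta}-1\big\}}\cdot\mu(\theta)\Delta_M(\hat\omega_m)^{-1}>0 . \]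
   Context: Let $M_0,M$ be positive integers. Consider a discrete-time Markov chain of M/G/1 type with state space $\{(0,j):1\le j\le M_0\}\cup\{(k,j):k\ge1,1\le j\le M\}$ (states with first coordinate $k$ form level $k$), with transition matrix in lexicographic order \[ T=\begin{pmatrix}B(0)&B(1)&B(2)&\cdots\\ C(0)&A(1)&A(2)&\cdots\\ O&A(0)&A(1)&\cdots\\ O&O&A(0)&\cdots\\ \vdots&\vdots&\vdots&\ddots\end{pmatrix}, \] where $A(k)$ ($k\ge0$) are nonnegative $M\times M$, $B(0)$ is $M_0\times M_0$, $B(k)$ ($k\ge1$) are $M_0\times M$, $C(0)$ is $M\times M_0$, all nonnegative; $A=\sum_{k\ge0}A(k)$ is stochastic, $B(0)e+\sum_{k\ge1}B(k)e=e$ ($e$ a column of ones), $\pi A=\pi$, $\pi e=1$. Let $A^*(z)=\sum_{k\ge0}z^kA(k)$, $B^*(z)=\sum_{k\ge1}z^kB(k)$ with convergence radii $r_A,r_B$, and $\Gamma_A^*(z)=z^{-1}A^*(z)$. For a square complex matrix $X$, $\delta(X)$ is a maximum-modulus eigenvalue with nonnegative argument and maximal real part among maximum-modulus eigenvalues. Assumption 1: (a) $T$ irreducible; (b) $A$ irreducible; (c) $\pi\sum_{k\ge1}kA(k)e<1$; (d) $\sum_{k\ge1}kB(k)e$ finite. Assumption 2: $r_A>1$, $r_B>1$. Assumption 3: there is a finite $\theta$ with $1<\theta<r_A$ and $\theta=\delta(A^*(\theta))$. Assumption 4: $B^*(z)$ is meromorphic in an open set containing $\{|z|\le r_B\}$,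 and for some positive integer $m_B$ and finite nonnegative $\tilde B(r_B)\ne O$, $\lim_{z\to r_B}(1-z/r_B)^{m_B}B^*(z)=\tilde B(r_B)$. Assumption 5: there exist exactly $N\ge1$ numbers $\zeta_0,\dots,\zeta_{N-1}$ with $|\zeta_n|=1$, $0=\arg\zeta_0<\cdots<\arg\zeta_{N-1}<2\pi$, such that $\lim_{z\to r_B\zeta_n}(1-z/(r_B\zeta_n))^{m_B}B^*(z)=\tilde B(r_B\zeta_n)$ is finite and nonzero. $x=(x(0),x(1),\dots)$ is the stationary probability vector partitioned by levels, $\bar x(k)=\sum_{l\ge k+1}x(l)$. $\mu(\theta),v(\theta)$ are the Perron–Frobenius left/right eigenvectors of $\Gamma_A^*(\theta)$ with $\mu(\theta)e=1$, $\mu(\theta)v(\theta)=1$. Period $\tau$: in the Markov additive process on $\mathbb Z\times\{1,\dots,M\}$ moving from $(k_0,i)$ to $(k_0+k,j)$ with probability $[\Gamma_A(k)]_{i,j}$, where $\Gamma_A(k)=A(k+1)$ for $k\ge-1$ and $O$ for $k\le-2$, $\tau$ is the common value of $\gcd\{k\ne0:(0,j)\to(k,j)\}$ ($\to$ = reachable with positive probability in $\ge1$ steps). Fix $p:\{1,\dots,M\}\to\{0,\dots,\tau-1\}$ with $[\Gamma_A(k)]_{i,j}>0$ only if $k\equiv p(j)-p(i)\pmod\tau$, and $\Delta_M(z)=\mathrm{diag}(z^{-p(1)},\dots,z^{-p(M)})$; $\omega_x=\exp(2\pi\iota/x)$. Define for $\nu=0,\dots,\tau-1$: $c(\omega_\tau^\nu)=\frac{[x(0)B^*(\theta\omega_\tau^\nu)-x(1)A(0)]\Delta_M(\omega_\tau^\nu)v(\theta)}{(\theta\omega_\tau^\nu-1)\{\frac{d}{dy}\delta(A^*(y))|_{y=\theta}-1\}}$;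 $\mathbb H=\{0\}\cup\{\nu\in\{1,\dots,\tau-1\}:c(\omega_\tau^\nu)\ne0\}$; $\tau'=\tau/\gcd((\{\tau\}\cup\mathbb H)\setminus\{0\})$; $\mathcal P_A=\{\theta\omega_\tau^\nu:\nu\in\mathbb H\}$; $\mathcal P_B=\{\theta\zeta_n:n=0,\dots,N-1\}$; $\mathcal P=\mathcal P_A\cap\mathcal P_B$ with $L$ elements, written $\mathcal P=\{\theta\omega_{\tau'}^{\eta_m}:m=0,\dots,L-1\}$ with integers $0=\eta_0<\eta_1<\cdots<\eta_{L-1}\le\tau'-1$; $\hat\tau=\tau'/\gcd\{\eta_1,\dots,\eta_{L-1},\tau'\}$; $\hat\omega_m=\omega_{\tau'}^{\eta_m}$. $O(g)e^{\rm t}$ denotes a row vector with entries $O(g)$. *)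

theory Defs
  imports "HOL-Complex_Analysis.Complex_Analysis" "HOL-Library.Landau_Symbols"
begin

text \<open>Matrices are functions of two phase indices.  Phase types: 'a (level 0, size M0),
  'b (levels k >= 1, size M).  States: (0, Inl i) and (k, Inr j) with k >= 1.\<close>

definition mg1_states :: "(nat \<times> ('a + 'b)) set" where
  "mg1_states = {(0, Inl i) | i. True} \<union> {(k, Inr j) | k j. k \<ge> 1}"

definition mg1_T ::
  "('a \<Rightarrow> 'a \<Rightarrow> real) \<Rightarrow> (nat \<Rightarrow> 'a \<Rightarrow> 'b \<Rightarrow> real) \<Rightarrow> ('b \<Rightarrow> 'a \<Rightarrow> real) \<Rightarrow>
   (nat \<Rightarrow> 'b \<Rightarrow> 'b \<Rightarrow> real) \<Rightarrow> (nat \<times> ('a + 'b)) \<Rightarrow> (nat \<times> ('a + 'b)) \<Rightarrow> real" where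
  "mg1_T B0 B C0 A s t =
     (case (s, t) of
        ((0, Inl i), (0, Inl j)) \<Rightarrow> B0 i j
      | ((0, Inl i), (l, Inr j)) \<Rightarrow> (if l \<ge> 1 then B l i j else 0)
      | ((k, Inr i), (0, Inl j)) \<Rightarrow> (if k = 1 then C0 i j else 0)
      | ((k, Inr i), (l, Inr j)) \<Rightarrow>
           (if k \<ge> 1 \<and> l \<ge> 1 \<and> l + 1 \<ge> k then A (l + 1 - k) i j else 0)
      | _ \<Rightarrow> 0)"

definition mg1_vec :: "('a \<Rightarrow> real) \<Rightarrow> (nat \<Rightarrow> 'b \<Rightarrow> real) \<Rightarrow> (nat \<times> ('a + 'b)) \<Rightarrow> real" where
  "mg1_vec x0 x s = (case s of (0, Inl i) \<Rightarrow> x0 i | (k, Inr j) \<Rightarrow> (if k \<ge> 1 then x k j else 0)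
                               | _ \<Rightarrow> 0)"

definition mat_conv_radius :: "(nat \<Rightarrow> 'i::finite \<Rightarrow> 'j::finite \<Rightarrow> real) \<Rightarrow> ereal" where
  "mat_conv_radius F = Min {conv_radius (\<lambda>k. complex_of_real (F k i j)) | i j. True}"

definition Astar :: "(nat \<Rightarrow> 'b \<Rightarrow> 'b \<Rightarrow> real) \<Rightarrow> complex \<Rightarrow> 'b \<Rightarrow> 'b \<Rightarrow> complex" where
  "Astar A z i j = (\<Sum>k. z ^ k * complex_of_real (A k i j))"

definition Bstar :: "(nat \<Rightarrow> 'a \<Rightarrow> 'b \<Rightarrow> real) \<Rightarrow> complex \<Rightarrow> 'a \<Rightarrow> 'b \<Rightarrow> complex" where
  "Bstar B z i j = (\<Sum>k. z ^ Suc k * complex_of_real (B (Suc k) i j))"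

definition is_eigenvalue :: "('n::finite \<Rightarrow> 'n \<Rightarrow> complex) \<Rightarrow> complex \<Rightarrow> bool" where
  "is_eigenvalue X lam \<longleftrightarrow> (\<exists>v. (\<exists>j. v j \<noteq> 0) \<and> (\<forall>i. (\<Sum>j\<in>UNIV. X i j * v j) = lam * v i))"

definition delta :: "('n::finite \<Rightarrow> 'n \<Rightarrow> complex) \<Rightarrow> complex" where
  "delta X = (THE lam. is_eigenvalue X lam
       \<and> (\<forall>\<mu>. is_eigenvalue X \<mu> \<longrightarrow> cmod \<mu> \<le> cmod lam)
       \<and> (\<forall>\<mu>. is_eigenvalue X \<mu> \<and> cmod \<mu> = cmod lam \<longrightarrow> Re \<mu> \<le> Re lam)
       \<and> Im lam \<ge> 0)"

definition omega :: "nat \<Rightarrow> complex" where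
  "omega x = exp (2 * of_real pi * \<i> / of_nat x)"

text \<open>Reachability in the Markov additive process with Gamma_A(k) = A(k+1) (k >= -1).\<close>
definition MAP_step :: "(nat \<Rightarrow> 'b \<Rightarrow> 'b \<Rightarrow> real) \<Rightarrow> ((int \<times> 'b) \<times> (int \<times> 'b)) set" where
  "MAP_step A = {((k0, i), (k1, j)) | k0 i k1 j. k1 - k0 \<ge> -1 \<and> A (nat (k1 - k0 + 1)) i j > 0}"

text \<open>Delta_M(z) = diag(z^{-p(1)}, ..., z^{-p(M)}) (diagonal entries).\<close>
definition DeltaM :: "('b \<Rightarrow> nat) \<Rightarrow> complex \<Rightarrow> 'b \<Rightarrow> complex" where
  "DeltaM p z j = inverse (z ^ p j)"

definition Btilde :: "(complex \<Rightarrow> 'a \<Rightarrow> 'b \<Rightarrow> complex) \<Rightarrow> nat \<Rightarrow> complex \<Rightarrow> 'a \<Rightarrow> 'b \<Rightarrow> complex" where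
  "Btilde Bext m w i j = Lim (at w) (\<lambda>z. (1 - z / w) ^ m * Bext z i j)"

definition dDelta :: "(nat \<Rightarrow> 'b::finite \<Rightarrow> 'b \<Rightarrow> real) \<Rightarrow> real \<Rightarrow> real" where
  "dDelta A \<theta> = deriv (\<lambda>y. Re (delta (Astar A (complex_of_real y)))) \<theta>"

definition Zset :: "(complex \<Rightarrow> 'a::finite \<Rightarrow> 'b::finite \<Rightarrow> complex) \<Rightarrow> real \<Rightarrow> nat \<Rightarrow> complex set" where
  "Zset Bext rB mB = {\<zeta>. cmod \<zeta> = 1 \<and> (\<exists>Bt. Bt \<noteq> (\<lambda>i j. 0) \<and>
       (\<forall>i j. ((\<lambda>z. (1 - z / (of_real rB * \<zeta>)) ^ mB * Bext z i j) \<longlongrightarrow> Bt i j)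
                 (at (of_real rB * \<zeta>))))}"

definition cfun :: "('a::finite \<Rightarrow> real) \<Rightarrow> (nat \<Rightarrow> 'b::finite \<Rightarrow> real) \<Rightarrow> (nat \<Rightarrow> 'b \<Rightarrow> 'b \<Rightarrow> real)
    \<Rightarrow> (complex \<Rightarrow> 'a \<Rightarrow> 'b \<Rightarrow> complex) \<Rightarrow> ('b \<Rightarrow> real) \<Rightarrow> ('b \<Rightarrow> nat) \<Rightarrow> nat \<Rightarrow> real
    \<Rightarrow> nat \<Rightarrow> complex \<Rightarrow> complex" where
  "cfun x0 x A Bext v p tau \<theta> \<nu> z =
     (\<Sum>j\<in>UNIV. ((\<Sum>i\<in>UNIV. complex_of_real (x0 i) * Bext z i j)
                 - (\<Sum>i\<in>UNIV. complex_of_real (x 1 i * A 0 i j)))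
                * DeltaM p (omega tau ^ \<nu>) j * complex_of_real (v j))
     / ((of_real \<theta> * omega tau ^ \<nu> - 1) * complex_of_real (dDelta A \<theta> - 1))"

definition Hset :: "('a::finite \<Rightarrow> real) \<Rightarrow> (nat \<Rightarrow> 'b::finite \<Rightarrow> real) \<Rightarrow> (nat \<Rightarrow> 'b \<Rightarrow> 'b \<Rightarrow> real)
    \<Rightarrow> (complex \<Rightarrow> 'a \<Rightarrow> 'b \<Rightarrow> complex) \<Rightarrow> ('b \<Rightarrow> real) \<Rightarrow> ('b \<Rightarrow> nat) \<Rightarrow> nat \<Rightarrow> real
    \<Rightarrow> nat set" where
  "Hset x0 x A Bext v p tau \<theta> = {0} \<union> {\<nu> \<in> {1..<tau}.
      \<not> ((cfun x0 x A Bext v p tau \<theta> \<nu>) \<longlongrightarrow> 0) (at (of_real \<theta> * omega tau ^ \<nu>))}"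

definition tau_prime :: "nat \<Rightarrow> nat set \<Rightarrow> nat" where
  "tau_prime tau H = tau div Gcd (({tau} \<union> H) - {0})"

definition Pset :: "real \<Rightarrow> nat \<Rightarrow> nat set \<Rightarrow> complex set \<Rightarrow> complex set" where
  "Pset \<theta> tau H Z = {of_real \<theta> * omega tau ^ \<nu> | \<nu>. \<nu> \<in> H} \<inter> {of_real \<theta> * \<zeta> | \<zeta>. \<zeta> \<in> Z}"

definition Eta_set :: "real \<Rightarrow> nat \<Rightarrow> complex set \<Rightarrow> nat set" where
  "Eta_set \<theta> tau' P = {\<eta> \<in> {0..<tau'}. of_real \<theta> * omega tau' ^ \<eta> \<in> P}"

text \<open>hat tau = tau' / gcd{eta_1, ..., eta_{L-1}, tau'} (eta_0 = 0 does not change the gcd).\<close>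
definition tau_hat :: "nat \<Rightarrow> nat set \<Rightarrow> nat" where
  "tau_hat tau' Eta = tau' div Gcd (Eta \<union> {tau'})"

text \<open>hat c_l (entry j), a sum over m = 0..L-1 with hat omega_m = omega_tau'^eta_m.\<close>
definition c_hat :: "('a::finite \<Rightarrow> real) \<Rightarrow> (nat \<Rightarrow> 'b::finite \<Rightarrow> 'b \<Rightarrow> real)
    \<Rightarrow> (complex \<Rightarrow> 'a \<Rightarrow> 'b \<Rightarrow> complex) \<Rightarrow> nat \<Rightarrow> ('b \<Rightarrow> real) \<Rightarrow> ('b \<Rightarrow> real) \<Rightarrow> ('b \<Rightarrow> nat)
    \<Rightarrow> real \<Rightarrow> nat \<Rightarrow> nat set \<Rightarrow> nat \<Rightarrow> 'b \<Rightarrow> complex" where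
  "c_hat x0 A Bext mB v mu p \<theta> tau' Eta l j = (\<Sum>\<eta>\<in>Eta.
       inverse ((omega tau' ^ \<eta>) ^ l)
       * ((\<Sum>i\<in>UNIV. \<Sum>k\<in>UNIV. complex_of_real (x0 i)
              * Btilde Bext mB (of_real \<theta> * omega tau' ^ \<eta>) i k
              * DeltaM p (omega tau' ^ \<eta>) k * complex_of_real (v k))
          / ((of_real \<theta> * omega tau' ^ \<eta> - 1) * complex_of_real (dDelta A \<theta> - 1)))
       * complex_of_real (mu j) * inverse (DeltaM p (omega tau' ^ \<eta>) j))"

definition xbar :: "(nat \<Rightarrow> 'b \<Rightarrow> real) \<Rightarrow> nat \<Rightarrow> 'b \<Rightarrow> real" where
  "xbar x k j = (\<Sum>l. x (l + k + 1) j)"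

end

theory Submission
  imports Defs
begin

text \<open>The generating function \<open>w(z) = \<Sum>\<^sub>k z\<^sup>k x(k)\<close> satisfies \<open>w(z) (z I - A*(z)) = z (x(0) B*(z) - x(1) A(0))\<close>
  and hence continues meromorphically by Cramer's rule. It is bounded on the unit disc, and
  \<open>z I - A*(z)\<close> is nonsingular for \<open>1 < |z| < \<theta>\<close>, because \<open>v\<^sup>t\<close> with \<open>|z| = \<theta>\<^sup>t\<close> is superharmonic by the
  weighted AM-GM inequality, strictly so by the drift condition. On the circle \<open>|z| = \<theta>\<close> the matrix is
  singular only at \<open>\<theta> u\<close> with \<open>u\<^sup>\<tau> = 1\<close>, where its null spaces are spanned by the rotated Perron vectors;
  there \<open>w\<close> has a pole of order at most \<open>m\<^sub>B + 1\<close> whose leading coefficient is read off by applying the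
  equation to the right null vector. Subtracting these leading terms gives the asymptotics of the
  coefficients of \<open>(w(z) - w(1)) / (z - 1)\<close>, which are the tails. The limits of the rescaled tails are
  therefore real and nonnegative. Since the tails decrease, if one of them vanished then all would,
  whereas their average over a period is the positive contribution of the pole at \<open>\<theta>\<close>.\<close>

section \<open>Coefficient asymptotics from poles on a circle\<close>

text \<open>The obstacle is that the equation for w cannot simply be inverted: in the closed unit
  disc the matrix does become singular, at 1 for instance, and there Cramer's quotient says nothing.
  Poles are excluded there analytically: a meromorphic function that stays bounded along some
  approach to a point has no pole at it. The same principle, used along radii, bounds the pole
  orders of the continuation of B* on the whole circle by that of its pole at \<theta>. Both strict
  inequalities of the proof, nonsingularity in the annulus and \<open>dDelta A \<theta> > 1\<close>,
  come from one object, the likelihood ratio \<open>ratio\<close> of the \<theta>-twisted kernel to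
  the original one. The first is its AM-GM gap and the second its relative entropy; either is strict
  once the ratio is not identically 1 on the support of A. The second inequality keeps the
  denominator of the leading coefficient away from 0. The index sets of the theorem, built from
  gcds, are never computed: the expansion runs over all \<tau>-th roots of unity, and the roots
  missing from the index set turn out to have coefficient 0.\<close>

lemma meromorphic_removable_if_mult_tendsto_0:
  assumes "f meromorphic_on {z0}" "((\<lambda>z. (z - z0) * f z) \<longlongrightarrow> 0) (at z0)"
  shows "\<exists>L. (f \<longlongrightarrow> L) (at z0)"
proof -
  obtain r where r: "r > 0" "f analytic_on ball z0 r - {z0}"
    using assms(1) by (auto simp: meromorphic_at_iff isolated_singularity_at_def)
  then have "f holomorphic_on ball z0 r - {z0}"
    by (simp add: analytic_imp_holomorphic)
  then obtain g where g: "g holomorphic_on ball z0 r" "\<forall>z\<in>ball z0 r - {z0}. g z = f z"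
    using holomorphic_on_extend_lim[of f "ball z0 r" z0] assms(2) r(1) by auto
  have "(g \<longlongrightarrow> g z0) (at z0)"
    using g(1) r(1) by (metis at_within_open centre_in_ball continuous_on holomorphic_on_imp_continuous_on open_ball)
  moreover have "eventually (\<lambda>z. g z = f z) (at z0)"
    using eventually_at_in_open[of "ball z0 r" z0] r(1) g(2) by (auto elim!: eventually_mono)
  ultimately show ?thesis
    by (blast intro: Lim_transform_eventually)
qed

lemma meromorphic_mult_power_tendsto:
  assumes "f meromorphic_on {z0}"
  shows "\<exists>n L. ((\<lambda>z. (z - z0) ^ n * f z) \<longlongrightarrow> L) (at z0)"
proof (cases "is_pole f z0")
  case True
  obtain r where r: "r > 0" "f analytic_on ball z0 r - {z0}"
    using assms(1) by (auto simp: meromorphic_at_iff isolated_singularity_at_def)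
  then have "f holomorphic_on ball z0 r - {z0}"
    by (simp add: analytic_imp_holomorphic)
  from zorder_exist_pole[OF this _ _ True] r(1)
  obtain r' where r': "r' > 0" "zor_poly f z0 holomorphic_on cball z0 r'"
     "\<And>w. w \<in> cball z0 r' - {z0} \<Longrightarrow> f w = zor_poly f z0 w / (w - z0) ^ nat (- zorder f z0)"
    by auto
  let ?g = "zor_poly f z0" and ?n = "nat (- zorder f z0)"
  have "?g holomorphic_on ball z0 r'"
    using r'(2) ball_subset_cball holomorphic_on_subset by blast
  then have "(?g \<longlongrightarrow> ?g z0) (at z0)"
    using r'(1) by (metis at_within_open centre_in_ball continuous_on holomorphic_on_imp_continuous_on open_ball)
  moreover have "eventually (\<lambda>z. ?g z = (z - z0) ^ ?n * f z) (at z0)"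
    using eventually_at_in_open[of "ball z0 r'" z0] r'(1) by (auto elim!: eventually_mono simp: r'(3))
  ultimately show ?thesis
    by (blast intro: Lim_transform_eventually)
next
  case False
  then obtain L where "(f \<longlongrightarrow> L) (at z0)"
    using assms by (auto simp: meromorphic_at_iff not_essential_def)
  then have "((\<lambda>z. (z - z0) ^ 0 * f z) \<longlongrightarrow> L) (at z0)"
    by simp
  then show ?thesis by blast
qed

text \<open>At a pole the modulus tends to infinity from every direction, so a bound along any set
  accumulating at the point, such as a radius or one side of a circle, excludes it.\<close>

lemma meromorphic_frequently_bounded_tendsto:
  assumes "f meromorphic_on {z0}" "\<exists>\<^sub>F z in at z0. norm (f z) \<le> C"
  shows "\<exists>L. (f \<longlongrightarrow> L) (at z0)"
proof -
  have "\<not> is_pole f z0"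
  proof
    assume "is_pole f z0"
    then have "\<forall>\<^sub>F z in at z0. norm (f z) \<ge> C + 1"
      unfolding is_pole_def filterlim_at_infinity_conv_norm_at_top filterlim_at_top by blast
    then have "\<forall>\<^sub>F z in at z0. \<not> norm (f z) \<le> C"
      by (auto elim!: eventually_mono)
    with assms(2) show False by (simp add: frequently_def)
  qed
  then show ?thesis
    using assms by (auto simp: meromorphic_at_iff not_essential_def)
qed

lemma mult_power_tendsto_0:
  fixes f :: "complex \<Rightarrow> complex"
  assumes "((\<lambda>z. (z - z0) ^ m * f z) \<longlongrightarrow> L) (at z0)" "m < n"
  shows "((\<lambda>z. (z - z0) ^ n * f z) \<longlongrightarrow> 0) (at z0)"
proof -
  have "((\<lambda>z. (z - z0) ^ (n - m) * ((z - z0) ^ m * f z)) \<longlongrightarrow> (z0 - z0) ^ (n - m) * L) (at z0)"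
    by (intro tendsto_intros assms(1))
  moreover have "(z - z0) ^ (n - m) * ((z - z0) ^ m * f z) = (z - z0) ^ n * f z" for z
    using assms(2) by (simp flip: mult.assoc power_add)
  ultimately show ?thesis using assms(2) by (simp add: zero_power)
qed

lemma one_minus_div_power_eq:
  fixes z z0 :: complex
  assumes "z0 \<noteq> 0"
  shows "(1 - z / z0) ^ m = (- 1 / z0) ^ m * (z - z0) ^ m"
proof -
  have "1 - z / z0 = (- 1 / z0) * (z - z0)"
    using assms by (simp add: field_simps)
  then show ?thesis by (simp only: power_mult_distrib)
qed

section \<open>Power series coefficients of regular functions and of single poles\<close>

text \<open>Newton's binomial series with exponent \<open>- (m + 1)\<close>; it supplies the exact
  coefficients of a pole of order \<open>Suc m\<close>.\<close>

lemma binomial_geometric_sums: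
  fixes z :: complex
  assumes "norm z < 1"
  shows "(\<lambda>k. of_nat ((k + m) choose m) * z ^ k) sums (1 / (1 - z) ^ Suc m)"
proof -
  have "(\<lambda>n. (- of_nat (Suc m) gchoose n) * (- z) ^ n) sums (1 + - z) powr (- of_nat (Suc m))"
    by (rule gen_binomial_complex) (use assms in simp)
  moreover have "(- of_nat (Suc m) gchoose n) * (- z) ^ n = of_nat ((n + m) choose m) * z ^ n" for n
  proof -
    have "(- of_nat (Suc m) gchoose n :: complex) = (-1) ^ n * (of_nat (n + m) gchoose n)"
      by (subst gbinomial_minus) (simp add: add.commute)
    also have "(of_nat (n + m) gchoose n :: complex) = of_nat ((n + m) choose m)"
      by (metis add.commute add_diff_cancel_right' binomial_gbinomial binomial_symmetric le_add1)
    finally have "(- of_nat (Suc m) gchoose n) * (- z) ^ n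
        = ((-1) ^ n * (-1) ^ n) * (of_nat ((n + m) choose m) * z ^ n)"
      by (subst power_minus[of z]) (simp only: mult_ac)
    then show ?thesis by (simp flip: power_mult_distrib)
  qed
  moreover have "(1 + - z) powr (- of_nat (Suc m)) = 1 / (1 - z) ^ Suc m"
  proof -
    have "1 + - z \<noteq> 0" using assms by auto
    then show ?thesis by (subst powr_minus, subst powr_nat') (auto simp: divide_inverse)
  qed
  ultimately show ?thesis by simp
qed

text \<open>Only a punctured neighbourhood of 0 is used, because a meromorphic function may carry
  any value at 0 itself. Once the lower coefficients vanish, dividing by \<open>z ^ n\<close> and
  letting z tend to 0 isolates \<open>h n\<close>.\<close>

lemma powser_sums_zero_coeff:
  fixes h :: "nat \<Rightarrow> complex"
  assumes "d > 0" "\<And>z. z \<noteq> 0 \<Longrightarrow> norm z < d \<Longrightarrow> (\<lambda>n. h n * z ^ n) sums 0"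
  shows "h n = 0"
proof (induction n rule: less_induct)
  case (less n)
  have "(\<lambda>k. h (k + n) * z ^ k) sums 0" if "z \<noteq> 0" "norm z < d" for z
  proof -
    have "(\<lambda>k. h (k + n) * z ^ (k + n)) sums (0 - (\<Sum>i<n. h i * z ^ i))"
      by (intro sums_split_initial_segment assms that)
    then have "(\<lambda>k. h (k + n) * z ^ (k + n) / z ^ n) sums ((0 - (\<Sum>i<n. h i * z ^ i)) / z ^ n)"
      by (rule sums_divide)
    then show ?thesis using less that(1) by (simp add: power_add)
  qed
  then have "((\<lambda>_. 0) \<longlongrightarrow> h (0 + n)) (at (0::complex))"
    by (intro powser_limit_0_strong[of d "\<lambda>k. h (k + n)"] assms(1)) auto
  then have "0 = h (0 + n)"
    by (intro tendsto_unique[OF _ tendsto_const]) auto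
  then show ?case by simp
qed

lemma open_enlarge_cball:
  fixes V :: "complex set"
  assumes r: "\<theta> > 0" and V: "open V" "cball 0 \<theta> \<subseteq> V"
  obtains e where "e > 0" "ball 0 (\<theta> + e) \<subseteq> V"
proof -
  obtain e where e: "e > 0" "(\<Union>x\<in>cball 0 \<theta>. ball x e) \<subseteq> V"
    using compact_subset_open_imp_ball_epsilon_subset[of "cball (0::complex) \<theta>" V] V by force
  have "ball 0 (\<theta> + e) \<subseteq> V"
  proof
    fix z :: complex assume z: "z \<in> ball 0 (\<theta> + e)"
    show "z \<in> V"
    proof (cases "norm z \<le> \<theta>")
      case True then show ?thesis using V(2) by auto
    next
      case False
      \<comment> \<open>The radial projection of z onto the circle, which is the nearest point of
        the closed disc.\<close>
      define x where "x = of_real (\<theta> / norm z) * z"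
      have n: "norm z > 0" "norm z > \<theta>" using False r by auto
      have "norm x \<le> \<theta>" using n r by (simp add: x_def norm_mult norm_divide)
      moreover have "dist x z < e"
      proof -
        have "x - z = of_real (\<theta> / norm z - 1) * z" by (simp add: x_def algebra_simps)
        then have "dist x z = \<bar>\<theta> / norm z - 1\<bar> * norm z"
          by (simp only: dist_norm norm_mult norm_of_real)
        also have "\<dots> = norm z - \<theta>"
          using n by (simp add: abs_if field_simps)
        finally show ?thesis using z by simp
      qed
      ultimately show ?thesis using e(2) by (auto simp: subset_eq)
    qed
  qed
  with e(1) show ?thesis by (rule that)
qed

text \<open>With its removable singularities filled in, F is holomorphic on a neighbourhood of the
  closed disc, hence by compactness on a larger disc. Its series then converges at \<theta> itself,
  so the terms \<open>f k * \<theta> ^ k\<close> are bounded.\<close>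

lemma coeff_bigo_if_regular:
  fixes f :: "nat \<Rightarrow> complex"
  assumes r: "\<theta> > 0"
    and mero: "F meromorphic_on cball 0 \<theta>"
    and reg: "\<And>z. norm z \<le> \<theta> \<Longrightarrow> \<exists>L. (F \<longlongrightarrow> L) (at z)"
    and ser: "\<forall>\<^sub>F z in at 0. (\<lambda>k. f k * z ^ k) sums F z"
  shows "f \<in> O(\<lambda>k. of_real (1 / \<theta> ^ k))"
proof -
  let ?G = "remove_sings F"
  have "?G analytic_on cball 0 \<theta>"
  proof (subst analytic_on_analytic_at, intro ballI)
    fix z :: complex assume "z \<in> cball 0 \<theta>"
    then show "?G analytic_on {z}"
      using reg[of z] mero by (metis meromorphic_on_isolated_singularity meromorphic_on_meromorphic_at
            mem_cball_0 remove_sings_analytic_at)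
  qed
  then obtain V where V: "open V" "cball 0 \<theta> \<subseteq> V" "?G holomorphic_on V"
    by (metis analytic_on_holomorphic)
  obtain e where e: "e > 0" "ball 0 (\<theta> + e) \<subseteq> V"
    by (rule open_enlarge_cball[OF r V(1,2)])
  then have holG: "?G holomorphic_on ball 0 (\<theta> + e)"
    using V(3) holomorphic_on_subset by blast
  define g where "g = (\<lambda>n. (deriv ^^ n) ?G 0 / fact n)"
  have gs: "(\<lambda>n. g n * z ^ n) sums ?G z" if "norm z < \<theta> + e" for z
    using holomorphic_power_series[OF holG, of z] that by (simp add: g_def)
  have iso: "isolated_singularity_at F 0"
    using mero r by (metis meromorphic_on_isolated_singularity meromorphic_on_meromorphic_at mem_cball_0 norm_zero less_imp_le)
  have ev: "\<forall>\<^sub>F z in at 0. (\<lambda>n. f n * z ^ n) sums ?G z"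
    using ser eventually_remove_sings_eq_at[OF iso] by eventually_elim simp
  have "f = g"
  proof -
    obtain d where d: "d > 0" "\<And>z. z \<noteq> 0 \<Longrightarrow> norm z < d \<Longrightarrow> (\<lambda>n. f n * z ^ n) sums ?G z"
      using ev unfolding eventually_at by (auto simp: dist_norm)
    define d' where "d' = min d \<theta>"
    have "(\<lambda>n. (f n - g n) * z ^ n) sums 0" if "z \<noteq> 0" "norm z < d'" for z
      using sums_diff[OF d(2)[OF that(1)] gs[of z]] that e(1) by (simp add: d'_def algebra_simps)
    then have "f n - g n = 0" for n
      by (intro powser_sums_zero_coeff[of d' "\<lambda>n. f n - g n"]) (use d(1) r in \<open>auto simp: d'_def\<close>)
    then show ?thesis by auto
  qed
  then have "(\<lambda>n. f n * of_real \<theta> ^ n) sums ?G (of_real \<theta>)"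
    using gs[of "of_real \<theta>"] r e(1) by simp
  then have "(\<lambda>n. f n * of_real \<theta> ^ n) \<longlonglongrightarrow> 0"
    by (intro summable_LIMSEQ_zero sums_summable)
  then have "Bseq (\<lambda>n. f n * of_real \<theta> ^ n)"
    by (intro convergent_imp_Bseq convergentI)
  then obtain K where K: "K > 0" "\<And>n. norm (f n * of_real \<theta> ^ n) \<le> K"
    by (auto simp: Bseq_def)
  show ?thesis
  proof (rule bigoI[of _ K], rule eventuallyI)
    fix n show "norm (f n) \<le> K * norm (of_real (1 / \<theta> ^ n) :: complex)"
      using K(2)[of n] r by (simp add: norm_mult norm_power norm_divide field_simps)
  qed
qed

lemma power_minus_root_eq:
  fixes z z0 :: complex
  assumes "z0 \<noteq> 0"
  shows "(z - z0) ^ m = (- z0) ^ m * (1 - z / z0) ^ m"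
proof -
  have "z - z0 = (- z0) * (1 - z / z0)"
    using assms by (simp add: field_simps)
  then show ?thesis by (simp only: power_mult_distrib)
qed

section \<open>Peeling off the poles on the boundary circle\<close>

text \<open>Regularity is expressed by limits, since the values of a meromorphic function at its
  singularities carry no information. The series has to represent F only near 0, which already fixes
  the coefficients; poles can occur on the circle alone.\<close>

definition disc_series :: "real \<Rightarrow> (nat \<Rightarrow> complex) \<Rightarrow> (complex \<Rightarrow> complex) \<Rightarrow> bool" where
  "disc_series \<theta> f F \<longleftrightarrow> F meromorphic_on cball 0 \<theta> \<and>
     (\<forall>z. norm z < \<theta> \<longrightarrow> (\<exists>L. (F \<longlongrightarrow> L) (at z))) \<and>
     (\<forall>\<^sub>F z in at 0. (\<lambda>k. f k * z ^ k) sums F z)"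

text \<open>Each subtracted fraction has explicit coefficients and cancels the term of order
  \<open>Suc m\<close> at its own point. What is left at z tends to 0 after multiplication by
  \<open>(w - z) ^ Suc m\<close>, and Riemann's theorem on removable singularities then lowers the
  order by one.\<close>

lemma subtract_leading_poles:
  assumes r: "\<theta> > 0" and series: "disc_series \<theta> f F"
    and lim: "\<And>z. norm z = \<theta> \<Longrightarrow> ((\<lambda>w. (1 - w / z) ^ Suc m * F w) \<longlongrightarrow> C z) (at z)"
    and P: "finite P" "\<And>z. z \<in> P \<Longrightarrow> norm z = \<theta>" "\<And>z. norm z = \<theta> \<Longrightarrow> z \<notin> P \<Longrightarrow> C z = 0"
  defines "G \<equiv> \<lambda>w. F w - (\<Sum>z\<in>P. C z / (1 - w / z) ^ Suc m)"
    and "g \<equiv> \<lambda>k. f k - (\<Sum>z\<in>P. C z * of_nat ((k + m) choose m) / z ^ k)"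
  shows "disc_series \<theta> g G"
    and "\<And>z. norm z = \<theta> \<Longrightarrow> \<exists>L. ((\<lambda>w. (w - z) ^ m * G w) \<longlongrightarrow> L) (at z)"
proof -
  note mero = series[unfolded disc_series_def, THEN conjunct1]
    and reg = series[unfolded disc_series_def, THEN conjunct2, THEN conjunct1, rule_format]
    and ser = series[unfolded disc_series_def, THEN conjunct2, THEN conjunct2]
  have P0: "z \<noteq> 0" if "z \<in> P" for z using P(2)[OF that] r by auto
  have meroG: "G meromorphic_on cball 0 \<theta>"
    unfolding G_def by (intro meromorphic_intros mero)
  have regG: "\<exists>L. (G \<longlongrightarrow> L) (at z)" if z: "norm z < \<theta>" for z
  proof -
    obtain L where L: "(F \<longlongrightarrow> L) (at z)" using reg z by blast
    have "1 - z / y \<noteq> 0" if "y \<in> P" for y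
      using P(2)[OF that] z by auto
    then have "(G \<longlongrightarrow> L - (\<Sum>y\<in>P. C y / (1 - z / y) ^ Suc m)) (at z)"
      unfolding G_def by (intro tendsto_intros L) (auto simp: P0)
    then show ?thesis by blast
  qed
  have "\<forall>\<^sub>F z::complex in at 0. norm z < \<theta>"
    using r by (auto simp: eventually_at dist_norm)
  with ser have "\<forall>\<^sub>F z in at 0. (\<lambda>k. g k * z ^ k) sums G z"
  proof eventually_elim
    case (elim z)
    have "(\<lambda>k. C y * of_nat ((k + m) choose m) / y ^ k * z ^ k) sums (C y / (1 - z / y) ^ Suc m)"
      if "y \<in> P" for y
    proof -
      have "norm (z / y) < 1" using elim P(2)[OF that] r by (simp add: norm_divide)
      from sums_mult[OF binomial_geometric_sums[OF this, of m], of "C y"]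
      show ?thesis by (simp add: power_divide mult_ac)
    qed
    then have "(\<lambda>k. \<Sum>y\<in>P. C y * of_nat ((k + m) choose m) / y ^ k * z ^ k) sums (\<Sum>y\<in>P. C y / (1 - z / y) ^ Suc m)"
      by (rule sums_sum)
    from sums_diff[OF elim(1) this] show ?case
      by (simp add: g_def G_def left_diff_distrib sum_distrib_right)
  qed
  with meroG regG show "disc_series \<theta> g G" by (simp add: disc_series_def)
  show "\<exists>L. ((\<lambda>w. (w - z) ^ m * G w) \<longlongrightarrow> L) (at z)" if z: "norm z = \<theta>" for z
  proof (rule meromorphic_removable_if_mult_tendsto_0)
    have "G meromorphic_on {z}"
      using meroG z by (auto intro: meromorphic_on_subset)
    then show "(\<lambda>w. (w - z) ^ m * G w) meromorphic_on {z}"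
      by (intro meromorphic_intros)
    have z0: "z \<noteq> 0" using z r by auto
    \<comment> \<open>The fractions belonging to other points are continuous at z and are killed by
      the factor that vanishes there.\<close>
    have summand: "((\<lambda>w. (1 - w / z) ^ Suc m * (C y / (1 - w / y) ^ Suc m)) \<longlongrightarrow> (if y = z then C z else 0)) (at z)"
      if y: "y \<in> P" for y
    proof (cases "y = z")
      case True
      have "\<forall>\<^sub>F w in at z. C z = (1 - w / z) ^ Suc m * (C y / (1 - w / y) ^ Suc m)"
        by (rule eventually_mono[OF eventually_neq_at_within[of z z UNIV]]) (use True z0 in auto)
      then show ?thesis using True by (auto intro: Lim_transform_eventually[OF tendsto_const])
    next
      case False
      then have "1 - z / y \<noteq> 0" using P0[OF y] by auto
      then have "((\<lambda>w. (1 - w / z) ^ Suc m * (C y / (1 - w / y) ^ Suc m)) \<longlongrightarrow>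
           (1 - z / z) ^ Suc m * (C y / (1 - z / y) ^ Suc m)) (at z)"
        by (intro tendsto_intros z0) (use P0[OF y] in auto)
      then show ?thesis using False z0 by simp
    qed
    have "((\<lambda>w. (1 - w / z) ^ Suc m * F w - (\<Sum>y\<in>P. (1 - w / z) ^ Suc m * (C y / (1 - w / y) ^ Suc m))) \<longlongrightarrow>
        C z - (\<Sum>y\<in>P. if y = z then C z else 0)) (at z)"
      by (intro tendsto_diff tendsto_sum summand lim z)
    moreover have "C z - (\<Sum>y\<in>P. if y = z then C z else 0) = 0"
      using P(1) P(3)[OF z] by (cases "z \<in> P") (auto simp: sum.delta)
    ultimately have *: "((\<lambda>w. (1 - w / z) ^ Suc m * G w) \<longlongrightarrow> 0) (at z)"
      unfolding G_def right_diff_distrib sum_distrib_left by simp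
    have "((\<lambda>w. (- z) ^ Suc m * ((1 - w / z) ^ Suc m * G w)) \<longlongrightarrow> (- z) ^ Suc m * 0) (at z)"
      by (intro tendsto_intros *)
    moreover have "(- z) ^ Suc m * ((1 - w / z) ^ Suc m * G w) = (w - z) * ((w - z) ^ m * G w)" for w
    proof -
      have "(w - z) * ((w - z) ^ m * G w) = (w - z) ^ Suc m * G w" by simp
      also have "\<dots> = (- z) ^ Suc m * (1 - w / z) ^ Suc m * G w"
        by (subst power_minus_root_eq[OF z0]) simp
      finally show ?thesis by (simp only: mult.assoc)
    qed
    ultimately show "((\<lambda>w. (w - z) * ((w - z) ^ m * G w)) \<longlongrightarrow> 0) (at z)"
      by simp
  qed
qed

lemma binomial_bigo: "(\<lambda>k. real ((k + m) choose m)) \<in> O(\<lambda>k. real k ^ m)"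
proof (rule bigoI[of _ "real (m + 1) ^ m"])
  show "\<forall>\<^sub>F k in sequentially. norm (real (k + m choose m)) \<le> real (m + 1) ^ m * norm (real k ^ m)"
  proof (rule eventually_mono[OF eventually_ge_at_top[of 1]])
    fix k :: nat assume k: "1 \<le> k"
    have "real ((k + m) choose m) \<le> real ((k + m) ^ m)"
      by (metis binomial_le_pow2 binomial_le_pow le_add2 of_nat_le_iff)
    also have "k + m \<le> (m + 1) * k" using k by (simp add: algebra_simps)
    then have "real ((k + m) ^ m) \<le> real (((m + 1) * k) ^ m)"
      by (metis of_nat_le_iff power_mono zero_le)
    also have "real (((m + 1) * k) ^ m) = real (m + 1) ^ m * real k ^ m"
      by (simp only: of_nat_power of_nat_mult power_mult_distrib)
    finally show "norm (real (k + m choose m)) \<le> real (m + 1) ^ m * norm (real k ^ m)"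
      by simp
  qed
qed

text \<open>By the absorption identity \<open>(m + 1) * (k + m + 1 choose m + 1) = (k + m + 1) * (k
  + m choose m)\<close>, passing from m to \<open>m + 1\<close> multiplies the error by k up to a
  constant and adds \<open>k + m choose m\<close>, which is itself of order \<open>k ^ m\<close>.
  For \<open>m = 1\<close> the difference is the constant 1.\<close>

lemma binomial_diff_bigo:
  assumes "m \<ge> 1"
  shows "(\<lambda>k. real ((k + m) choose m) - real k ^ m / fact m) \<in> O(\<lambda>k. real k ^ (m - 1))"
  using assms
proof (induction m rule: dec_induct)
  case base
  then show ?case by (auto intro!: bigoI[of _ 1])
next
  case (step m)
  have eq: "real ((k + Suc m) choose Suc m) - real k ^ Suc m / fact (Suc m)
     = (real k / real (Suc m)) * (real ((k + m) choose m) - real k ^ m / fact m)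
       + real ((k + m) choose m)" for k
  proof -
    have "real (Suc m) * real ((k + Suc m) choose Suc m) = real (k + Suc m) * real ((k + m) choose m)"
      by (metis Suc_times_binomial_eq add_Suc_right mult.commute of_nat_mult)
    then have "real ((k + Suc m) choose Suc m) = (real k / real (Suc m) + 1) * real ((k + m) choose m)"
      by (simp add: field_simps)
    moreover have "real k ^ Suc m / fact (Suc m) = (real k / real (Suc m)) * (real k ^ m / fact m)"
      by (simp add: field_simps)
    ultimately show ?thesis by (simp only: algebra_simps)
  qed
  have "(\<lambda>k. (real k / real (Suc m)) * (real ((k + m) choose m) - real k ^ m / fact m))
      \<in> O(\<lambda>k. real k * real k ^ (m - 1))"
    by (intro landau_o.big.mult step.IH) auto
  moreover have "real k * real k ^ (m - 1) = real k ^ m" for k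
    using step(1) by (simp add: power_eq_if)
  ultimately show ?case
    unfolding eq using binomial_bigo[of m] by (auto intro: sum_in_bigo)
qed

lemma circle_sum_bigo:
  assumes r: "\<theta> > 0" and P: "\<And>z. z \<in> P \<Longrightarrow> norm z = \<theta>" and a: "a \<in> O(\<lambda>k. real k ^ e)"
  shows "(\<lambda>k. \<Sum>z\<in>P. C z / z ^ k * of_real (a k)) \<in> O(\<lambda>k. complex_of_real (real k ^ e / \<theta> ^ k))"
proof (rule big_sum_in_bigo)
  fix z assume z: "z \<in> P"
  obtain K where K: "\<forall>\<^sub>F k in sequentially. norm (a k) \<le> K * norm (real k ^ e)"
    using a by (auto elim!: landau_o.bigE)
  show "(\<lambda>k. C z / z ^ k * of_real (a k)) \<in> O(\<lambda>k. complex_of_real (real k ^ e / \<theta> ^ k))"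
  proof (rule bigoI[of _ "norm (C z) * K"], rule eventually_mono[OF K])
    fix k :: nat assume k: "norm (a k) \<le> K * norm (real k ^ e)"
    have "norm (C z / z ^ k * of_real (a k)) = norm (C z) * norm (a k) / \<theta> ^ k"
      using P[OF z] by (simp add: norm_mult norm_divide norm_power)
    also have "\<dots> \<le> norm (C z) * (K * real k ^ e) / \<theta> ^ k"
      using k r by (intro divide_right_mono mult_left_mono) auto
    finally show "norm (C z / z ^ k * of_real (a k))
        \<le> norm (C z) * K * norm (complex_of_real (real k ^ e / \<theta> ^ k))"
      using r by (simp add: norm_divide norm_power)
  qed
qed

text \<open>Induction on the pole order: the leading terms are peeled off and estimated directly,
  and the rest falls under the induction hypothesis. The truncated \<open>m - 1\<close> gives
  regular functions and simple poles the same bound \<open>1 / \<theta> ^ k\<close>.\<close>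

lemma circle_poles_coeff_bigo:
  assumes r: "\<theta> > 0" and "disc_series \<theta> f F"
    and "\<And>z. norm z = \<theta> \<Longrightarrow> \<exists>L. ((\<lambda>w. (w - z) ^ m * F w) \<longlongrightarrow> L) (at z)"
  shows "f \<in> O(\<lambda>k. of_real (real k ^ (m - 1) / \<theta> ^ k))"
  using assms(2-)
proof (induction m arbitrary: f F)
  case 0
  have "f \<in> O(\<lambda>k. of_real (1 / \<theta> ^ k))"
  proof (rule coeff_bigo_if_regular[OF r])
    show "\<exists>L. (F \<longlongrightarrow> L) (at z)" if "norm z \<le> \<theta>" for z
      using "0.prems"(1) "0.prems"(2)[of z] that by (cases "norm z = \<theta>") (auto simp: disc_series_def)
  qed (use "0.prems"(1) in \<open>auto simp: disc_series_def\<close>)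
  then show ?case by simp
next
  case (Suc m)
  have mero: "F meromorphic_on cball 0 \<theta>" using Suc.prems(1) by (simp add: disc_series_def)
  have "\<exists>L. ((\<lambda>w. (1 - w / z) ^ Suc m * F w) \<longlongrightarrow> L) (at z)" if z: "norm z = \<theta>" for z
  proof -
    obtain L where L: "((\<lambda>w. (w - z) ^ Suc m * F w) \<longlongrightarrow> L) (at z)"
      using Suc.prems(2) z by blast
    have "z \<noteq> 0" using z r by auto
    then have "((\<lambda>w. (1 - w / z) ^ Suc m * F w) \<longlongrightarrow> (- 1 / z) ^ Suc m * L) (at z)"
      using tendsto_mult_left[OF L, of "(- 1 / z) ^ Suc m"]
      by (simp only: one_minus_div_power_eq[OF \<open>z \<noteq> 0\<close>] mult.assoc)
    then show ?thesis by blast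
  qed
  then obtain C where C: "\<And>z. norm z = \<theta> \<Longrightarrow> ((\<lambda>w. (1 - w / z) ^ Suc m * F w) \<longlongrightarrow> C z) (at z)"
    by metis
  define P where "P = {z. norm z = \<theta> \<and> C z \<noteq> 0}"
  \<comment> \<open>A nonzero \<open>C z\<close> forces a singularity at z, and the singularities of
    a meromorphic function do not accumulate in the compact disc; so only finitely many fractions
    are subtracted.\<close>
  have "finite (cball 0 \<theta> \<inter> {w. \<not> F analytic_on {w}})"
    by (intro finite_not_islimpt_in_compact meromorphic_on_imp_not_islimpt_singularities[OF mero]) auto
  moreover have "P \<subseteq> cball 0 \<theta> \<inter> {w. \<not> F analytic_on {w}}"
  proof
    fix z assume z: "z \<in> P"
    then have z0: "z \<noteq> 0" using r by (auto simp: P_def)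
    have False if "F analytic_on {z}"
    proof -
      have "isCont F z" using that by (simp add: analytic_at_imp_isCont)
      then have "((\<lambda>w. (1 - w / z) ^ Suc m * F w) \<longlongrightarrow> (1 - z / z) ^ Suc m * F z) (at z)"
        using z0 by (intro tendsto_intros) (auto simp: isCont_def)
      then have "C z = (1 - z / z) ^ Suc m * F z"
        using C[of z] z by (intro tendsto_unique[OF _ C[of z]]) (auto simp: P_def)
      then show False using z z0 by (simp add: P_def)
    qed
    then show "z \<in> cball 0 \<theta> \<inter> {w. \<not> F analytic_on {w}}" using z by (auto simp: P_def)
  qed
  ultimately have "finite P" using finite_subset by blast
  then have P: "finite P" "\<And>z. z \<in> P \<Longrightarrow> norm z = \<theta>" "\<And>z. norm z = \<theta> \<Longrightarrow> z \<notin> P \<Longrightarrow> C z = 0"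
    by (auto simp: P_def)
  note sub = subtract_leading_poles[OF r Suc.prems(1) C P]
  have "(\<lambda>k. f k - (\<Sum>z\<in>P. C z * of_nat ((k + m) choose m) / z ^ k))
      \<in> O(\<lambda>k. of_real (real k ^ (m - 1) / \<theta> ^ k))" (is "?g \<in> _")
    by (rule Suc.IH[OF sub])
  also have "(\<lambda>k. of_real (real k ^ (m - 1) / \<theta> ^ k) :: complex) \<in> O(\<lambda>k. of_real (real k ^ m / \<theta> ^ k))"
  proof (rule bigoI[of _ 1], rule eventually_mono[OF eventually_ge_at_top[of 1]])
    fix k :: nat assume "1 \<le> k"
    then have "real k ^ (m - 1) \<le> real k ^ m" by (intro power_increasing) auto
    then show "norm (of_real (real k ^ (m - 1) / \<theta> ^ k) :: complex) \<le> 1 * norm (of_real (real k ^ m / \<theta> ^ k) :: complex)"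
      using r by (simp add: norm_divide norm_power divide_right_mono)
  qed
  finally have 1: "?g \<in> O(\<lambda>k. of_real (real k ^ m / \<theta> ^ k))" .
  have 2: "(\<lambda>k. \<Sum>z\<in>P. C z * of_nat ((k + m) choose m) / z ^ k) \<in> O(\<lambda>k. of_real (real k ^ m / \<theta> ^ k))"
    using circle_sum_bigo[where P = P and C = C, OF r P(2) binomial_bigo[of m]] by simp
  show ?case using sum_in_bigo(1)[OF 1 2] by simp
qed

text \<open>Without the leading terms the poles have order at most m, which contributes
  \<open>k ^ (m - 1) / \<theta> ^ k\<close>. Replacing the exact binomial coefficient by its top
  term \<open>k ^ m / fact m\<close> costs the same, for \<open>m \<ge> 1\<close>.\<close>

lemma circle_poles_coeff_asymp:
  assumes r: "\<theta> > 0" and series: "disc_series \<theta> f F"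
    and lim: "\<And>z. norm z = \<theta> \<Longrightarrow> ((\<lambda>w. (1 - w / z) ^ Suc m * F w) \<longlongrightarrow> C z) (at z)"
    and P: "finite P" "\<And>z. z \<in> P \<Longrightarrow> norm z = \<theta>" "\<And>z. norm z = \<theta> \<Longrightarrow> z \<notin> P \<Longrightarrow> C z = 0"
    and m: "m \<ge> 1"
  shows "(\<lambda>k. f k - of_real (real k ^ m / fact m) * (\<Sum>z\<in>P. C z / z ^ k))
     \<in> O(\<lambda>k. of_real (real k ^ (m - 1) / \<theta> ^ k))"
proof -
  note sub = subtract_leading_poles[OF r series lim P]
  have 1: "(\<lambda>k. f k - (\<Sum>z\<in>P. C z * of_nat ((k + m) choose m) / z ^ k))
      \<in> O(\<lambda>k. of_real (real k ^ (m - 1) / \<theta> ^ k))"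
    by (rule circle_poles_coeff_bigo[OF r sub])
  have 2: "(\<lambda>k. \<Sum>z\<in>P. C z / z ^ k * of_real (real ((k + m) choose m) - real k ^ m / fact m))
      \<in> O(\<lambda>k. of_real (real k ^ (m - 1) / \<theta> ^ k))"
    by (rule circle_sum_bigo[OF r P(2) binomial_diff_bigo[OF m]])
  have "(\<Sum>z\<in>P. C z * of_nat ((k + m) choose m) / z ^ k) - of_real (real k ^ m / fact m) * (\<Sum>z\<in>P. C z / z ^ k)
     = (\<Sum>z\<in>P. C z / z ^ k * of_real (real ((k + m) choose m) - real k ^ m / fact m))" for k
    by (simp add: sum_distrib_left algebra_simps flip: sum_subtractf)
  then have "(\<lambda>k. f k - of_real (real k ^ m / fact m) * (\<Sum>z\<in>P. C z / z ^ k))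
    = (\<lambda>k. (f k - (\<Sum>z\<in>P. C z * of_nat ((k + m) choose m) / z ^ k))
        + (\<Sum>z\<in>P. C z / z ^ k * of_real (real ((k + m) choose m) - real k ^ m / fact m)))"
    by (simp add: fun_eq_iff algebra_simps)
  then show ?thesis using sum_in_bigo(1)[OF 1 2] by simp
qed

section \<open>Poles of solutions of analytic linear systems\<close>

text \<open>The unknown is a row vector, so the left kernel is the relevant one. Superharmonicity
  and phase arguments establish this form directly; the determinant enters only to obtain
  analyticity in z.\<close>

definition left_nondegenerate :: "('n::finite \<Rightarrow> 'n \<Rightarrow> complex) \<Rightarrow> bool" where
  "left_nondegenerate M \<longleftrightarrow> (\<forall>c. (\<forall>j. (\<Sum>i\<in>UNIV. c i * M i j) = 0) \<longrightarrow> (\<forall>i. c i = 0))"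

lemma left_nondegenerate_iff_det:
  fixes M :: "'n::finite \<Rightarrow> 'n \<Rightarrow> complex"
  shows "left_nondegenerate M \<longleftrightarrow> det (\<chi> j i. M i j) \<noteq> 0"
proof -
  let ?N = "(\<chi> j i. M i j) :: complex^'n^'n"
  have eq: "?N *v x = 0 \<longleftrightarrow> (\<forall>j. (\<Sum>i\<in>UNIV. (x $ i) * M i j) = 0)" for x
    by (simp add: vec_eq_iff matrix_vector_mult_def mult.commute)
  have "det ?N \<noteq> 0 \<longleftrightarrow> (\<exists>B. B ** ?N = mat 1)"
    by (simp add: invertible_left_inverse flip: invertible_det_nz)
  also have "\<dots> \<longleftrightarrow> (\<forall>x. ?N *v x = 0 \<longrightarrow> x = 0)"
    by (rule matrix_left_invertible_ker)
  also have "\<dots> \<longleftrightarrow> left_nondegenerate M"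
  proof
    assume *: "\<forall>x. ?N *v x = 0 \<longrightarrow> x = 0"
    show "left_nondegenerate M" unfolding left_nondegenerate_def
    proof (intro allI impI)
      fix c i assume "\<forall>j. (\<Sum>i\<in>UNIV. c i * M i j) = 0"
      then have "(\<chi> i. c i) = (0 :: complex^'n)" using *[rule_format, of "\<chi> i. c i"] by (simp add: eq)
      then show "c i = 0" by (simp add: vec_eq_iff)
    qed
  next
    assume "left_nondegenerate M"
    then show "\<forall>x. ?N *v x = 0 \<longrightarrow> x = 0"
      unfolding eq by (auto simp: left_nondegenerate_def vec_eq_iff)
  qed
  finally show ?thesis by simp
qed

lemma left_nondegenerate_unique:
  assumes "left_nondegenerate M" "\<And>j. (\<Sum>i\<in>UNIV. c i * M i j) = (\<Sum>i\<in>UNIV. d i * M i j)"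
  shows "c = d"
proof
  fix i
  have "\<forall>j. (\<Sum>i\<in>UNIV. (c i - d i) * M i j) = 0"
    using assms(2) by (simp add: left_diff_distrib sum_subtractf)
  then have "c i - d i = 0"
    using assms(1)[unfolded left_nondegenerate_def, rule_format, of "\<lambda>i. c i - d i"] by blast
  then show "c i = d i" by simp
qed

text \<open>One regular point \<xi> is enough: the determinant is holomorphic on a connected set and
  nonzero at \<xi>, hence nonzero off a sparse set, and Cramer's quotients solve the transposed
  system there. At zeros of the determinant the quotients have default values, so the equation is
  claimed only on punctured neighbourhoods.\<close>

lemma meromorphic_left_solution:
  fixes M :: "complex \<Rightarrow> 'n::finite \<Rightarrow> 'n \<Rightarrow> complex"
  assumes D: "open D" "connected D"
    and hol: "\<And>i j. (\<lambda>z. M z i j) holomorphic_on D"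
    and mero: "\<And>j. (\<lambda>z. b z j) meromorphic_on D"
    and \<xi>: "\<xi> \<in> D" "left_nondegenerate (M \<xi>)"
  obtains w where "\<And>i. (\<lambda>z. w z i) meromorphic_on D"
    "\<And>z0. z0 \<in> D \<Longrightarrow> \<forall>\<^sub>F z in at z0. left_nondegenerate (M z) \<and> (\<forall>j. (\<Sum>i\<in>UNIV. w z i * M z i j) = b z j)"
proof -
  define d where "d = (\<lambda>z. det ((\<chi> j i. M z i j) :: complex^'n^'n))"
  define w where "w = (\<lambda>z k. det ((\<chi> j i. if i = k then (\<chi> j. b z j) $ j else (\<chi> j i. M z i j) $ j $ i) :: complex^'n^'n) / d z)"
  have holM: "(\<lambda>z. M z i j) meromorphic_on D" for i j
    using hol D(1) by (intro analytic_on_imp_meromorphic_on) (simp add: analytic_on_open)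
  have hold: "d holomorphic_on D"
    unfolding d_def det_def by (auto intro!: holomorphic_intros hol)
  have mw: "(\<lambda>z. w z k) meromorphic_on D" for k
  proof -
    have "(\<lambda>z. if i = k then b z j else M z i j) meromorphic_on D" for i j
      using mero holM by (cases "i = k") auto
    moreover have "d meromorphic_on D"
      using hold D(1) by (intro analytic_on_imp_meromorphic_on) (simp add: analytic_on_open)
    ultimately show ?thesis
      unfolding w_def det_def vec_lambda_beta by (auto intro!: meromorphic_intros)
  qed
  have d\<xi>: "d \<xi> \<noteq> 0" using \<xi>(2) by (simp add: left_nondegenerate_iff_det d_def)
  have ev: "\<forall>\<^sub>F z in at z0. d z \<noteq> 0" if z0: "z0 \<in> D" for z0
  proof -
    have "d meromorphic_on D"
      using hold D(1) by (intro analytic_on_imp_meromorphic_on) (simp add: analytic_on_open)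
    from meromorphic_imp_constant_or_avoid[OF this D, of 0]
    \<comment> \<open>The alternative, that d vanishes off a sparse set, contradicts its continuity
      at \<xi>.\<close>
    have "eventually (\<lambda>z. d z \<noteq> 0) (cosparse D)"
    proof
      assume "eventually (\<lambda>z. d z = 0) (cosparse D)"
      then have "\<forall>\<^sub>F z in at \<xi>. d z = 0"
        using \<xi>(1) by (metis eventually_cosparse_imp_eventually_at at_within_open D(1))
      moreover have "(d \<longlongrightarrow> d \<xi>) (at \<xi>)"
        using hold \<xi>(1) D(1) by (metis at_within_open continuous_on holomorphic_on_imp_continuous_on)
      then have "\<forall>\<^sub>F z in at \<xi>. d z \<noteq> 0"
        using d\<xi> by (rule tendsto_imp_eventually_ne)
      ultimately have "\<forall>\<^sub>F z in at \<xi>. False" by eventually_elim simp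
      then show ?thesis by simp
    qed
    then show ?thesis
      using z0 by (metis eventually_cosparse_imp_eventually_at at_within_open D(1))
  qed
  show ?thesis
  proof (rule that[OF mw])
    fix z0 assume "z0 \<in> D"
    from ev[OF this] show "\<forall>\<^sub>F z in at z0. left_nondegenerate (M z) \<and> (\<forall>j. (\<Sum>i\<in>UNIV. w z i * M z i j) = b z j)"
    proof eventually_elim
      case (elim z)
      have "((\<chi> j i. M z i j) :: complex^'n^'n) *v (\<chi> k. w z k) = (\<chi> j. b z j)"
        by (subst cramer) (use elim in \<open>auto simp: w_def d_def\<close>)
      then have "\<forall>j. (\<Sum>i\<in>UNIV. w z i * M z i j) = b z j"
        by (simp add: vec_eq_iff matrix_vector_mult_def mult.commute)
      then show ?case using elim by (simp add: left_nondegenerate_iff_det d_def)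
    qed
  qed
qed

section \<open>Pole orders and null vectors\<close>

lemma pole_order_decrease:
  fixes w :: "complex \<Rightarrow> 'n \<Rightarrow> complex"
  assumes "\<And>i. (\<lambda>z. w z i) meromorphic_on {z0}"
    and "\<And>i. ((\<lambda>z. (z - z0) ^ Suc n * w z i) \<longlongrightarrow> 0) (at z0)"
  shows "\<exists>c. \<forall>i. ((\<lambda>z. (z - z0) ^ n * w z i) \<longlongrightarrow> c i) (at z0)"
proof -
  have "\<exists>L. ((\<lambda>z. (z - z0) ^ n * w z i) \<longlongrightarrow> L) (at z0)" for i
    using assms(2)[of i]
    by (intro meromorphic_removable_if_mult_tendsto_0 meromorphic_intros assms(1)) (simp add: mult.assoc)
  then show ?thesis by metis
qed

lemma pole_order_vector_exists:
  fixes w :: "complex \<Rightarrow> 'n::finite \<Rightarrow> complex"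
  assumes "\<And>i. (\<lambda>z. w z i) meromorphic_on {z0}"
  shows "\<exists>n\<ge>m. \<exists>c. \<forall>i. ((\<lambda>z. (z - z0) ^ n * w z i) \<longlongrightarrow> c i) (at z0)"
proof -
  obtain N L where NL: "\<And>i. ((\<lambda>z. (z - z0) ^ N i * w z i) \<longlongrightarrow> L i) (at z0)"
    using meromorphic_mult_power_tendsto[OF assms] by metis
  \<comment> \<open>An exponent strictly above every component's own exponent, so that all limits
    are 0, and at least m so that a descent can stop at m.\<close>
  define n where "n = Suc (Max (range N)) + m"
  have "N i < n" for i
    unfolding n_def by (meson Max_ge finite finite_imageI le_imp_less_Suc rangeI trans_less_add1)
  then have "((\<lambda>z. (z - z0) ^ n * w z i) \<longlongrightarrow> 0) (at z0)" for i
    using mult_power_tendsto_0[OF NL] by blast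
  then show ?thesis by (intro exI[of _ n] conjI exI[of _ "\<lambda>_. 0"]) (auto simp: n_def)
qed

text \<open>Multiplied by \<open>(z - z0) ^ n\<close> with n above the order m of the right side,
  the equation loses its right side in the limit.\<close>

lemma leading_coeff_left_null:
  fixes w :: "complex \<Rightarrow> 'n::finite \<Rightarrow> complex"
  assumes M: "\<And>i j. ((\<lambda>z. M z i j) \<longlongrightarrow> M z0 i j) (at z0)"
    and ev: "\<forall>\<^sub>F z in at z0. \<forall>j. (\<Sum>i\<in>UNIV. w z i * M z i j) = b z j"
    and b: "\<And>j. ((\<lambda>z. (z - z0) ^ m * b z j) \<longlongrightarrow> \<beta> j) (at z0)"
    and c: "\<And>i. ((\<lambda>z. (z - z0) ^ n * w z i) \<longlongrightarrow> c i) (at z0)" and "m < n"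
  shows "(\<Sum>i\<in>UNIV. c i * M z0 i j) = 0"
proof -
  have "((\<lambda>z. \<Sum>i\<in>UNIV. (z - z0) ^ n * w z i * M z i j) \<longlongrightarrow> (\<Sum>i\<in>UNIV. c i * M z0 i j)) (at z0)"
    by (intro tendsto_intros c M)
  moreover have "\<forall>\<^sub>F z in at z0. (\<Sum>i\<in>UNIV. (z - z0) ^ n * w z i * M z i j) = (z - z0) ^ n * b z j"
    using ev by eventually_elim (metis (no_types, lifting) mult.assoc sum.cong sum_distrib_left)
  ultimately have "((\<lambda>z. (z - z0) ^ n * b z j) \<longlongrightarrow> (\<Sum>i\<in>UNIV. c i * M z0 i j)) (at z0)"
    by (rule Lim_transform_eventually)
  moreover have "((\<lambda>z. (z - z0) ^ n * b z j) \<longlongrightarrow> 0) (at z0)"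
    by (rule mult_power_tendsto_0[OF b \<open>m < n\<close>])
  ultimately show ?thesis by (intro tendsto_unique[of "at z0"]) auto
qed

text \<open>Descent from some large exponent: as long as it exceeds m, the leading coefficient is a
  left null vector, hence 0, and the order drops by one.\<close>

lemma nondegenerate_pole_order:
  fixes w :: "complex \<Rightarrow> 'n::finite \<Rightarrow> complex"
  assumes mero: "\<And>i. (\<lambda>z. w z i) meromorphic_on {z0}"
    and M: "\<And>i j. ((\<lambda>z. M z i j) \<longlongrightarrow> M z0 i j) (at z0)"
    and ev: "\<forall>\<^sub>F z in at z0. \<forall>j. (\<Sum>i\<in>UNIV. w z i * M z i j) = b z j"
    and b: "\<And>j. ((\<lambda>z. (z - z0) ^ m * b z j) \<longlongrightarrow> \<beta> j) (at z0)"
    and nd: "left_nondegenerate (M z0)"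
  shows "\<exists>c. \<forall>i. ((\<lambda>z. (z - z0) ^ m * w z i) \<longlongrightarrow> c i) (at z0)"
proof -
  obtain n where "n \<ge> m" "\<exists>c. \<forall>i. ((\<lambda>z. (z - z0) ^ n * w z i) \<longlongrightarrow> c i) (at z0)"
    using pole_order_vector_exists[of w, OF mero] by blast
  then show ?thesis
  proof (induction n rule: dec_induct)
    case (step n)
    then obtain c where c: "\<And>i. ((\<lambda>z. (z - z0) ^ Suc n * w z i) \<longlongrightarrow> c i) (at z0)" by blast
    have "(\<Sum>i\<in>UNIV. c i * M z0 i j) = 0" for j
      using leading_coeff_left_null[where M=M, OF M ev b c] step(1) by simp
    then have "c i = 0" for i using nd by (simp add: left_nondegenerate_def)
    then show ?case using pole_order_decrease[of w z0 n, OF mero] c step.IH by simp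
  qed
qed

text \<open>The leading coefficient is a left null vector of \<open>M z0\<close>, hence a multiple of \<open>u\<close>;
  applying the equation to the right null vector \<open>v\<close> gains one order of vanishing on the left
  and determines the multiple.\<close>

lemma simple_null_pole_limit:
  fixes w :: "complex \<Rightarrow> 'n::finite \<Rightarrow> complex"
  assumes mero: "\<And>i. (\<lambda>z. w z i) meromorphic_on {z0}"
    and M': "\<And>i j. ((\<lambda>z. M z i j) has_field_derivative M' i j) (at z0)"
    and ev: "\<forall>\<^sub>F z in at z0. \<forall>j. (\<Sum>i\<in>UNIV. w z i * M z i j) = b z j"
    and b: "\<And>j. ((\<lambda>z. (z - z0) ^ m * b z j) \<longlongrightarrow> \<beta> j) (at z0)"
    and null: "\<And>c. (\<And>j. (\<Sum>i\<in>UNIV. c i * M z0 i j) = 0) \<Longrightarrow> \<exists>\<alpha>. \<forall>i. c i = \<alpha> * u i"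
    and v: "\<And>i. (\<Sum>j\<in>UNIV. M z0 i j * v j) = 0"
    and \<kappa>: "\<kappa> = (\<Sum>i\<in>UNIV. \<Sum>j\<in>UNIV. u i * M' i j * v j)" "\<kappa> \<noteq> 0"
  shows "((\<lambda>z. (z - z0) ^ Suc m * w z i) \<longlongrightarrow> (\<Sum>j\<in>UNIV. \<beta> j * v j) / \<kappa> * u i) (at z0)"
proof -
  have M: "((\<lambda>z. M z i j) \<longlongrightarrow> M z0 i j) (at z0)" for i j
    using DERIV_isCont[OF M'] by (simp add: isCont_def)
  \<comment> \<open>Proved for every exponent \<open>n \<ge> m\<close> because it is used twice: for
    \<open>n > m\<close> the limit L is 0, so the coefficient vanishes and the descent continues;
    for \<open>n = m\<close> it is the claimed formula.\<close>
  have *: "c i = L / \<kappa> * u i"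
    if c: "\<And>i. ((\<lambda>z. (z - z0) ^ Suc n * w z i) \<longlongrightarrow> c i) (at z0)" and n: "m \<le> n"
      and L: "((\<lambda>z. (z - z0) ^ n * (\<Sum>j\<in>UNIV. b z j * v j)) \<longlongrightarrow> L) (at z0)" for c n L i
  proof -
    have "(\<Sum>i\<in>UNIV. c i * M z0 i j) = 0" for j
      using leading_coeff_left_null[where M=M, OF M ev b c] n by simp
    then obtain \<alpha> where \<alpha>: "\<And>i. c i = \<alpha> * u i" using null by blast
    have D: "((\<lambda>z. (\<Sum>j\<in>UNIV. M z i j * v j) / (z - z0)) \<longlongrightarrow> (\<Sum>j\<in>UNIV. M' i j * v j)) (at z0)" for i
    proof -
      have "((\<lambda>z. \<Sum>j\<in>UNIV. M z i j * v j) has_field_derivative (\<Sum>j\<in>UNIV. M' i j * v j)) (at z0)"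
        by (intro DERIV_sum DERIV_cmult_right M')
      then show ?thesis by (simp add: has_field_derivative_iff v)
    qed
    have "((\<lambda>z. \<Sum>i\<in>UNIV. (z - z0) ^ Suc n * w z i * ((\<Sum>j\<in>UNIV. M z i j * v j) / (z - z0))) \<longlongrightarrow>
        (\<Sum>i\<in>UNIV. c i * (\<Sum>j\<in>UNIV. M' i j * v j))) (at z0)"
      by (intro tendsto_intros c D)
    moreover have "\<forall>\<^sub>F z in at z0. (\<Sum>i\<in>UNIV. (z - z0) ^ Suc n * w z i * ((\<Sum>j\<in>UNIV. M z i j * v j) / (z - z0)))
        = (z - z0) ^ n * (\<Sum>j\<in>UNIV. b z j * v j)"
      using ev eventually_neq_at_within[of z0 z0 UNIV]
    proof eventually_elim
      case (elim z)
      have "(\<Sum>i\<in>UNIV. (z - z0) ^ Suc n * w z i * ((\<Sum>j\<in>UNIV. M z i j * v j) / (z - z0)))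
          = (z - z0) ^ n * (\<Sum>i\<in>UNIV. \<Sum>j\<in>UNIV. w z i * M z i j * v j)"
        using elim(2) by (simp add: sum_distrib_left mult.assoc sum_divide_distrib)
      also have "(\<Sum>i\<in>UNIV. \<Sum>j\<in>UNIV. w z i * M z i j * v j) = (\<Sum>j\<in>UNIV. \<Sum>i\<in>UNIV. w z i * M z i j * v j)"
        by (rule sum.swap)
      also have "\<dots> = (\<Sum>j\<in>UNIV. b z j * v j)"
        using elim(1) by (simp flip: sum_distrib_right)
      finally show ?case .
    qed
    ultimately have "((\<lambda>z. (z - z0) ^ n * (\<Sum>j\<in>UNIV. b z j * v j)) \<longlongrightarrow> (\<Sum>i\<in>UNIV. c i * (\<Sum>j\<in>UNIV. M' i j * v j))) (at z0)"
      by (rule Lim_transform_eventually)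
    then have "L = (\<Sum>i\<in>UNIV. c i * (\<Sum>j\<in>UNIV. M' i j * v j))"
      using L by (intro tendsto_unique[of "at z0"]) auto
    also have "\<dots> = \<alpha> * \<kappa>"
      by (simp add: \<alpha> \<kappa>(1) sum_distrib_left mult.assoc)
    finally show ?thesis using \<alpha> \<kappa>(2) by simp
  qed
  have bv: "((\<lambda>z. (z - z0) ^ m * (\<Sum>j\<in>UNIV. b z j * v j)) \<longlongrightarrow> (\<Sum>j\<in>UNIV. \<beta> j * v j)) (at z0)"
  proof -
    have "((\<lambda>z. \<Sum>j\<in>UNIV. (z - z0) ^ m * b z j * v j) \<longlongrightarrow> (\<Sum>j\<in>UNIV. \<beta> j * v j)) (at z0)"
      by (intro tendsto_intros b)
    then show ?thesis by (simp add: sum_distrib_left mult.assoc)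
  qed
  obtain n where "n \<ge> Suc m" "\<exists>c. \<forall>i. ((\<lambda>z. (z - z0) ^ n * w z i) \<longlongrightarrow> c i) (at z0)"
    using pole_order_vector_exists[of w, OF mero] by blast
  then have "\<exists>c. \<forall>i. ((\<lambda>z. (z - z0) ^ Suc m * w z i) \<longlongrightarrow> c i) (at z0)"
  proof (induction n rule: dec_induct)
    case (step n)
    then obtain c where c: "\<And>i. ((\<lambda>z. (z - z0) ^ Suc n * w z i) \<longlongrightarrow> c i) (at z0)" by blast
    have "((\<lambda>z. (z - z0) ^ n * (\<Sum>j\<in>UNIV. b z j * v j)) \<longlongrightarrow> 0) (at z0)"
      using mult_power_tendsto_0[OF bv] step(1) by simp
    then have "c i = 0" for i using *[OF c] step(1) by fastforce
    then show ?case using pole_order_decrease[of w z0 n, OF mero] c step.IH by simp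
  qed
  then obtain c where c: "\<And>i. ((\<lambda>z. (z - z0) ^ Suc m * w z i) \<longlongrightarrow> c i) (at z0)" by blast
  from *[OF c _ bv, of i] c[of i] show ?thesis by simp
qed

section \<open>Nonnegative irreducible matrices\<close>

definition irreducible_mat :: "('n \<Rightarrow> 'n \<Rightarrow> real) \<Rightarrow> bool" where
  "irreducible_mat Q \<longleftrightarrow> (\<forall>i j. (i, j) \<in> {(i, j). Q i j > 0}\<^sup>+)"

lemma irreducible_mat_closed_set:
  assumes "irreducible_mat Q" "i \<in> J" "\<And>i j. i \<in> J \<Longrightarrow> Q i j > 0 \<Longrightarrow> j \<in> J"
  shows "j \<in> J"
proof -
  have "(i, j) \<in> {(i, j). Q i j > 0}\<^sup>+" using assms(1) by (simp add: irreducible_mat_def)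
  then show ?thesis by (induction rule: trancl_induct) (use assms(2,3) in auto)
qed

lemma irreducible_mat_transpose:
  assumes "irreducible_mat Q"
  shows "irreducible_mat (\<lambda>i j. Q j i)"
proof -
  have "{(i, j). Q j i > 0} = {(i, j). Q i j > 0}\<inverse>" by auto
  then show ?thesis using assms by (simp add: irreducible_mat_def trancl_converse)
qed

lemma irreducible_mat_predecessor:
  assumes "irreducible_mat Q"
  shows "\<exists>i. Q i j > 0"
proof -
  have "(j, j) \<in> {(i, j). Q i j > 0}\<^sup>+" using assms by (simp add: irreducible_mat_def)
  then show ?thesis by (auto elim: tranclE)
qed

text \<open>A zero entry is a vanishing sum of nonnegative inflows, so all predecessors of k are
  zeros as well; irreducibility spreads this to every index.\<close>

lemma irreducible_left_fixed_zero:
  fixes q :: "'n::finite \<Rightarrow> real"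
  assumes "irreducible_mat Q" "\<And>i j. Q i j \<ge> 0" "\<And>i. q i \<ge> 0"
    and "\<And>j. (\<Sum>i\<in>UNIV. q i * Q i j) = q j" "q k = 0"
  shows "q i = 0"
proof -
  have "i \<in> {i. q i = 0}"
  proof (rule irreducible_mat_closed_set[OF irreducible_mat_transpose[OF assms(1)], of k])
    fix i j assume i: "i \<in> {i. q i = 0}" and p: "Q j i > 0"
    have "(\<Sum>l\<in>UNIV. q l * Q l i) = 0" using assms(4)[of i] i by simp
    then have "\<forall>l\<in>UNIV. q l * Q l i = 0"
      by (subst (asm) sum_nonneg_eq_0_iff) (auto simp: assms)
    then show "j \<in> {i. q i = 0}" using p by force
  qed (use assms in auto)
  then show ?thesis by simp
qed

text \<open>Subtract from q the largest multiple of \<mu> that leaves it nonnegative. The difference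
  is again fixed and has a zero entry, so it vanishes.\<close>

lemma irreducible_left_fixed_unique_real:
  fixes q \<mu> :: "'n::finite \<Rightarrow> real"
  assumes "irreducible_mat Q" "\<And>i j. Q i j \<ge> 0" "\<And>i. \<mu> i > 0"
    and "\<And>j. (\<Sum>i\<in>UNIV. \<mu> i * Q i j) = \<mu> j" "\<And>j. (\<Sum>i\<in>UNIV. q i * Q i j) = q j"
  shows "\<exists>\<alpha>. \<forall>i. q i = \<alpha> * \<mu> i"
proof -
  define \<alpha> where "\<alpha> = Min (range (\<lambda>i. q i / \<mu> i))"
  have "\<alpha> \<in> range (\<lambda>i. q i / \<mu> i)" unfolding \<alpha>_def by (intro Min_in) auto
  then obtain k where k: "\<alpha> = q k / \<mu> k" by auto
  have le: "\<alpha> \<le> q i / \<mu> i" for i unfolding \<alpha>_def by (intro Min_le) auto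
  have "q i - \<alpha> * \<mu> i = 0" for i
  proof (rule irreducible_left_fixed_zero[OF assms(1,2), where q = "\<lambda>i. q i - \<alpha> * \<mu> i" and k = k])
    show "q i - \<alpha> * \<mu> i \<ge> 0" for i using le[of i] assms(3)[of i] by (simp add: field_simps)
    show "(\<Sum>i\<in>UNIV. (q i - \<alpha> * \<mu> i) * Q i j) = q j - \<alpha> * \<mu> j" for j
      using assms(4,5)[of j] by (simp add: left_diff_distrib sum_subtractf mult.assoc flip: sum_distrib_left)
    show "q k - \<alpha> * \<mu> k = 0" using k assms(3)[of k] by simp
  qed
  then show ?thesis by auto
qed

lemma irreducible_left_fixed_unique:
  fixes \<mu> :: "'n::finite \<Rightarrow> real" and c :: "'n \<Rightarrow> complex"
  assumes "irreducible_mat Q" "\<And>i j. Q i j \<ge> 0" "\<And>i. \<mu> i > 0"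
    and "\<And>j. (\<Sum>i\<in>UNIV. \<mu> i * Q i j) = \<mu> j"
    and c: "\<And>j. (\<Sum>i\<in>UNIV. c i * of_real (Q i j)) = c j"
  shows "\<exists>\<alpha>. \<forall>i. c i = \<alpha> * of_real (\<mu> i)"
proof -
  have "(\<Sum>i\<in>UNIV. Re (c i) * Q i j) = Re (c j)" "(\<Sum>i\<in>UNIV. Im (c i) * Q i j) = Im (c j)" for j
    using arg_cong[OF c[of j], of Re] arg_cong[OF c[of j], of Im] by simp_all
  then obtain a b where "\<forall>i. Re (c i) = a * \<mu> i" "\<forall>i. Im (c i) = b * \<mu> i"
    using irreducible_left_fixed_unique_real[OF assms(1-4)] by meson
  then show ?thesis by (intro exI[of _ "Complex a b"]) (auto simp: complex_eq_iff)
qed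

text \<open>Pairing \<open>q Q h\<close> in both orders shows that the weighted excess of
  \<open>q Q\<close> over q and the weighted deficit of \<open>Q h\<close> below h add up to 0. All
  terms are nonnegative, so each of them is 0.\<close>

lemma left_subinvariant_imp_invariant:
  fixes q h :: "'n::finite \<Rightarrow> real"
  assumes "\<And>i. q i \<ge> 0" "\<And>i. h i > 0"
    and q: "\<And>j. q j \<le> (\<Sum>i\<in>UNIV. q i * Q i j)" and h: "\<And>i. (\<Sum>j\<in>UNIV. Q i j * h j) \<le> h i"
  shows "(\<Sum>i\<in>UNIV. q i * Q i j) = q j" "q i * (\<Sum>j\<in>UNIV. Q i j * h j) = q i * h i"
proof -
  have "(\<Sum>j\<in>UNIV. ((\<Sum>i\<in>UNIV. q i * Q i j) - q j) * h j) + (\<Sum>i\<in>UNIV. q i * (h i - (\<Sum>j\<in>UNIV. Q i j * h j))) = 0"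
  proof -
    have "(\<Sum>j\<in>UNIV. (\<Sum>i\<in>UNIV. q i * Q i j) * h j) = (\<Sum>i\<in>UNIV. q i * (\<Sum>j\<in>UNIV. Q i j * h j))"
      unfolding sum_distrib_left sum_distrib_right by (subst sum.swap) (simp add: mult.assoc)
    then show ?thesis by (simp add: algebra_simps sum_subtractf)
  qed
  moreover have 1: "((\<Sum>i\<in>UNIV. q i * Q i j) - q j) * h j \<ge> 0" for j
    using q[of j] assms(2)[of j] by simp
  moreover have 2: "q i * (h i - (\<Sum>j\<in>UNIV. Q i j * h j)) \<ge> 0" for i
    using h[of i] assms(1)[of i] by simp
  ultimately have "(\<Sum>j\<in>UNIV. ((\<Sum>i\<in>UNIV. q i * Q i j) - q j) * h j) = 0"
      "(\<Sum>i\<in>UNIV. q i * (h i - (\<Sum>j\<in>UNIV. Q i j * h j))) = 0"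
    by (smt (verit) sum_nonneg)+
  then have **: "\<forall>j. ((\<Sum>i\<in>UNIV. q i * Q i j) - q j) * h j = 0"
      and *: "\<forall>i. q i * (h i - (\<Sum>j\<in>UNIV. Q i j * h j)) = 0"
    using 1 2 by (simp_all add: sum_nonneg_eq_0_iff)
  from **[rule_format, of j] show "(\<Sum>i\<in>UNIV. q i * Q i j) = q j"
    using assms(2)[of j] by simp
  show "q i * (\<Sum>j\<in>UNIV. Q i j * h j) = q i * h i"
    using *[rule_format, of i] by auto
qed

lemma left_fixed_norm_le:
  fixes c :: "'n::finite \<Rightarrow> complex"
  assumes "\<And>i j. norm (Z i j) \<le> Q i j" "\<And>j. (\<Sum>i\<in>UNIV. c i * Z i j) = c j"
  shows "norm (c j) \<le> (\<Sum>i\<in>UNIV. norm (c i) * Q i j)"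
proof -
  have "norm (c j) \<le> (\<Sum>i\<in>UNIV. norm (c i * Z i j))"
    using assms(2)[of j] norm_sum by metis
  also have "\<dots> \<le> (\<Sum>i\<in>UNIV. norm (c i) * Q i j)"
    by (intro sum_mono) (auto simp: norm_mult intro!: mult_left_mono assms)
  finally show ?thesis .
qed

text \<open>By the triangle inequality the moduli of c are subinvariant for the dominating matrix Q,
  hence invariant. The strict inequality at k leaves no mass at k, and a zero of an invariant vector
  spreads everywhere.\<close>

lemma strictly_superharmonic_no_left_fixed:
  fixes c :: "'n::finite \<Rightarrow> complex"
  assumes irr: "irreducible_mat Q" and nn: "\<And>i j. Q i j \<ge> 0" and h0: "\<And>i. h i > 0"
    and h: "\<And>i. (\<Sum>j\<in>UNIV. Q i j * h j) \<le> h i" and strict: "(\<Sum>j\<in>UNIV. Q k j * h j) < h k"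
    and Z: "\<And>i j. norm (Z i j) \<le> Q i j" and c: "\<And>j. (\<Sum>i\<in>UNIV. c i * Z i j) = c j"
  shows "c i = 0"
proof -
  note sub = left_subinvariant_imp_invariant[where q = "\<lambda>i. norm (c i)" and h = h, OF norm_ge_zero h0 left_fixed_norm_le[OF Z c] h]
  have "norm (c k) = 0" using sub(2)[of k] strict by simp
  then have "norm (c i) = 0"
    by (rule irreducible_left_fixed_zero[OF irr nn norm_ge_zero sub(1)])
  then show ?thesis by simp
qed

section \<open>The Perron root, its eigenvector and its derivative\<close>

text \<open>A positive eigenvector majorises every other one up to a constant, so its eigenvalue has
  maximal modulus. Being real and nonnegative, it is then the only maximal eigenvalue with the
  largest real part, which settles the definite description in \<open>delta\<close>.\<close>

lemma delta_eqI:
  fixes Q :: "'n::finite \<Rightarrow> 'n \<Rightarrow> real"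
  assumes nn: "\<And>i j. Q i j \<ge> 0" and h0: "\<And>i. h i > 0" and r: "r \<ge> 0"
    and h: "\<And>i. (\<Sum>j\<in>UNIV. Q i j * h j) = r * h i"
  shows "delta (\<lambda>i j. of_real (Q i j)) = of_real r"
proof -
  let ?X = "\<lambda>i j. complex_of_real (Q i j)"
  have eig: "is_eigenvalue ?X (of_real r)"
    unfolding is_eigenvalue_def
  proof (intro exI[of _ "\<lambda>i. complex_of_real (h i)"] conjI allI)
    show "\<exists>j. complex_of_real (h j) \<noteq> 0" using h0 by (metis less_irrefl of_real_eq_0_iff)
    show "(\<Sum>j\<in>UNIV. ?X i j * of_real (h j)) = of_real r * of_real (h i)" for i
      using arg_cong[OF h[of i], of complex_of_real] by simp
  qed
  have dom: "cmod \<mu> \<le> r" if eig\<mu>: "is_eigenvalue ?X \<mu>" for \<mu>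
  proof -
    obtain u where u: "\<exists>j. u j \<noteq> 0" "\<And>i. (\<Sum>j\<in>UNIV. ?X i j * u j) = \<mu> * u i"
      using eig\<mu> unfolding is_eigenvalue_def by blast
    \<comment> \<open>The smallest factor for which \<rho> times h dominates the moduli of u; the
      eigenvalue equation is compared at an index where equality holds.\<close>
    define \<rho> where "\<rho> = Max (range (\<lambda>i. cmod (u i) / h i))"
    have "\<rho> \<in> range (\<lambda>i. cmod (u i) / h i)" unfolding \<rho>_def by (intro Max_in) auto
    then obtain k where k: "\<rho> = cmod (u k) / h k" by auto
    have le0: "cmod (u i) / h i \<le> \<rho>" for i unfolding \<rho>_def by (intro Max_ge) auto
    have le: "cmod (u i) \<le> \<rho> * h i" for i using h0[of i] le0[of i] by (simp add: pos_divide_le_eq)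
    have "\<rho> > 0"
    proof -
      obtain j where "u j \<noteq> 0" using u(1) by auto
      then have "0 < \<rho> * h j" using le[of j] by (smt (verit) zero_less_norm_iff)
      then show ?thesis using h0[of j] zero_less_mult_pos2 by blast
    qed
    have "cmod \<mu> * (\<rho> * h k) = cmod (\<Sum>j\<in>UNIV. ?X k j * u j)"
      using u(2)[of k] k h0[of k] by (simp add: norm_mult)
    also have "\<dots> \<le> (\<Sum>j\<in>UNIV. cmod (?X k j * u j))" by (rule norm_sum)
    also have "\<dots> \<le> (\<Sum>j\<in>UNIV. Q k j * (\<rho> * h j))"
      using nn le by (intro sum_mono) (auto simp: norm_mult intro!: mult_left_mono)
    also have "\<dots> = \<rho> * (\<Sum>j\<in>UNIV. Q k j * h j)" by (simp add: sum_distrib_left mult_ac)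
    also have "\<dots> = r * (\<rho> * h k)" by (simp add: h)
    finally show ?thesis using \<open>\<rho> > 0\<close> h0[of k] by (simp add: mult_le_cancel_right)
  qed
  show ?thesis unfolding delta_def
  proof (rule the_equality)
    show "is_eigenvalue ?X (of_real r) \<and> (\<forall>\<mu>. is_eigenvalue ?X \<mu> \<longrightarrow> cmod \<mu> \<le> cmod (of_real r))
      \<and> (\<forall>\<mu>. is_eigenvalue ?X \<mu> \<and> cmod \<mu> = cmod (of_real r) \<longrightarrow> Re \<mu> \<le> Re (of_real r)) \<and> 0 \<le> Im (of_real r)"
      using eig dom r by (auto intro: order_trans[OF complex_Re_le_cmod])
  next
    fix l assume l: "is_eigenvalue ?X l \<and> (\<forall>\<mu>. is_eigenvalue ?X \<mu> \<longrightarrow> cmod \<mu> \<le> cmod l)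
      \<and> (\<forall>\<mu>. is_eigenvalue ?X \<mu> \<and> cmod \<mu> = cmod l \<longrightarrow> Re \<mu> \<le> Re l) \<and> 0 \<le> Im l"
    then have "cmod l = r" using eig dom r by (metis abs_of_nonneg norm_of_real order_antisym)
    then have "r \<le> Re l" using l eig r by auto
    then have "Re l = cmod l" using complex_Re_le_cmod[of l] \<open>cmod l = r\<close> by simp
    then have "Im l = 0" by (simp add: cmod_def) (metis Im_eq_0 \<open>Re l = cmod l\<close> abs_norm_cancel)
    then show "l = of_real r" using \<open>Re l = cmod l\<close> \<open>cmod l = r\<close> by (simp add: complex_eq_iff)
  qed
qed

lemma compact_prob_simplex: "compact {x :: real^'n. (\<forall>i. 0 \<le> x $ i) \<and> (\<Sum>i\<in>UNIV. x $ i) = 1}" (is "compact ?S")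
proof -
  have "closed ?S"
    by (intro closed_Collect_conj closed_Collect_all closed_Collect_le closed_Collect_eq continuous_intros)
  moreover have "bounded ?S"
  proof (rule boundedI[of _ 1])
    fix x assume x: "x \<in> ?S"
    have "norm x \<le> (\<Sum>i\<in>UNIV. \<bar>x $ i\<bar>)" by (rule norm_le_l1_cart)
    then show "norm x \<le> 1" using x by simp
  qed
  ultimately show ?thesis by (simp add: compact_eq_bounded_closed)
qed

text \<open>Brouwer's theorem for the normalised map on the probability simplex. The normaliser
  \<open>s\<close> is positive because irreducibility puts a positive entry into every column, and a
  zero of the fixed point would spread to all indices.\<close>

lemma perron_vector_exists:
  fixes Q :: "'n::finite \<Rightarrow> 'n \<Rightarrow> real"
  assumes irr: "irreducible_mat Q" and nn: "\<And>i j. Q i j \<ge> 0"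
  obtains h r where "\<And>i. h i > 0" "r > 0" "(\<Sum>i\<in>UNIV. h i) = 1" "\<And>i. (\<Sum>j\<in>UNIV. Q i j * h j) = r * h i"
proof -
  define S where "S = {x :: real^'n. (\<forall>i. 0 \<le> x $ i) \<and> (\<Sum>i\<in>UNIV. x $ i) = 1}"
  define s where "s = (\<lambda>x :: real^'n. \<Sum>i\<in>UNIV. \<Sum>j\<in>UNIV. Q i j * x $ j)"
  define f where "f = (\<lambda>x :: real^'n. \<chi> i. (\<Sum>j\<in>UNIV. Q i j * x $ j) / s x)"
  have s_pos: "s x > 0" if x: "x \<in> S" for x
  proof -
    have nnt: "(\<Sum>j\<in>UNIV. Q i j * x $ j) \<ge> 0" for i using x nn by (auto simp: S_def intro!: sum_nonneg)
    have "\<exists>j. x $ j \<noteq> 0" using x by (auto simp: S_def intro: ccontr)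
    then obtain j where j: "x $ j > 0" using x by (auto simp: S_def less_le)
    obtain i where "Q i j > 0" using irreducible_mat_predecessor[OF irr] by blast
    then have "0 < Q i j * x $ j" using j by simp
    also have "\<dots> \<le> (\<Sum>j\<in>UNIV. Q i j * x $ j)"
      using x nn by (intro member_le_sum) (auto simp: S_def)
    also have "\<dots> \<le> s x" unfolding s_def by (rule member_le_sum[where f = "\<lambda>i. \<Sum>j\<in>UNIV. Q i j * x $ j"]) (auto simp: nnt)
    finally show ?thesis .
  qed
  have "compact S" unfolding S_def by (rule compact_prob_simplex)
  moreover have "convex S"
    unfolding S_def convex_def by (auto simp: sum.distrib simp flip: sum_distrib_left)
  moreover have "S \<noteq> {}"
  proof -
    obtain k :: 'n where True by blast
    have "axis k 1 \<in> S" by (auto simp: S_def axis_def sum.delta)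
    then show ?thesis by blast
  qed
  moreover have "continuous_on S f"
  proof -
    have "continuous_on S s" unfolding s_def by (intro continuous_intros)
    moreover have "\<forall>x\<in>S. s x \<noteq> 0" using s_pos by fastforce
    ultimately show ?thesis unfolding f_def by (intro continuous_on_vec_lambda continuous_intros) auto
  qed
  moreover have "f \<in> S \<rightarrow> S"
  proof
    fix x assume x: "x \<in> S"
    have "(\<Sum>i\<in>UNIV. f x $ i) = 1" using s_pos[OF x] by (simp add: f_def flip: sum_divide_distrib) (simp add: s_def)
    moreover have "f x $ i \<ge> 0" for i
      using x nn s_pos[OF x] by (auto simp: f_def S_def intro!: divide_nonneg_pos sum_nonneg)
    ultimately show "f x \<in> S" by (simp add: S_def)
  qed
  ultimately obtain x where x: "x \<in> S" "f x = x" by (rule brouwer)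
  have sx: "s x > 0" by (rule s_pos[OF x(1)])
  have eq: "(\<Sum>j\<in>UNIV. Q i j * x $ j) = s x * x $ i" for i
    using arg_cong[OF x(2), of "\<lambda>y. y $ i"] sx by (simp add: f_def field_simps)
  have "x $ i \<noteq> 0" for i
  proof
    assume "x $ i = 0"
    have "j \<in> {j. x $ j = 0}" for j
    proof (rule irreducible_mat_closed_set[OF irr, of i])
      fix a b assume a: "a \<in> {j. x $ j = 0}" and p: "Q a b > 0"
      have "(\<Sum>j\<in>UNIV. Q a j * x $ j) = 0" using eq[of a] a by simp
      then have "\<forall>j\<in>UNIV. Q a j * x $ j = 0"
        by (subst (asm) sum_nonneg_eq_0_iff) (use x nn in \<open>auto simp: S_def\<close>)
      then show "b \<in> {j. x $ j = 0}" using p by force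
    qed (use \<open>x $ i = 0\<close> in auto)
    then show False using x(1) by (simp add: S_def)
  qed
  then have "x $ i > 0" for i using x(1) by (auto simp: S_def less_le)
  then show ?thesis using that[of "\<lambda>i. x $ i" "s x"] sx eq x(1) by (auto simp: S_def)
qed

lemma irreducible_right_eigenvector_unique:
  fixes v h :: "'n::finite \<Rightarrow> real"
  assumes "irreducible_mat Q" "\<And>i j. Q i j \<ge> 0" "\<And>i. v i > 0" "r > 0"
    and "\<And>i. (\<Sum>j\<in>UNIV. Q i j * v j) = r * v i" "\<And>i. (\<Sum>j\<in>UNIV. Q i j * h j) = r * h i"
  shows "\<exists>\<alpha>. \<forall>i. h i = \<alpha> * v i"
proof (rule irreducible_left_fixed_unique_real[where Q = "\<lambda>j i. Q i j / r"])
  have "irreducible_mat (\<lambda>j i. Q i j)" by (rule irreducible_mat_transpose) fact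
  then show "irreducible_mat (\<lambda>j i. Q i j / r)"
    using assms(4) by (simp add: irreducible_mat_def zero_less_divide_iff)
  have "(\<Sum>j\<in>UNIV. u j * (Q i j / r)) = (\<Sum>j\<in>UNIV. Q i j * u j) / r" for u i
    by (simp add: sum_divide_distrib mult.commute)
  then show "(\<Sum>j\<in>UNIV. v j * (Q i j / r)) = v i" "(\<Sum>j\<in>UNIV. h j * (Q i j / r)) = h i" for i
    using assms(4,5,6) by simp_all
qed (use assms in auto)

text \<open>By compactness: away from v the residual \<open>g\<close> of the eigenvector equation
  has a positive minimum on the simplex, since v is the only eigenvector for r there. Probability
  vectors with vanishing residual must therefore approach v.\<close>

lemma perron_vector_tendsto:
  fixes Q :: "'n::finite \<Rightarrow> 'n \<Rightarrow> real" and h :: "'a \<Rightarrow> 'n \<Rightarrow> real"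
  assumes irr: "irreducible_mat Q" and nn: "\<And>i j. Q i j \<ge> 0"
    and v0: "\<And>i. v i > 0" and r: "r > 0" and v: "\<And>i. (\<Sum>j\<in>UNIV. Q i j * v j) = r * v i"
    and v1: "(\<Sum>i\<in>UNIV. v i) = 1"
    and h0: "\<forall>\<^sub>F y in F. (\<forall>i. h y i \<ge> 0) \<and> (\<Sum>i\<in>UNIV. h y i) = 1"
    and lim: "\<And>i. ((\<lambda>y. (\<Sum>j\<in>UNIV. Q i j * h y j) - r * h y i) \<longlongrightarrow> 0) F"
  shows "((\<lambda>y. h y i) \<longlongrightarrow> v i) F"
proof -
  define V where "V = (\<chi> i. v i)"
  define g where "g = (\<lambda>x :: real^'n. \<Sum>i\<in>UNIV. \<bar>(\<Sum>j\<in>UNIV. Q i j * x $ j) - r * x $ i\<bar>)"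
  have glim: "((\<lambda>y. g (\<chi> i. h y i)) \<longlongrightarrow> 0) F"
  proof -
    have "((\<lambda>y. g (\<chi> i. h y i)) \<longlongrightarrow> (\<Sum>i\<in>(UNIV :: 'n set). \<bar>0\<bar>)) F"
      unfolding g_def vec_lambda_beta by (intro tendsto_sum tendsto_rabs lim)
    then show ?thesis by simp
  qed
  have "((\<lambda>y. (\<chi> i. h y i) :: real^'n) \<longlongrightarrow> V) F"
  proof (rule tendstoI)
    fix e :: real assume e: "e > 0"
    define S where "S = {x :: real^'n. (\<forall>i. 0 \<le> x $ i) \<and> (\<Sum>i\<in>UNIV. x $ i) = 1 \<and> e \<le> dist x V}"
    have "closed {x. e \<le> dist x V}" by (intro closed_Collect_le continuous_intros)
    from compact_Int_closed[OF compact_prob_simplex this] have "compact S"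
      unfolding S_def by (simp add: Int_def conj_assoc)
    have gpos: "g x > 0" if x: "x \<in> S" for x
    proof -
      have "g x \<noteq> 0"
      proof
        assume "g x = 0"
        then have "(\<Sum>j\<in>UNIV. Q i j * x $ j) = r * x $ i" for i
          unfolding g_def by (subst (asm) sum_nonneg_eq_0_iff) auto
        then obtain \<alpha> where \<alpha>: "\<And>i. x $ i = \<alpha> * v i"
          using irreducible_right_eigenvector_unique[OF irr nn v0 r v, of "\<lambda>i. x $ i"] by blast
        then have "\<alpha> = 1" using x v1 by (simp add: S_def flip: sum_distrib_left)
        then have "x = V" by (simp add: V_def vec_eq_iff \<alpha>)
        then show False using x e by (simp add: S_def)
      qed
      moreover have "g x \<ge> 0" unfolding g_def by (intro sum_nonneg) auto
      ultimately show ?thesis by simp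
    qed
    have "\<exists>m>0. \<forall>x\<in>S. m \<le> g x"
    proof (cases "S = {}")
      case True then show ?thesis by (intro exI[of _ 1]) auto
    next
      case False
      have "continuous_on S g" unfolding g_def by (intro continuous_intros)
      from continuous_attains_inf[OF \<open>compact S\<close> False this] show ?thesis using gpos by blast
    qed
    then obtain m where m: "m > 0" "\<And>x. x \<in> S \<Longrightarrow> m \<le> g x" by blast
    have "\<forall>\<^sub>F y in F. g (\<chi> i. h y i) < m"
      using glim m(1) by (rule order_tendstoD)
    with h0 show "\<forall>\<^sub>F y in F. dist (\<chi> i. h y i) V < e"
    proof eventually_elim
      case (elim y)
      then have "(\<chi> i. h y i) \<notin> S" using m(2) by force
      then show ?case using elim by (auto simp: S_def)
    qed
  qed
  from tendsto_vec_nth[OF this, of i] show ?thesis by (simp add: V_def)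
qed

text \<open>Pairing the eigenvector equation at y with the fixed left eigenvector \<mu> gives the
  exact identity \<open>key\<close>. After division by \<open>y - \<theta>\<close> only continuity
  of the Perron vector at \<theta> is required, not its differentiability.\<close>

lemma delta_has_real_derivative:
  fixes Q :: "real \<Rightarrow> 'n::finite \<Rightarrow> 'n \<Rightarrow> real"
  assumes Y: "open Y" "\<theta> \<in> Y"
    and irr: "\<And>y. y \<in> Y \<Longrightarrow> irreducible_mat (Q y)" and nn: "\<And>y i j. y \<in> Y \<Longrightarrow> Q y i j \<ge> 0"
    and D: "\<And>i j. ((\<lambda>y. Q y i j) has_real_derivative Q' i j) (at \<theta>)"
    and \<mu>0: "\<And>i. \<mu> i > 0" and \<mu>: "\<And>j. (\<Sum>i\<in>UNIV. \<mu> i * Q \<theta> i j) = r0 * \<mu> j"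
    and v0: "\<And>i. v i > 0" and v: "\<And>i. (\<Sum>j\<in>UNIV. Q \<theta> i j * v j) = r0 * v i"
    and r0: "r0 > 0" and \<mu>v: "(\<Sum>i\<in>UNIV. \<mu> i * v i) = 1"
  shows "((\<lambda>y. Re (delta (\<lambda>i j. of_real (Q y i j)))) has_real_derivative (\<Sum>i\<in>UNIV. \<Sum>j\<in>UNIV. \<mu> i * Q' i j * v j)) (at \<theta>)"
    (is "(_ has_real_derivative ?D) _")
proof -
  have "\<forall>y\<in>Y. \<exists>h r. (\<forall>i. h i > 0) \<and> r > 0 \<and> (\<Sum>i\<in>UNIV. h i) = 1 \<and> (\<forall>i. (\<Sum>j\<in>UNIV. Q y i j * h j) = r * h i)"
    by (metis perron_vector_exists irr nn)
  then obtain h r where hr: "\<And>y i. y \<in> Y \<Longrightarrow> h y i > 0" "\<And>y. y \<in> Y \<Longrightarrow> r y > 0"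
      "\<And>y. y \<in> Y \<Longrightarrow> (\<Sum>i\<in>UNIV. h y i) = 1" "\<And>y i. y \<in> Y \<Longrightarrow> (\<Sum>j\<in>UNIV. Q y i j * h y j) = r y * h y i"
    by metis
  have R: "Re (delta (\<lambda>i j. of_real (Q y i j))) = r y" if "y \<in> Y" for y
    using delta_eqI[of "Q y" "h y" "r y"] hr[OF that] nn[OF that] by (simp add: less_imp_le)
  have R\<theta>: "Re (delta (\<lambda>i j. of_real (Q \<theta> i j))) = r0"
    using delta_eqI[of "Q \<theta>" v r0] v0 v r0 nn[OF Y(2)] by (simp add: less_imp_le)
  have evY: "\<forall>\<^sub>F y in at \<theta>. y \<in> Y" using Y by (meson eventually_at_topological)
  define m where "m = (\<lambda>y. \<Sum>i\<in>UNIV. \<mu> i * h y i)"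
  \<comment> \<open>A lower bound for the divisor \<open>m y\<close> that is uniform in y, since
    \<open>h y\<close> is a probability vector.\<close>
  define \<mu>m where "\<mu>m = Min (range \<mu>)"
  have \<mu>m: "\<mu>m > 0" "\<mu>m \<le> \<mu> i" for i
    unfolding \<mu>m_def using \<mu>0 by (auto simp: Min_gr_iff)
  have m: "m y \<ge> \<mu>m" if "y \<in> Y" for y
  proof -
    have "\<mu>m = (\<Sum>i\<in>UNIV. \<mu>m * h y i)" using hr(3)[OF that] by (simp flip: sum_distrib_left)
    also have "\<dots> \<le> m y" unfolding m_def using hr(1)[OF that]
      by (intro sum_mono mult_right_mono \<mu>m(2)) (simp add: less_imp_le)
    finally show ?thesis .
  qed
  have h1: "h y i \<le> 1" if "y \<in> Y" for y i
    using member_le_sum[of i UNIV "h y"] hr(1,3)[OF that] by (simp add: less_imp_le)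
  have key: "(r y - r0) * m y = (\<Sum>i\<in>UNIV. \<Sum>j\<in>UNIV. \<mu> i * (Q y i j - Q \<theta> i j) * h y j)" if "y \<in> Y" for y
  proof -
    have "(\<Sum>i\<in>UNIV. \<Sum>j\<in>UNIV. \<mu> i * Q y i j * h y j) = (\<Sum>i\<in>UNIV. \<mu> i * (\<Sum>j\<in>UNIV. Q y i j * h y j))"
      by (simp add: sum_distrib_left mult.assoc)
    also have "\<dots> = r y * m y" by (simp add: hr(4)[OF that]) (simp add: m_def sum_distrib_left mult_ac)
    finally have 1: "(\<Sum>i\<in>UNIV. \<Sum>j\<in>UNIV. \<mu> i * Q y i j * h y j) = r y * m y" .
    have "(\<Sum>i\<in>UNIV. \<Sum>j\<in>UNIV. \<mu> i * Q \<theta> i j * h y j) = (\<Sum>j\<in>UNIV. (\<Sum>i\<in>UNIV. \<mu> i * Q \<theta> i j) * h y j)"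
      by (subst sum.swap) (simp add: sum_distrib_right)
    also have "\<dots> = r0 * m y" by (simp add: \<mu> m_def sum_distrib_left mult_ac)
    finally show ?thesis using 1 by (simp add: left_diff_distrib right_diff_distrib sum_subtractf)
  qed
  have Qc: "((\<lambda>y. Q y i j) \<longlongrightarrow> Q \<theta> i j) (at \<theta>)" for i j
    using DERIV_isCont[OF D] by (simp add: isCont_def)
  have Qd: "((\<lambda>y. (Q y i j - Q \<theta> i j) / (y - \<theta>)) \<longlongrightarrow> Q' i j) (at \<theta>)" for i j
    using D by (simp add: has_field_derivative_iff)
  have rlim: "((\<lambda>y. r y - r0) \<longlongrightarrow> 0) (at \<theta>)"
  proof (rule Lim_null_comparison)
    let ?b = "\<lambda>y. (\<Sum>i\<in>UNIV. \<Sum>j\<in>UNIV. \<mu> i * \<bar>Q y i j - Q \<theta> i j\<bar>) / \<mu>m"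
    show "\<forall>\<^sub>F y in at \<theta>. norm (r y - r0) \<le> ?b y"
      using evY
    proof eventually_elim
      case (elim y)
      have "\<bar>r y - r0\<bar> * \<mu>m \<le> \<bar>r y - r0\<bar> * m y" by (intro mult_left_mono m elim) auto
      also have "\<dots> = \<bar>(r y - r0) * m y\<bar>" using m[OF elim] \<mu>m(1) by (simp add: abs_mult)
      also have "\<dots> \<le> (\<Sum>i\<in>UNIV. \<Sum>j\<in>UNIV. \<bar>\<mu> i * (Q y i j - Q \<theta> i j) * h y j\<bar>)"
        unfolding key[OF elim] by (intro order_trans[OF sum_abs] sum_mono sum_abs)
      also have "\<dots> \<le> (\<Sum>i\<in>UNIV. \<Sum>j\<in>UNIV. \<mu> i * \<bar>Q y i j - Q \<theta> i j\<bar>)"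
      proof (intro sum_mono)
        fix i j
        have "\<bar>\<mu> i * (Q y i j - Q \<theta> i j) * h y j\<bar> = \<mu> i * \<bar>Q y i j - Q \<theta> i j\<bar> * h y j"
          using \<mu>0[of i] hr(1)[OF elim, of j] by (simp add: abs_mult)
        also have "\<dots> \<le> \<mu> i * \<bar>Q y i j - Q \<theta> i j\<bar> * 1"
          using \<mu>0[of i] h1[OF elim] by (intro mult_left_mono) auto
        finally show "\<bar>\<mu> i * (Q y i j - Q \<theta> i j) * h y j\<bar> \<le> \<mu> i * \<bar>Q y i j - Q \<theta> i j\<bar>" by simp
      qed
      finally show ?case using \<mu>m(1) by (simp add: field_simps)
    qed
    have "(?b \<longlongrightarrow>
       (\<Sum>i\<in>UNIV. \<Sum>j\<in>UNIV. \<mu> i * \<bar>Q \<theta> i j - Q \<theta> i j\<bar>) / \<mu>m) (at \<theta>)"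
      using \<mu>m(1) by (intro tendsto_intros Qc) auto
    then show "(?b \<longlongrightarrow> 0) (at \<theta>)" by simp
  qed
  \<comment> \<open>The vectors \<open>h y\<close> have total mass 1 whereas v is normalised against
    \<mu>; the factor s passes between the two and cancels in the final quotient.\<close>
  define s where "s = (\<Sum>i\<in>UNIV. v i)"
  have s0: "s > 0" unfolding s_def using v0 by (intro sum_pos) auto
  have hlim: "((\<lambda>y. h y i) \<longlongrightarrow> v i / s) (at \<theta>)" for i
  proof (rule perron_vector_tendsto[OF irr[OF Y(2)] nn[OF Y(2)] _ r0, where v = "\<lambda>i. v i / s"])
    show "\<forall>\<^sub>F y in at \<theta>. (\<forall>i. h y i \<ge> 0) \<and> (\<Sum>i\<in>UNIV. h y i) = 1"
      using evY by eventually_elim (auto simp: hr less_imp_le)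
    show "v i / s > 0" for i using v0 s0 by simp
    show "(\<Sum>j\<in>UNIV. Q \<theta> i j * (v j / s)) = r0 * (v i / s)" for i
      using v[of i] by (simp flip: sum_divide_distrib)
    show "(\<Sum>i\<in>UNIV. v i / s) = 1" using s0 by (simp add: s_def flip: sum_divide_distrib)
    show "((\<lambda>y. (\<Sum>j\<in>UNIV. Q \<theta> i j * h y j) - r0 * h y i) \<longlongrightarrow> 0) (at \<theta>)" for i
    proof (rule Lim_null_comparison)
      show "\<forall>\<^sub>F y in at \<theta>. norm ((\<Sum>j\<in>UNIV. Q \<theta> i j * h y j) - r0 * h y i)
          \<le> (\<Sum>j\<in>UNIV. \<bar>Q \<theta> i j - Q y i j\<bar>) + \<bar>r y - r0\<bar>"
        using evY
      proof eventually_elim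
        case (elim y)
        have "(\<Sum>j\<in>UNIV. Q \<theta> i j * h y j) - r0 * h y i
            = (\<Sum>j\<in>UNIV. (Q \<theta> i j - Q y i j) * h y j) + (r y - r0) * h y i"
          by (simp add: left_diff_distrib sum_subtractf hr(4)[OF elim])
        also have "norm \<dots> \<le> (\<Sum>j\<in>UNIV. \<bar>(Q \<theta> i j - Q y i j) * h y j\<bar>) + \<bar>(r y - r0) * h y i\<bar>"
          unfolding real_norm_def by (intro order_trans[OF abs_triangle_ineq] add_mono sum_abs) auto
        also have "\<dots> \<le> (\<Sum>j\<in>UNIV. \<bar>Q \<theta> i j - Q y i j\<bar>) + \<bar>r y - r0\<bar>"
          using hr(1)[OF elim] h1[OF elim]
          by (intro add_mono sum_mono) (auto simp: abs_mult less_imp_le intro!: mult_left_le)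
        finally show ?case .
      qed
      have "((\<lambda>y. (\<Sum>j\<in>UNIV. \<bar>Q \<theta> i j - Q y i j\<bar>) + \<bar>r y - r0\<bar>) \<longlongrightarrow> (\<Sum>j\<in>UNIV. \<bar>Q \<theta> i j - Q \<theta> i j\<bar>) + \<bar>0\<bar>) (at \<theta>)"
        by (intro tendsto_intros Qc rlim)
      then show "((\<lambda>y. (\<Sum>j\<in>UNIV. \<bar>Q \<theta> i j - Q y i j\<bar>) + \<bar>r y - r0\<bar>) \<longlongrightarrow> 0) (at \<theta>)" by simp
    qed
  qed
  let ?q = "\<lambda>y. \<Sum>i\<in>UNIV. \<Sum>j\<in>UNIV. \<mu> i * ((Q y i j - Q \<theta> i j) / (y - \<theta>)) * h y j"
  have msum: "(\<Sum>i\<in>UNIV. \<mu> i * (v i / s)) = 1 / s" using \<mu>v by (simp flip: sum_divide_distrib)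
  have "((\<lambda>y. ?q y / m y) \<longlongrightarrow>
     (\<Sum>i\<in>UNIV. \<Sum>j\<in>UNIV. \<mu> i * Q' i j * (v j / s)) / (\<Sum>i\<in>UNIV. \<mu> i * (v i / s))) (at \<theta>)"
    unfolding m_def by (intro tendsto_intros Qd hlim) (use msum s0 in auto)
  also have "(\<Sum>i\<in>UNIV. \<Sum>j\<in>UNIV. \<mu> i * Q' i j * (v j / s)) / (\<Sum>i\<in>UNIV. \<mu> i * (v i / s)) = ?D"
    unfolding msum using s0 by (simp flip: sum_divide_distrib)
  finally have L: "((\<lambda>y. ?q y / m y) \<longlongrightarrow>
     ?D) (at \<theta>)" .
  show ?thesis
    unfolding has_field_derivative_iff R\<theta>
  proof (rule Lim_transform_eventually[OF L])
    show "\<forall>\<^sub>F y in at \<theta>. ?q y / m y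
      = (Re (delta (\<lambda>i j. of_real (Q y i j))) - r0) / (y - \<theta>)"
      using evY
    proof eventually_elim
      case (elim y)
      have "m y > 0" using m[OF elim] \<mu>m(1) by simp
      have "?q y = (r y - r0) * m y / (y - \<theta>)"
        unfolding key[OF elim] by (simp add: sum_divide_distrib)
      then show ?case using \<open>m y > 0\<close> R[OF elim] by simp
    qed
  qed
qed

section \<open>Matrix generating functions\<close>

text \<open>The real form of A* on the real axis, kept separate because the Perron arguments need
  order and positivity.\<close>

definition Areal :: "(nat \<Rightarrow> 'n \<Rightarrow> 'n \<Rightarrow> real) \<Rightarrow> real \<Rightarrow> 'n \<Rightarrow> 'n \<Rightarrow> real" where
  "Areal A y i j = (\<Sum>k. A k i j * y ^ k)"

definition dAreal :: "(nat \<Rightarrow> 'n \<Rightarrow> 'n \<Rightarrow> real) \<Rightarrow> real \<Rightarrow> 'n \<Rightarrow> 'n \<Rightarrow> real" where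
  "dAreal A y i j = (\<Sum>n. diffs (\<lambda>k. A k i j) n * y ^ n)"

definition dAstar :: "(nat \<Rightarrow> 'n \<Rightarrow> 'n \<Rightarrow> real) \<Rightarrow> complex \<Rightarrow> 'n \<Rightarrow> 'n \<Rightarrow> complex" where
  "dAstar A z i j = (\<Sum>n. diffs (\<lambda>k. complex_of_real (A k i j)) n * z ^ n)"

definition charmat :: "(nat \<Rightarrow> 'n \<Rightarrow> 'n \<Rightarrow> real) \<Rightarrow> complex \<Rightarrow> 'n \<Rightarrow> 'n \<Rightarrow> complex" where
  "charmat A z i j = (if i = j then z else 0) - Astar A z i j"

lemma mat_conv_radius_le: "mat_conv_radius F \<le> conv_radius (\<lambda>k. complex_of_real (F k i j))"
proof -
  have "{conv_radius (\<lambda>k. complex_of_real (F k i j)) | i j. True}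
      = (\<lambda>(i, j). conv_radius (\<lambda>k. complex_of_real (F k i j))) ` UNIV" by auto
  then have "finite {conv_radius (\<lambda>k. complex_of_real (F k i j)) | i j. True}" by simp
  then show ?thesis unfolding mat_conv_radius_def by (intro Min_le) auto
qed

lemma mat_power_series_summable:
  assumes "ereal (norm z) < mat_conv_radius F"
  shows "summable (\<lambda>k. norm (complex_of_real (F k i j) * z ^ k))"
    "summable (\<lambda>k. complex_of_real (F k i j) * z ^ k)"
proof -
  show 1: "summable (\<lambda>k. norm (complex_of_real (F k i j) * z ^ k))"
    by (rule abs_summable_in_conv_radius) (rule less_le_trans[OF assms mat_conv_radius_le])
  show "summable (\<lambda>k. complex_of_real (F k i j) * z ^ k)"
    by (rule summable_norm_cancel[OF 1])
qed

lemma mat_power_series_summable_real: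
  assumes "ereal \<bar>y\<bar> < mat_conv_radius F"
  shows "summable (\<lambda>k. F k i j * y ^ k)"
proof -
  have "summable (\<lambda>k. norm (complex_of_real (F k i j) * of_real y ^ k))"
    by (rule mat_power_series_summable) (use assms in simp)
  then have "summable (\<lambda>k. norm (F k i j * y ^ k))"
    by (simp add: norm_mult norm_power abs_mult power_abs)
  then show ?thesis by (rule summable_norm_cancel)
qed

lemma charmat_left_mult:
  fixes A :: "nat \<Rightarrow> 'n::finite \<Rightarrow> 'n \<Rightarrow> real"
  shows "(\<Sum>i\<in>UNIV. c i * charmat A z i j) = z * c j - (\<Sum>i\<in>UNIV. c i * Astar A z i j)"
proof -
  have "c i * charmat A z i j = (if i = j then c i * z else 0) - c i * Astar A z i j" for i
    by (simp add: charmat_def right_diff_distrib)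
  then show ?thesis by (simp add: sum_subtractf sum.delta mult.commute)
qed

lemma charmat_right_mult:
  fixes A :: "nat \<Rightarrow> 'n::finite \<Rightarrow> 'n \<Rightarrow> real"
  shows "(\<Sum>j\<in>UNIV. charmat A z i j * c j) = z * c i - (\<Sum>j\<in>UNIV. Astar A z i j * c j)"
proof -
  have "charmat A z i j * c j = (if i = j then z * c j else 0) - Astar A z i j * c j" for j
    by (simp add: charmat_def left_diff_distrib)
  then show ?thesis by (simp add: sum_subtractf sum.delta)
qed

lemma Astar_of_real:
  assumes "ereal \<bar>y\<bar> < mat_conv_radius A"
  shows "Astar A (of_real y) i j = of_real (Areal A y i j)"
proof -
  have "(\<lambda>k. complex_of_real (A k i j * y ^ k)) sums of_real (Areal A y i j)"
    unfolding Areal_def by (intro sums_of_real summable_sums mat_power_series_summable_real assms)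
  then show ?thesis unfolding Astar_def by (simp add: sums_iff mult.commute)
qed

lemma Astar_has_field_derivative:
  assumes "ereal (norm z) < mat_conv_radius A"
  shows "((\<lambda>z. Astar A z i j) has_field_derivative dAstar A z i j) (at z)"
proof -
  obtain K where K: "ereal (norm z) < ereal K" "ereal K < mat_conv_radius A"
    using ereal_dense2[OF assms] by blast
  have "((\<lambda>z. \<Sum>k. complex_of_real (A k i j) * z ^ k) has_field_derivative dAstar A z i j) (at z)"
    unfolding dAstar_def
  proof (rule termdiffs_strong')
    fix w :: complex assume "norm w < K"
    then have "ereal (norm w) < mat_conv_radius A" using K(2) by (meson ereal_less(2) less_ereal.simps(1) less_trans)
    then show "summable (\<lambda>n. complex_of_real (A n i j) * w ^ n)" by (rule mat_power_series_summable)
  qed (use K in simp)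
  then show ?thesis by (simp add: Astar_def mult.commute)
qed

lemma Areal_has_field_derivative:
  assumes "ereal \<bar>y\<bar> < mat_conv_radius A"
  shows "((\<lambda>y. Areal A y i j) has_real_derivative dAreal A y i j) (at y)"
proof -
  obtain K where K: "ereal \<bar>y\<bar> < ereal K" "ereal K < mat_conv_radius A"
    using ereal_dense2[OF assms] by blast
  show ?thesis
    unfolding dAreal_def Areal_def
  proof (rule termdiffs_strong')
    fix w :: real assume "norm w < K"
    then have "ereal \<bar>w\<bar> < mat_conv_radius A" using K(2) by (metis less_ereal.simps(1) less_trans real_norm_def)
    then show "summable (\<lambda>n. A n i j * w ^ n)" by (rule mat_power_series_summable_real)
  qed (use K in simp)
qed

lemma summable_diffs_mat:
  assumes "ereal \<bar>y\<bar> < mat_conv_radius A"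
  shows "summable (\<lambda>n. diffs (\<lambda>k. A k i j) n * y ^ n)"
proof -
  obtain K where K: "ereal \<bar>y\<bar> < ereal K" "ereal K < mat_conv_radius A"
    using ereal_dense2[OF assms] by blast
  show ?thesis
  proof (rule termdiff_converges)
    fix w :: real assume "norm w < K"
    then have "ereal \<bar>w\<bar> < mat_conv_radius A" using K(2) by (metis less_ereal.simps(1) less_trans real_norm_def)
    then show "summable (\<lambda>n. A n i j * w ^ n)" by (rule mat_power_series_summable_real)
  qed (use K in simp)
qed

lemma dAreal_sums:
  assumes "ereal \<bar>y\<bar> < mat_conv_radius A"
  shows "(\<lambda>k. real k * A k i j * y ^ k) sums (y * dAreal A y i j)"
proof -
  have "(\<lambda>n. real n * A n i j * y ^ (n - Suc 0)) sums dAreal A y i j"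
    unfolding dAreal_def by (intro diffs_equiv summable_diffs_mat assms)
  from sums_mult[OF this, of y] show ?thesis
  proof (rule sums_cong[THEN iffD1, rotated])
    show "y * (real n * A n i j * y ^ (n - Suc 0)) = real n * A n i j * y ^ n" for n
      by (cases n) auto
  qed
qed

lemma norm_Astar_le:
  assumes "ereal (norm z) < mat_conv_radius A" "\<And>k i j. A k i j \<ge> 0"
  shows "norm (Astar A z i j) \<le> Areal A (norm z) i j"
proof -
  have "norm (Astar A z i j) \<le> (\<Sum>k. norm (complex_of_real (A k i j) * z ^ k))"
    using summable_norm[OF mat_power_series_summable(1)[OF assms(1)]] by (simp add: Astar_def mult.commute)
  also have "\<dots> = Areal A (norm z) i j"
    using assms(2) by (simp add: Areal_def norm_mult norm_power)
  finally show ?thesis .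
qed

section \<open>Convexity inequalities and periods of complex numbers\<close>

text \<open>With \<open>s = exp L\<close>, dividing by \<open>s powr t\<close> leaves a weighted
  mean of exponentials at \<open>(1 - t) * L\<close> and \<open>- t * L\<close>. Their weighted mean
  exponent is 0, so the tangent bound \<open>1 + x \<le> exp x\<close> gives at least 1, strictly
  unless L is 0.\<close>

lemma weighted_am_gm_strict:
  fixes s t :: real
  assumes "s > 0" "0 < t" "t < 1"
  shows "s powr t \<le> t * s + (1 - t)" "s \<noteq> 1 \<Longrightarrow> s powr t < t * s + (1 - t)"
proof -
  define L where "L = ln s"
  have s: "s = exp L" using assms by (simp add: L_def)
  have p: "s powr t = exp (t * L)" using assms by (simp add: powr_def L_def)
  have fac: "t * s + (1 - t) = s powr t * (t * exp ((1 - t) * L) + (1 - t) * exp (- (t * L)))"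
  proof -
    have "exp (t * L) * exp ((1 - t) * L) = s" "exp (t * L) * exp (- (t * L)) = 1"
      by (simp_all add: s algebra_simps flip: exp_add)
    then show ?thesis unfolding p by (simp only: distrib_left mult.left_commute[of "exp (t * L)"]) simp
  qed
  have e1: "t * exp ((1 - t) * L) \<ge> t * (1 + (1 - t) * L)"
    using assms by (intro mult_left_mono exp_ge_add_one_self) auto
  have e2: "(1 - t) * exp (- (t * L)) \<ge> (1 - t) * (1 + - (t * L))"
    using assms by (intro mult_left_mono exp_ge_add_one_self) auto
  have sum: "t * (1 + (1 - t) * L) + (1 - t) * (1 + - (t * L)) = 1" by (simp add: algebra_simps)
  show "s powr t \<le> t * s + (1 - t)"
  proof -
    have "1 \<le> t * exp ((1 - t) * L) + (1 - t) * exp (- (t * L))" using e1 e2 sum by linarith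
    from mult_left_mono[OF this, of "s powr t"] show ?thesis unfolding fac by simp
  qed
  assume "s \<noteq> 1"
  then have "L \<noteq> 0" using s by auto
  then have "(1 - t) * L \<noteq> 0" using assms by simp
  then have "exp ((1 - t) * L) \<noteq> 1 + (1 - t) * L"
    using ln_eq_minus_one[of "exp ((1 - t) * L)"] by auto
  then have "exp ((1 - t) * L) > 1 + (1 - t) * L"
    using exp_ge_add_one_self[of "(1 - t) * L"] by linarith
  then have "t * exp ((1 - t) * L) > t * (1 + (1 - t) * L)"
    using assms by simp
  then have "t * exp ((1 - t) * L) + (1 - t) * exp (- (t * L)) > 1" using e2 sum by linarith
  then show "s powr t < t * s + (1 - t)"
    unfolding fac using assms by (simp add: p)
qed

text \<open>The integrand of relative entropy, obtained by multiplying
  \<open>ln (1 / s) \<le> 1 / s - 1\<close> by s.\<close>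

lemma entropy_strict:
  fixes s :: real
  assumes "s > 0"
  shows "s * ln s - s + 1 \<ge> 0" "s \<noteq> 1 \<Longrightarrow> s * ln s - s + 1 > 0"
proof -
  have inv: "ln (1 / s) = - ln s" using assms by (simp add: ln_div)
  have "ln (1 / s) \<le> 1 / s - 1" using assms by (intro ln_le_minus_one) auto
  then have "s * (- ln s) \<le> s * (1 / s - 1)" using assms inv by (intro mult_left_mono) auto
  then show "s * ln s - s + 1 \<ge> 0" using assms by (simp add: right_diff_distrib)
  assume "s \<noteq> 1"
  then have "ln (1 / s) \<noteq> 1 / s - 1" using ln_eq_minus_one[of "1 / s"] assms by auto
  then have "ln (1 / s) < 1 / s - 1" using \<open>ln (1 / s) \<le> 1 / s - 1\<close> by simp
  then have "s * (- ln s) < s * (1 / s - 1)" using assms inv by (intro mult_strict_left_mono) auto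
  then show "s * ln s - s + 1 > 0" using assms by (simp add: right_diff_distrib)
qed

text \<open>The multiplicative order of \<zeta> divides every element of K and hence the gcd; this
  avoids a Bezout combination for a possibly infinite set.\<close>

lemma power_Gcd_eq_1:
  fixes \<zeta> :: complex
  assumes z0: "\<zeta> \<noteq> 0" and K: "\<And>k. k \<in> K \<Longrightarrow> \<zeta> powi k = 1" and g: "int t = Gcd K" "t \<ge> 1"
  shows "\<zeta> ^ t = 1"
proof -
  \<comment> \<open>Needed for \<zeta> to have finite order; the positive gcd provides it, because
    \<open>Gcd\<close> of an empty or zero set is 0.\<close>
  have "\<exists>k\<in>K. k \<noteq> 0"
  proof (rule ccontr)
    assume "\<not> ?thesis"
    then have "K \<subseteq> {0}" by auto
    then have "Gcd K = 0" by simp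
    then have "int t = 0" using g(1) by metis
    then show False using g(2) by simp
  qed
  then obtain k where k: "k \<in> K" "k \<noteq> 0" by blast
  have "\<zeta> ^ nat \<bar>k\<bar> = 1"
  proof (cases "k \<ge> 0")
    case True then show ?thesis using K[OF k(1)] by (simp add: power_int_def)
  next
    case False then show ?thesis using K[OF k(1)] by (simp add: power_int_def field_simps power_inverse)
  qed
  then have ex: "\<exists>m. m > 0 \<and> \<zeta> ^ m = 1" using k(2) by (intro exI[of _ "nat \<bar>k\<bar>"]) auto
  define m where "m = (LEAST m. m > 0 \<and> \<zeta> ^ m = 1)"
  have m: "m > 0" "\<zeta> ^ m = 1" unfolding m_def using LeastI_ex[OF ex] by auto
  have least: "m \<le> n" if "n > 0" "\<zeta> ^ n = 1" for n unfolding m_def using that by (intro Least_le) auto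
  have "int m dvd k" if "k \<in> K" for k
  proof -
    have "\<zeta> powi k = \<zeta> powi (int m * (k div int m)) * \<zeta> powi (k mod int m)"
      using z0 by (simp flip: power_int_add)
    also have "\<zeta> powi (int m * (k div int m)) = (\<zeta> powi int m) powi (k div int m)" by (rule power_int_mult)
    also have "\<zeta> powi int m = 1" using m(2) by simp
    finally have 1: "\<zeta> powi (k mod int m) = 1" using K[OF that] by simp
    have nn: "k mod int m \<ge> 0" "k mod int m < int m" using m(1) by auto
    have "\<zeta> ^ nat (k mod int m) = 1" using 1 nn(1) by (simp add: power_int_def)
    then have "\<not> nat (k mod int m) > 0" using least nn by (metis le_less_trans less_irrefl nat_less_iff of_nat_le_iff int_nat_eq)
    then have "k mod int m = 0" using nn(1) by simp
    then show ?thesis by auto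
  qed
  then have "int m dvd int t" unfolding g(1) by (rule Gcd_greatest)
  then have "m dvd t" by simp
  then show ?thesis using m(2) by (auto simp: power_mult)
qed

lemma power_eq_if_cong:
  fixes u :: complex
  assumes "u ^ t = 1" "t \<ge> 1" "int a mod int t = int b mod int t"
  shows "u ^ a = u ^ b"
proof -
  have *: "u ^ n = u ^ (n mod t)" for n
    by (metis assms(1) mod_mult_div_eq mult.commute mult_1 power_add power_mult power_one add.commute)
  have "a mod t = b mod t" using assms(3) by (metis of_nat_eq_iff zmod_int)
  then show ?thesis using *[of a] *[of b] by simp
qed

section \<open>The Markov additive kernel\<close>

text \<open>The eigenvector equations are stated for A*(\<theta>) with eigenvalue \<theta>, so \<mu>
  and v belong to the eigenvalue 1 of A*(\<theta>)/\<theta>. In \<open>p_mod\<close>, d is the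
  increment of the level, to which the matrix with index \<open>d + 1\<close> belongs.\<close>

locale mg1_kernel =
  fixes A :: "nat \<Rightarrow> 'b::finite \<Rightarrow> 'b \<Rightarrow> real" and \<pi> \<mu> v :: "'b \<Rightarrow> real"
    and \<theta> :: real and \<tau> :: nat and p :: "'b \<Rightarrow> nat"
  assumes nonneg: "A k i j \<ge> 0"
    and summable_A: "summable (\<lambda>k. A k i j)"
    and stochastic: "(\<Sum>j\<in>UNIV. \<Sum>k. A k i j) = 1"
    and \<pi>_stat: "(\<Sum>i\<in>UNIV. \<pi> i * (\<Sum>k. A k i j)) = \<pi> j"
    and \<pi>_norm: "(\<Sum>i\<in>UNIV. \<pi> i) = 1"
    and irreducible: "irreducible_mat (\<lambda>i j. \<Sum>k. A k i j)"
    and summable_kA: "summable (\<lambda>k. real k * A k i j)"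
    and drift: "(\<Sum>i\<in>UNIV. \<pi> i * (\<Sum>j\<in>UNIV. \<Sum>k. real k * A k i j)) < 1"
    and \<theta>_gt_1: "1 < \<theta>" and \<theta>_less: "ereal \<theta> < mat_conv_radius A"
    and \<mu>_pos: "\<mu> i > 0" and v_pos: "v i > 0"
    and \<mu>_eig: "(\<Sum>i\<in>UNIV. \<mu> i * Areal A \<theta> i j) = \<theta> * \<mu> j"
    and v_eig: "(\<Sum>j\<in>UNIV. Areal A \<theta> i j * v j) = \<theta> * v i"
    and \<mu>v: "(\<Sum>i\<in>UNIV. \<mu> i * v i) = 1"
    and \<tau>_pos: "\<tau> \<ge> 1"
    and \<tau>_Gcd: "int \<tau> = Gcd {k. k \<noteq> 0 \<and> ((0, j), (k, j)) \<in> (MAP_step A)\<^sup>+}"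
    and p_mod: "d \<ge> -1 \<Longrightarrow> A (nat (d + 1)) i j > 0 \<Longrightarrow>
                   d mod int \<tau> = (int (p j) - int (p i)) mod int \<tau>"
begin

lemma less_radius: "\<bar>y\<bar> \<le> \<theta> \<Longrightarrow> ereal \<bar>y\<bar> < mat_conv_radius A"
  using \<theta>_less by (meson ereal_less_eq(3) le_less_trans)

lemma Areal_sums: "\<bar>y\<bar> \<le> \<theta> \<Longrightarrow> (\<lambda>k. A k i j * y ^ k) sums Areal A y i j"
  unfolding Areal_def by (intro summable_sums mat_power_series_summable_real less_radius)

lemma A_sums: "(\<lambda>k. A k i j) sums (\<Sum>k. A k i j)"
  using summable_A by (rule summable_sums)

lemma Asum_pos_iff: "(\<Sum>k. A k i j) > 0 \<longleftrightarrow> (\<exists>k. A k i j > 0)"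
proof
  assume pos: "(\<Sum>k. A k i j) > 0"
  show "\<exists>k. A k i j > 0"
  proof (rule ccontr)
    assume "\<not> ?thesis"
    then have "A k i j = 0" for k using nonneg[of k i j] by (auto simp: not_less intro: antisym)
    then show False using pos by simp
  qed
next
  assume "\<exists>k. A k i j > 0"
  then obtain k where "A k i j > 0" ..
  then show "(\<Sum>k. A k i j) > 0" by (rule suminf_pos2[OF summable_A nonneg])
qed

lemma Areal_nonneg: "y \<ge> 0 \<Longrightarrow> ereal y < mat_conv_radius A \<Longrightarrow> Areal A y i j \<ge> 0"
  unfolding Areal_def by (intro suminf_nonneg mat_power_series_summable_real) (auto simp: nonneg)

lemma Areal_irreducible:
  assumes "y > 0" "ereal y < mat_conv_radius A"
  shows "irreducible_mat (Areal A y)"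
proof -
  have "Areal A y i j > 0" if pos: "(\<Sum>k. A k i j) > 0" for i j
  proof -
    obtain k where "A k i j > 0" using pos Asum_pos_iff by blast
    then have "A k i j * y ^ k > 0" using assms by simp
    moreover have "summable (\<lambda>k. A k i j * y ^ k)"
      by (rule mat_power_series_summable_real) (use assms in simp)
    moreover have "A k i j * y ^ k \<ge> 0" for k using nonneg assms by simp
    ultimately show ?thesis unfolding Areal_def by (meson suminf_pos2)
  qed
  then have "{(i, j). (\<Sum>k. A k i j) > 0} \<subseteq> {(i, j). Areal A y i j > 0}" by auto
  from trancl_mono[OF _ this] show ?thesis using irreducible by (simp add: irreducible_mat_def)
qed

lemma Areal_scaled_irreducible:
  assumes "y > 0" "y \<le> \<theta>"
  shows "irreducible_mat (\<lambda>i j. Areal A y i j / y)" "Areal A y i j / y \<ge> 0"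
proof -
  have r: "ereal y < mat_conv_radius A" using less_radius[of y] assms by simp
  show "irreducible_mat (\<lambda>i j. Areal A y i j / y)"
    using Areal_irreducible[OF assms(1) r] assms(1) by (simp add: irreducible_mat_def zero_less_divide_iff)
  show "Areal A y i j / y \<ge> 0" using Areal_nonneg[OF _ r] assms(1) by simp
qed

text \<open>The ratio \<open>ratio k i j\<close> is the likelihood ratio of the transition \<open>(k, i, j)\<close> between the
  \<open>\<theta>\<close>-twisted and the original Markov additive process.\<close>

definition ratio :: "nat \<Rightarrow> 'b \<Rightarrow> 'b \<Rightarrow> real" where
  "ratio k i j = \<theta> ^ k * v j / (\<theta> * v i)"

lemma ratio_pos: "ratio k i j > 0"
  using \<theta>_gt_1 v_pos by (simp add: ratio_def)

lemma ratio_sums: "(\<lambda>k. A k i j * ratio k i j) sums (Areal A \<theta> i j * v j / (\<theta> * v i))"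
proof -
  have "(\<lambda>k. A k i j * \<theta> ^ k * (v j / (\<theta> * v i))) sums (Areal A \<theta> i j * (v j / (\<theta> * v i)))"
    using \<theta>_gt_1 by (intro sums_mult2 Areal_sums) auto
  then show ?thesis by (simp add: ratio_def mult.assoc)
qed

lemma ratio_total: "(\<Sum>j\<in>UNIV. Areal A \<theta> i j * v j / (\<theta> * v i)) = 1"
  using v_eig[of i] \<theta>_gt_1 v_pos[of i] by (simp flip: sum_divide_distrib)

text \<open>If the ratio were 1 on the whole support, then
  \<open>k * ln \<theta> = ln \<theta> + ln (v i) - ln (v j)\<close> for every possible transition.
  Under \<pi> the differences of \<open>ln v\<close> average out, and the mean of k would be exactly
  1, against the drift condition.\<close>

lemma ratio_nontrivial: "\<exists>k i j. A k i j > 0 \<and> ratio k i j \<noteq> 1"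
proof (rule ccontr)
  assume "\<not> ?thesis"
  then have triv: "ratio k i j = 1" if "A k i j > 0" for k i j using that by blast
  define L where "L = ln \<theta>"
  define f where "f = (\<lambda>i. ln (v i))"
  have L0: "L > 0" using \<theta>_gt_1 by (simp add: L_def)
  have eq: "L * (real k * A k i j) = A k i j * (L + f i - f j)" for k i j
  proof (cases "A k i j = 0")
    case False
    then have "ratio k i j = 1" using triv nonneg[of k i j] by simp
    then have "\<theta> ^ k * v j = \<theta> * v i" using \<theta>_gt_1 v_pos[of i] by (simp add: ratio_def)
    then have "ln (\<theta> ^ k * v j) = ln (\<theta> * v i)" by simp
    then have "real k * L + f j = L + f i"
      using \<theta>_gt_1 v_pos[of i] v_pos[of j] by (simp add: ln_mult ln_realpow L_def f_def)
    then have "real k * L = L + f i - f j" by simp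
    then show ?thesis by (metis mult.commute mult.left_commute)
  qed simp
  have "L * (\<Sum>k. real k * A k i j) = (\<Sum>k. A k i j) * (L + f i - f j)" for i j
  proof -
    have "L * (\<Sum>k. real k * A k i j) = (\<Sum>k. L * (real k * A k i j))"
      by (intro suminf_mult[symmetric] summable_kA)
    also have "\<dots> = (\<Sum>k. A k i j) * (L + f i - f j)"
      unfolding eq by (intro suminf_mult2[symmetric] summable_A)
    finally show ?thesis .
  qed
  then have "L * (\<Sum>i\<in>UNIV. \<pi> i * (\<Sum>j\<in>UNIV. \<Sum>k. real k * A k i j))
     = (\<Sum>i\<in>UNIV. \<Sum>j\<in>UNIV. \<pi> i * ((\<Sum>k. A k i j) * (L + f i - f j)))"
    by (simp add: sum_distrib_left mult.left_commute[of L])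
  also have "\<dots> = (\<Sum>i\<in>UNIV. \<pi> i * (L + f i) * (\<Sum>j\<in>UNIV. \<Sum>k. A k i j)) - (\<Sum>i\<in>UNIV. \<Sum>j\<in>UNIV. \<pi> i * (\<Sum>k. A k i j) * f j)"
    by (simp add: sum_distrib_left algebra_simps sum.distrib sum_subtractf)
  also have "(\<Sum>i\<in>UNIV. \<Sum>j\<in>UNIV. \<pi> i * (\<Sum>k. A k i j) * f j) = (\<Sum>j\<in>UNIV. (\<Sum>i\<in>UNIV. \<pi> i * (\<Sum>k. A k i j)) * f j)"
    by (subst sum.swap) (simp add: sum_distrib_right)
  also have "\<dots> = (\<Sum>j\<in>UNIV. \<pi> j * f j)" by (simp add: \<pi>_stat)
  also have "(\<Sum>i\<in>UNIV. \<pi> i * (L + f i) * (\<Sum>j\<in>UNIV. \<Sum>k. A k i j)) = L * (\<Sum>i\<in>UNIV. \<pi> i) + (\<Sum>j\<in>UNIV. \<pi> j * f j)"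
    by (simp add: stochastic distrib_left sum.distrib sum_distrib_left mult.commute)
  finally have "L * (\<Sum>i\<in>UNIV. \<pi> i * (\<Sum>j\<in>UNIV. \<Sum>k. real k * A k i j)) = L * 1" by (simp add: \<pi>_norm)
  then show False using drift L0 by simp
qed

lemma nonneg_double_sum_pos:
  fixes d :: "nat \<Rightarrow> 'b \<Rightarrow> real"
  assumes "\<And>j. (\<lambda>k. d k j) sums s j" "\<And>k j. d k j \<ge> 0"
  shows "(\<Sum>j\<in>UNIV. s j) \<ge> 0" "d k j > 0 \<Longrightarrow> (\<Sum>j\<in>UNIV. s j) > 0"
proof -
  have nn: "s j \<ge> 0" for j using assms by (metis sums_iff suminf_nonneg)
  then show "(\<Sum>j\<in>UNIV. s j) \<ge> 0" by (intro sum_nonneg) auto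
  assume "d k j > 0"
  then have "s j > 0" using assms by (metis sums_iff suminf_pos2)
  then show "(\<Sum>j\<in>UNIV. s j) > 0" using nn by (intro sum_pos2[of _ j]) auto
qed

section \<open>Nonsingularity in the annulus and the drift of the twisted kernel\<close>

text \<open>The t-th power of \<open>ratio\<close> is exactly the factor that turns A into the
  kernel at \<open>y = \<theta> powr t\<close> twisted by h. Both ends of the AM-GM bound have row
  sums 1: the ratio-weighted one since v is an eigenvector, the unweighted one since A is
  stochastic.\<close>

lemma superharmonic_between:
  assumes y: "1 < y" "y < \<theta>"
  obtains h k where "\<And>i. h i > 0" "\<And>i. (\<Sum>j\<in>UNIV. Areal A y i j / y * h j) \<le> h i"
    "(\<Sum>j\<in>UNIV. Areal A y k j / y * h j) < h k"
proof -
  define t where "t = ln y / ln \<theta>"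
  have t: "0 < t" "t < 1" using y by (auto simp: t_def)
  have yt: "\<theta> powr t = y" using y by (simp add: t_def powr_def)
  define h where "h = (\<lambda>i. v i powr t)"
  have h0: "h i > 0" for i using v_pos[of i] by (simp add: h_def)
  have rp: "ratio k i j powr t = y ^ k * h j / (y * h i)" for k i j
  proof -
    have "(\<theta> ^ k) powr t = y ^ k"
      using \<theta>_gt_1 yt by (metis less_trans mult.commute order_less_imp_le powr_gt_zero powr_powr powr_realpow zero_less_one zero_less_power less_irrefl powr_power)
    then show ?thesis using \<theta>_gt_1 v_pos[of i] v_pos[of j] yt
      by (simp add: ratio_def powr_divide powr_mult h_def)
  qed
  \<comment> \<open>The AM-GM gap of a single transition; its sum over k and j is the deficit of
    superharmonicity at i.\<close>
  define d where "d = (\<lambda>i k j. h i * (A k i j * (t * ratio k i j + (1 - t) - ratio k i j powr t)))"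
  have dnn: "d i k j \<ge> 0" for i k j
    unfolding d_def using h0[of i] nonneg weighted_am_gm_strict(1)[OF ratio_pos t]
    by (intro mult_nonneg_nonneg) (auto simp: less_imp_le)
  have dpos: "d i k j > 0" if "A k i j > 0" "ratio k i j \<noteq> 1" for i k j
    unfolding d_def using h0[of i] that weighted_am_gm_strict(2)[OF ratio_pos t that(2)] by simp
  define s where "s = (\<lambda>i j. h i * (t * (Areal A \<theta> i j * v j / (\<theta> * v i)) + (1 - t) * (\<Sum>k. A k i j)) - Areal A y i j / y * h j)"
  have ds: "(\<lambda>k. d i k j) sums s i j" for i j
  proof -
    have "(\<lambda>k. h i * (t * (A k i j * ratio k i j) + (1 - t) * A k i j) - A k i j * y ^ k * (h j / y)) sums
       (h i * (t * (Areal A \<theta> i j * v j / (\<theta> * v i)) + (1 - t) * (\<Sum>k. A k i j)) - Areal A y i j * (h j / y))"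
      using y by (intro sums_diff sums_mult sums_mult2 sums_add ratio_sums A_sums Areal_sums) auto
    moreover have "h i * (t * (A k i j * ratio k i j) + (1 - t) * A k i j) - A k i j * y ^ k * (h j / y) = d i k j" for k
      unfolding d_def rp using h0[of i] y by (simp add: field_simps)
    ultimately show ?thesis by (simp add: s_def)
  qed
  have tot: "(\<Sum>j\<in>UNIV. s i j) = h i - (\<Sum>j\<in>UNIV. Areal A y i j / y * h j)" for i
  proof -
    have "(\<Sum>j\<in>UNIV. s i j) = h i * (t * (\<Sum>j\<in>UNIV. Areal A \<theta> i j * v j / (\<theta> * v i)) + (1 - t) * (\<Sum>j\<in>UNIV. \<Sum>k. A k i j))
       - (\<Sum>j\<in>UNIV. Areal A y i j / y * h j)"
      unfolding s_def by (simp only: sum_subtractf sum.distrib sum_distrib_left distrib_left)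
    then show ?thesis by (simp only: ratio_total stochastic) simp
  qed
  obtain k i j where kij: "A k i j > 0" "ratio k i j \<noteq> 1" using ratio_nontrivial by blast
  show ?thesis
  proof (rule that[of h i, OF h0])
    show "(\<Sum>j\<in>UNIV. Areal A y i j / y * h j) \<le> h i" for i
      using nonneg_double_sum_pos(1)[where d = "d i" and s = "s i", OF ds dnn] tot[of i] by simp
    show "(\<Sum>j\<in>UNIV. Areal A y i j / y * h j) < h i"
      using nonneg_double_sum_pos(2)[where d = "d i" and s = "s i", OF ds dnn dpos[OF kij]] tot[of i] by simp
  qed
qed

lemma charmat_nondegenerate_between:
  assumes "1 < norm z" "norm z < \<theta>"
  shows "left_nondegenerate (charmat A z)"
  unfolding left_nondegenerate_def
proof (intro allI impI)
  fix c i assume c: "\<forall>j. (\<Sum>i\<in>UNIV. c i * charmat A z i j) = 0"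
  let ?y = "norm z"
  have z0: "z \<noteq> 0" using assms by auto
  obtain h k where h: "\<And>i. h i > 0" "\<And>i. (\<Sum>j\<in>UNIV. Areal A ?y i j / ?y * h j) \<le> h i"
    "(\<Sum>j\<in>UNIV. Areal A ?y k j / ?y * h j) < h k"
    using superharmonic_between[OF assms] by blast
  show "c i = 0"
  proof (rule strictly_superharmonic_no_left_fixed[OF _ _ h, where Z = "\<lambda>i j. Astar A z i j / z"])
    show "irreducible_mat (\<lambda>i j. Areal A ?y i j / ?y)" "Areal A ?y i j / ?y \<ge> 0" for i j
      using Areal_scaled_irreducible[of ?y] assms z0 by auto
    show "norm (Astar A z i j / z) \<le> Areal A ?y i j / ?y" for i j
      unfolding norm_divide
      by (intro divide_right_mono norm_Astar_le) (use less_radius[of ?y] assms nonneg in auto)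
    show "(\<Sum>i\<in>UNIV. c i * (Astar A z i j / z)) = c j" for j
      using c[rule_format, of j] z0 by (simp add: charmat_left_mult nonzero_divide_eq_eq mult.commute flip: sum_divide_distrib)
  qed
qed

text \<open>The relative entropy of the twisted kernel against the original one, averaged over
  \<open>\<mu> i * v i\<close>, is positive. Since this measure is stationary for the twisted
  kernel, the \<open>ln v\<close> terms cancel and the entropy equals \<open>ln \<theta>\<close>
  times the excess of the left side over 1.\<close>

lemma mean_drift_at_\<theta>: "(\<Sum>i\<in>UNIV. \<Sum>j\<in>UNIV. \<mu> i * dAreal A \<theta> i j * v j) > 1"
proof -
  define L where "L = ln \<theta>"
  define f where "f = (\<lambda>i. ln (v i))"
  have L0: "L > 0" using \<theta>_gt_1 by (simp add: L_def)
  have lr: "ln (ratio k i j) = real k * L - L + (f j - f i)" for k i j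
    using \<theta>_gt_1 v_pos[of i] v_pos[of j] by (simp add: ratio_def ln_div ln_mult ln_realpow L_def f_def)
  define d where "d = (\<lambda>i k j. \<mu> i * v i * (A k i j * (ratio k i j * ln (ratio k i j) - ratio k i j + 1)))"
  have dnn: "d i k j \<ge> 0" for i k j
    unfolding d_def using \<mu>_pos[of i] v_pos[of i] nonneg entropy_strict(1)[OF ratio_pos]
    by (intro mult_nonneg_nonneg) (auto simp: less_imp_le)
  have dpos: "d i k j > 0" if "A k i j > 0" "ratio k i j \<noteq> 1" for i k j
    unfolding d_def using \<mu>_pos[of i] v_pos[of i] that entropy_strict(2)[OF ratio_pos that(2)] by simp
  \<comment> \<open>The stationary flow of the twisted phase chain from i to j; both of its
    marginals are \<open>\<mu> i * v i\<close>, by the two eigenvector equations.\<close>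
  define B where "B = (\<lambda>i j. \<mu> i * Areal A \<theta> i j * v j / \<theta>)"
  define s where "s = (\<lambda>i j. L * (\<mu> i * dAreal A \<theta> i j * v j) + B i j * f j - (f i + L + 1) * B i j + \<mu> i * v i * (\<Sum>k. A k i j))"
  have ds: "(\<lambda>k. d i k j) sums s i j" for i j
  proof -
    have "(\<lambda>k. \<mu> i * L * v j / \<theta> * (real k * A k i j * \<theta> ^ k)
         + \<mu> i * v i * (f j - f i - L - 1) * (A k i j * ratio k i j) + \<mu> i * v i * A k i j) sums
       (\<mu> i * L * v j / \<theta> * (\<theta> * dAreal A \<theta> i j)
         + \<mu> i * v i * (f j - f i - L - 1) * (Areal A \<theta> i j * v j / (\<theta> * v i)) + \<mu> i * v i * (\<Sum>k. A k i j))"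
      using less_radius[of \<theta>] \<theta>_gt_1 by (intro sums_mult sums_add ratio_sums A_sums dAreal_sums) auto
    moreover have "\<mu> i * L * v j / \<theta> * (real k * A k i j * \<theta> ^ k)
         + \<mu> i * v i * (f j - f i - L - 1) * (A k i j * ratio k i j) + \<mu> i * v i * A k i j = d i k j" for k
    proof -
      have "\<mu> i * L * v j / \<theta> * (real k * A k i j * \<theta> ^ k) = \<mu> i * v i * A k i j * (real k * L) * ratio k i j"
        using \<theta>_gt_1 v_pos[of i] by (simp add: ratio_def field_simps)
      then show ?thesis unfolding d_def lr by (simp add: algebra_simps)
    qed
    moreover have "\<mu> i * L * v j / \<theta> * (\<theta> * dAreal A \<theta> i j)
         + \<mu> i * v i * (f j - f i - L - 1) * (Areal A \<theta> i j * v j / (\<theta> * v i)) + \<mu> i * v i * (\<Sum>k. A k i j) = s i j"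
      using \<theta>_gt_1 v_pos[of i] by (simp add: s_def B_def field_simps)
    ultimately show ?thesis by simp
  qed
  have B1: "(\<Sum>j\<in>UNIV. B i j) = \<mu> i * v i" for i
  proof -
    have "(\<Sum>j\<in>UNIV. B i j) = \<mu> i * (\<Sum>j\<in>UNIV. Areal A \<theta> i j * v j) / \<theta>"
      by (simp add: B_def sum_distrib_left mult.assoc flip: sum_divide_distrib)
    then show ?thesis using v_eig[of i] \<theta>_gt_1 by simp
  qed
  have B2: "(\<Sum>i\<in>UNIV. B i j) = \<mu> j * v j" for j
  proof -
    have "(\<Sum>i\<in>UNIV. B i j) = (\<Sum>i\<in>UNIV. \<mu> i * Areal A \<theta> i j) * v j / \<theta>"
      by (simp add: B_def sum_distrib_right flip: sum_divide_distrib)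
    then show ?thesis using \<mu>_eig[of j] \<theta>_gt_1 by simp
  qed
  have "(\<Sum>i\<in>UNIV. \<Sum>j\<in>UNIV. s i j) = L * (\<Sum>i\<in>UNIV. \<Sum>j\<in>UNIV. \<mu> i * dAreal A \<theta> i j * v j)
      + (\<Sum>i\<in>UNIV. \<Sum>j\<in>UNIV. B i j * f j) - (\<Sum>i\<in>UNIV. (f i + L + 1) * (\<Sum>j\<in>UNIV. B i j))
      + (\<Sum>i\<in>UNIV. \<mu> i * v i * (\<Sum>j\<in>UNIV. \<Sum>k. A k i j))"
    by (simp add: s_def sum.distrib sum_subtractf sum_distrib_left)
  also have "(\<Sum>i\<in>UNIV. \<Sum>j\<in>UNIV. B i j * f j) = (\<Sum>j\<in>UNIV. (\<Sum>i\<in>UNIV. B i j) * f j)"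
    by (subst sum.swap) (simp add: sum_distrib_right)
  also have "L * (\<Sum>i\<in>UNIV. \<Sum>j\<in>UNIV. \<mu> i * dAreal A \<theta> i j * v j)
      + (\<Sum>j\<in>UNIV. (\<Sum>i\<in>UNIV. B i j) * f j) - (\<Sum>i\<in>UNIV. (f i + L + 1) * (\<Sum>j\<in>UNIV. B i j))
      + (\<Sum>i\<in>UNIV. \<mu> i * v i * (\<Sum>j\<in>UNIV. \<Sum>k. A k i j))
     = L * ((\<Sum>i\<in>UNIV. \<Sum>j\<in>UNIV. \<mu> i * dAreal A \<theta> i j * v j) - (\<Sum>i\<in>UNIV. \<mu> i * v i))"
    unfolding B1 B2 stochastic by (simp add: algebra_simps sum.distrib sum_distrib_left)
  finally have eq: "(\<Sum>i\<in>UNIV. \<Sum>j\<in>UNIV. s i j) = L * ((\<Sum>i\<in>UNIV. \<Sum>j\<in>UNIV. \<mu> i * dAreal A \<theta> i j * v j) - 1)"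
    unfolding \<mu>v .
  obtain k i j where kij: "A k i j > 0" "ratio k i j \<noteq> 1" using ratio_nontrivial by blast
  have "(\<Sum>j\<in>UNIV. s i j) \<ge> 0" for i
    by (rule nonneg_double_sum_pos(1)[where d = "d i" and s = "s i", OF ds dnn])
  then have "(\<Sum>i\<in>UNIV. \<Sum>j\<in>UNIV. s i j) > 0"
    using nonneg_double_sum_pos(2)[where d = "d i" and s = "s i", OF ds dnn dpos[OF kij]]
    by (intro sum_pos2[of UNIV i "\<lambda>i. \<Sum>j\<in>UNIV. s i j"]) auto
  then show ?thesis unfolding eq using L0 by (simp add: zero_less_mult_iff)
qed

lemma dDelta_eq: "dDelta A \<theta> = (\<Sum>i\<in>UNIV. \<Sum>j\<in>UNIV. \<mu> i * dAreal A \<theta> i j * v j)"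
proof -
  obtain K where K: "ereal \<theta> < ereal K" "ereal K < mat_conv_radius A"
    using ereal_dense2[OF \<theta>_less] by blast
  let ?Y = "{0<..<K}"
  have r: "ereal \<bar>y\<bar> < mat_conv_radius A" "ereal y < mat_conv_radius A" if "y \<in> ?Y" for y
    using that K(2) by (auto intro: less_trans[of _ "ereal K"])
  have th: "\<theta> \<in> ?Y" using \<theta>_gt_1 K(1) by simp
  have D: "((\<lambda>y. Re (delta (\<lambda>i j. of_real (Areal A y i j)))) has_real_derivative (\<Sum>i\<in>UNIV. \<Sum>j\<in>UNIV. \<mu> i * dAreal A \<theta> i j * v j)) (at \<theta>)"
    by (rule delta_has_real_derivative[where Y = ?Y and ?r0.0 = \<theta>])
      (use r th \<theta>_gt_1 \<mu>_pos v_pos \<mu>_eig v_eig \<mu>v in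
        \<open>auto intro!: Areal_irreducible Areal_nonneg Areal_has_field_derivative\<close>)
  have "((\<lambda>y. Re (delta (Astar A (of_real y)))) has_real_derivative (\<Sum>i\<in>UNIV. \<Sum>j\<in>UNIV. \<mu> i * dAreal A \<theta> i j * v j)) (at \<theta>)"
  proof (rule has_field_derivative_transform_within_open[OF D _ th])
    fix y assume "y \<in> ?Y"
    then have "Astar A (of_real y) = (\<lambda>i j. of_real (Areal A y i j))" using Astar_of_real[OF r(1)] by blast
    then show "Re (delta (\<lambda>i j. of_real (Areal A y i j))) = Re (delta (Astar A (of_real y)))" by simp
  qed simp
  then show ?thesis unfolding dDelta_def by (rule DERIV_imp_deriv)
qed

lemma dDelta_gt_1: "dDelta A \<theta> > 1"
  using dDelta_eq mean_drift_at_\<theta> by simp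

end

section \<open>Null vectors on the circle of radius \<theta>\<close>

context mg1_kernel
begin

text \<open>The equality case of the triangle inequality. On the circle the moduli of c are
  invariant for the dominating nonnegative matrix, so in the equation for \<open>c j\<close> no
  cancellation occurs and every nonzero summand has the phase of \<open>c j\<close>.\<close>

lemma circle_left_null_phase:
  assumes z: "norm z = \<theta>" and c: "\<And>j. (\<Sum>i\<in>UNIV. c i * charmat A z i j) = 0" and nz: "c l \<noteq> 0"
    and pos: "A k i j > 0"
  shows "sgn (c i) * (z / of_real \<theta>) ^ k = z / of_real \<theta> * sgn (c j)"
proof -
  have th: "\<theta> > 0" using \<theta>_gt_1 by simp
  have z0: "z \<noteq> 0" using z th by auto
  let ?Q = "\<lambda>i j. Areal A \<theta> i j / \<theta>" and ?Z = "\<lambda>i j. Astar A z i j / z"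
  have rad: "ereal (norm z) < mat_conv_radius A" using less_radius[of \<theta>] z th by simp
  have ZQ: "norm (?Z i j) \<le> ?Q i j" for i j
    unfolding norm_divide z[symmetric] by (intro divide_right_mono norm_Astar_le rad nonneg) auto
  have cZ: "(\<Sum>i\<in>UNIV. c i * ?Z i j) = c j" for j
    using c[of j] z0 by (simp add: charmat_left_mult nonzero_divide_eq_eq mult.commute flip: sum_divide_distrib)
  have vQ: "(\<Sum>j\<in>UNIV. ?Q i j * v j) \<le> v i" for i
    using v_eig[of i] th by (simp flip: sum_divide_distrib)
  note inv = left_subinvariant_imp_invariant(1)[where q = "\<lambda>i. norm (c i)" and h = v,
      OF norm_ge_zero v_pos left_fixed_norm_le[OF ZQ cZ] vQ]
  have nzc: "c i \<noteq> 0" for i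
  proof
    assume "c i = 0"
    then have "norm (c i) = 0" by simp
    from irreducible_left_fixed_zero[OF Areal_scaled_irreducible[OF th order_refl] norm_ge_zero inv this]
    have "norm (c l) = 0" .
    then show False using nz by simp
  qed
  \<comment> \<open>The unit that rotates \<open>c j\<close> onto the positive axis, so that
    equality of phases becomes equality of real part and modulus.\<close>
  define e where "e = cnj (sgn (c j))"
  have e1: "norm e = 1" using nzc[of j] by (simp add: e_def norm_sgn)
  have es: "e * sgn (c j) = 1"
    using nzc[of j] complex_norm_square[of "sgn (c j)"] by (simp add: e_def norm_sgn mult.commute)
  have pol: "c i = of_real (norm (c i)) * sgn (c i)" for i
    using nzc[of i] by (simp add: sgn_eq)
  have ec: "e * c j = of_real (norm (c j))"
    using es by (subst pol) simp
  \<comment> \<open>Modulus minus real part of each summand: nonnegative terms whose total is 0 by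
    invariance.\<close>
  define d where "d = (\<lambda>k i. norm (c i) / \<theta> * (A k i j * \<theta> ^ k) - Re (e * c i / z * (of_real (A k i j) * z ^ k)))"
  have nrm: "norm (e * c i / z * (of_real (A k i j) * z ^ k)) = norm (c i) / \<theta> * (A k i j * \<theta> ^ k)" for k i
    using nonneg[of k i j] by (simp add: norm_mult norm_divide norm_power e1 z)
  have dnn: "d k i \<ge> 0" for k i
    using complex_Re_le_cmod[of "e * c i / z * (of_real (A k i j) * z ^ k)"] unfolding d_def nrm by simp
  have ds: "(\<lambda>k. d k i) sums (norm (c i) / \<theta> * Areal A \<theta> i j - Re (e * c i / z * Astar A z i j))" for i
    unfolding d_def
  proof (intro sums_diff sums_mult Areal_sums)
    have "(\<lambda>k. of_real (A k i j) * z ^ k) sums Astar A z i j"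
      unfolding Astar_def using summable_sums[OF mat_power_series_summable(2)[OF rad]] by (simp add: mult.commute)
    then show "(\<lambda>k. Re (e * c i / z * (of_real (A k i j) * z ^ k))) sums Re (e * c i / z * Astar A z i j)"
      by (intro sums_Re sums_mult)
  qed (use th in simp)
  have "(\<Sum>i\<in>UNIV. norm (c i) / \<theta> * Areal A \<theta> i j - Re (e * c i / z * Astar A z i j))
      = (\<Sum>i\<in>UNIV. norm (c i) * ?Q i j) - Re (e * (\<Sum>i\<in>UNIV. c i * ?Z i j))"
    by (simp add: sum_subtractf sum_distrib_left mult.assoc)
  also have "\<dots> = 0" unfolding inv cZ ec by simp
  finally have "d k i = 0"
    using nonneg_double_sum_pos(2)[where d = d and k = k and j = i, OF ds dnn] dnn[of k i] by linarith
  then have "Re (e * c i / z * (of_real (A k i j) * z ^ k)) = norm (e * c i / z * (of_real (A k i j) * z ^ k))"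
    unfolding nrm by (simp add: d_def)
  then have "e * c i / z * (of_real (A k i j) * z ^ k) = of_real (norm (e * c i / z * (of_real (A k i j) * z ^ k)))"
    using Im_eq_0[of "e * c i / z * (of_real (A k i j) * z ^ k)"] by (auto simp: complex_eq_iff)
  then have "e * (of_real (norm (c i)) * sgn (c i)) / z * (of_real (A k i j) * z ^ k) = of_real (norm (c i) / \<theta> * (A k i j * \<theta> ^ k))"
    unfolding nrm by (subst (asm) (1) pol)
  then have "of_real (norm (c i) * A k i j) * (e * sgn (c i) / z * z ^ k) = of_real (norm (c i) * A k i j) * of_real (1 / \<theta> * \<theta> ^ k)"
    by (simp add: mult_ac)
  moreover have "complex_of_real (norm (c i) * A k i j) \<noteq> 0"
    using pos nzc[of i] by simp
  ultimately have "e * sgn (c i) / z * z ^ k = of_real (1 / \<theta> * \<theta> ^ k)"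
    using mult_left_cancel by blast
  then have *: "e * (sgn (c i) * (z / of_real \<theta>) ^ k) = z / of_real \<theta>"
    using th z0 by (simp add: field_simps power_divide)
  have "sgn (c i) * (z / of_real \<theta>) ^ k = (e * sgn (c j)) * (sgn (c i) * (z / of_real \<theta>) ^ k)"
    unfolding es by simp
  also have "\<dots> = e * (sgn (c i) * (z / of_real \<theta>) ^ k) * sgn (c j)" by (simp only: mult_ac)
  finally show "sgn (c i) * (z / of_real \<theta>) ^ k = z / of_real \<theta> * sgn (c j)" unfolding * .
qed

text \<open>The phase relation telescopes along paths of the additive process, one power of \<zeta>
  per level. A path returning to phase l with displacement k therefore gives
  \<open>\<zeta> powi k = 1\<close>, and \<tau> is the gcd of these displacements.\<close>

lemma circle_left_null_root_of_unity:
  assumes z: "norm z = \<theta>" and c: "\<And>j. (\<Sum>i\<in>UNIV. c i * charmat A z i j) = 0" and nz: "c l \<noteq> 0"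
  shows "(z / of_real \<theta>) ^ \<tau> = 1"
proof -
  define \<zeta> where "\<zeta> = z / of_real \<theta>"
  have \<zeta>0: "\<zeta> \<noteq> 0" using z \<theta>_gt_1 by (auto simp: \<zeta>_def)
  have one_step: "sgn (c (snd a)) * \<zeta> powi (fst b - fst a) = sgn (c (snd b))" if "(a, b) \<in> MAP_step A" for a b
  proof (cases a; cases b)
    fix k0 i k1 j assume ab: "a = (k0, i)" "b = (k1, j)"
    then have k: "k1 - k0 \<ge> -1" "A (nat (k1 - k0 + 1)) i j > 0" using that by (auto simp: MAP_step_def)
    have "\<zeta> ^ nat (k1 - k0 + 1) = \<zeta> powi (k1 - k0 + 1)" using k(1) by (simp add: power_int_def)
    also have "\<dots> = \<zeta> powi (k1 - k0) * \<zeta>" using \<zeta>0 by (simp add: power_int_add)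
    finally have "sgn (c i) * (\<zeta> powi (k1 - k0) * \<zeta>) = \<zeta> * sgn (c j)"
      using circle_left_null_phase[OF z c nz k(2)] by (simp add: \<zeta>_def)
    then show ?thesis using \<zeta>0 by (simp add: ab)
  qed
  have path: "sgn (c (snd a)) * \<zeta> powi (fst b - fst a) = sgn (c (snd b))" if "(a, b) \<in> (MAP_step A)\<^sup>+" for a b
    using that
  proof (induction rule: trancl_induct)
    case (step b b')
    have "\<zeta> powi (fst b' - fst a) = \<zeta> powi (fst b - fst a) * \<zeta> powi (fst b' - fst b)"
      using \<zeta>0 by (simp flip: power_int_add)
    then show ?case using step.IH \<open>(b, b') \<in> MAP_step A\<close>[THEN one_step] by (metis mult.assoc)
  qed (rule one_step)
  have "\<zeta> ^ \<tau> = 1"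
  proof (rule power_Gcd_eq_1[OF \<zeta>0 _ \<tau>_Gcd[of l] \<tau>_pos])
    fix k assume "k \<in> {k. k \<noteq> 0 \<and> ((0, l), (k, l)) \<in> (MAP_step A)\<^sup>+}"
    then have "sgn (c l) * \<zeta> powi k = sgn (c l)" using path[of "(0, l)" "(k, l)"] by simp
    then show "\<zeta> powi k = 1" using nz by (simp add: sgn_zero_iff)
  qed
  then show ?thesis by (simp add: \<zeta>_def)
qed

lemma power_period:
  fixes u :: complex
  assumes u: "u ^ \<tau> = 1" and pos: "A k i j > 0"
  shows "u ^ k * u ^ p i = u * u ^ p j"
proof -
  \<comment> \<open>The matrix with index k moves the level by \<open>k - 1\<close>. Adding
    \<open>1 + p i\<close> on both sides below makes the exponents nonnegative.\<close>
  have "(int k - 1) mod int \<tau> = (int (p j) - int (p i)) mod int \<tau>"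
    using p_mod[of "int k - 1" i j] pos by simp
  then have "(int k - 1 + (1 + int (p i))) mod int \<tau> = (int (p j) - int (p i) + (1 + int (p i))) mod int \<tau>"
    by (rule mod_add_cong) simp
  then have "int (k + p i) mod int \<tau> = int (1 + p j) mod int \<tau>" by (simp add: add.commute)
  from power_eq_if_cong[OF u \<tau>_pos this] show ?thesis by (simp add: power_add)
qed

text \<open>Modulo \<tau> the index k is determined by i and j, so rotating the argument by a
  \<tau>-th root of unity multiplies each entry by one fixed power of u: a diagonal similarity
  together with the scalar u.\<close>

lemma Astar_rotate:
  fixes u :: complex
  assumes u: "u ^ \<tau> = 1" and z: "ereal (norm z) < mat_conv_radius A"
  shows "Astar A (z * u) i j = u * DeltaM p u i * Astar A z i j * inverse (DeltaM p u j)"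
proof -
  have u0: "u \<noteq> 0" using u \<tau>_pos by (auto simp: power_0_left)
  have "(\<lambda>k. u * DeltaM p u i * inverse (DeltaM p u j) * (of_real (A k i j) * z ^ k)) sums (u * DeltaM p u i * inverse (DeltaM p u j) * Astar A z i j)"
    unfolding Astar_def using summable_sums[OF mat_power_series_summable(2)[OF z]] by (intro sums_mult) (simp add: mult.commute)
  moreover have "u * DeltaM p u i * inverse (DeltaM p u j) * (of_real (A k i j) * z ^ k) = (z * u) ^ k * of_real (A k i j)" for k
  proof (cases "A k i j = 0")
    case False
    then have "A k i j > 0" using nonneg[of k i j] by simp
    from power_period[OF u this] have "u * inverse (u ^ p i) * u ^ p j = u ^ k"
      using u0 by (simp add: field_simps)
    then show ?thesis by (simp add: DeltaM_def power_mult_distrib mult_ac)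
  qed simp
  ultimately have "(\<lambda>k. (z * u) ^ k * of_real (A k i j)) sums (u * DeltaM p u i * inverse (DeltaM p u j) * Astar A z i j)"
    by (simp only:)
  then show ?thesis unfolding Astar_def[of A "z * u"] by (simp add: sums_iff mult_ac)
qed

text \<open>Differentiation lowers the exponent by one, which absorbs the scalar u of the rotation
  rule and leaves a pure similarity.\<close>

lemma dAstar_rotate:
  fixes u :: complex
  assumes u: "u ^ \<tau> = 1"
  shows "dAstar A (of_real \<theta> * u) i j = DeltaM p u i * of_real (dAreal A \<theta> i j) * inverse (DeltaM p u j)"
proof -
  have u0: "u \<noteq> 0" using u \<tau>_pos by (auto simp: power_0_left)
  have "(\<lambda>n. DeltaM p u i * inverse (DeltaM p u j) * of_real (diffs (\<lambda>k. A k i j) n * \<theta> ^ n)) sums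
      (DeltaM p u i * inverse (DeltaM p u j) * of_real (dAreal A \<theta> i j))"
    unfolding dAreal_def
    by (intro sums_mult sums_of_real summable_sums summable_diffs_mat) (use less_radius[of \<theta>] \<theta>_gt_1 in simp)
  moreover have "DeltaM p u i * inverse (DeltaM p u j) * of_real (diffs (\<lambda>k. A k i j) n * \<theta> ^ n)
      = diffs (\<lambda>k. complex_of_real (A k i j)) n * (of_real \<theta> * u) ^ n" for n
  proof (cases "A (Suc n) i j = 0")
    case True then show ?thesis by (simp add: diffs_def)
  next
    case False
    then have "A (Suc n) i j > 0" using nonneg[of "Suc n" i j] by simp
    from power_period[OF u this] have "inverse (u ^ p i) * u ^ p j = u ^ n"
      using u0 by (simp add: field_simps)
    then have "DeltaM p u i * inverse (DeltaM p u j) = u ^ n" by (simp add: DeltaM_def)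
    then show ?thesis by (simp add: diffs_def power_mult_distrib)
  qed
  ultimately have "(\<lambda>n. diffs (\<lambda>k. complex_of_real (A k i j)) n * (of_real \<theta> * u) ^ n) sums
      (DeltaM p u i * inverse (DeltaM p u j) * of_real (dAreal A \<theta> i j))"
    by (simp only:)
  then show ?thesis unfolding dAstar_def by (simp add: sums_iff mult_ac)
qed

lemma Astar_at_rotated_\<theta>:
  assumes "u ^ \<tau> = 1"
  shows "Astar A (of_real \<theta> * u) i j = u * DeltaM p u i * of_real (Areal A \<theta> i j) * inverse (DeltaM p u j)"
proof -
  have r: "ereal \<bar>\<theta>\<bar> < mat_conv_radius A" using less_radius[of \<theta>] \<theta>_gt_1 by simp
  then show ?thesis using Astar_rotate[OF assms, of "of_real \<theta>"] Astar_of_real[OF r] by simp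
qed

lemma DeltaM_nonzero: "u ^ \<tau> = 1 \<Longrightarrow> DeltaM p u i \<noteq> 0"
  using \<tau>_pos by (auto simp: DeltaM_def power_0_left)

text \<open>Undoing the rotation with the diagonal matrix turns c into a left fixed vector of the
  irreducible matrix A*(\<theta>)/\<theta>, whose fixed vectors are the multiples of \<mu>.\<close>

lemma rotated_left_null:
  assumes u: "u ^ \<tau> = 1" and c: "\<And>j. (\<Sum>i\<in>UNIV. c i * charmat A (of_real \<theta> * u) i j) = 0"
  shows "\<exists>\<alpha>. \<forall>i. c i = \<alpha> * (of_real (\<mu> i) * inverse (DeltaM p u i))"
proof -
  have th: "\<theta> > 0" using \<theta>_gt_1 by simp
  have u0: "u \<noteq> 0" using u \<tau>_pos by (auto simp: power_0_left)
  note D = DeltaM_nonzero[OF u]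
  have "(\<Sum>i\<in>UNIV. c i * DeltaM p u i * of_real (Areal A \<theta> i j / \<theta>)) = c j * DeltaM p u j" for j
  proof -
    have "of_real \<theta> * u * c j = (\<Sum>i\<in>UNIV. c i * Astar A (of_real \<theta> * u) i j)"
      using c[of j] by (simp add: charmat_left_mult)
    also have "\<dots> = u * inverse (DeltaM p u j) * of_real \<theta> * (\<Sum>i\<in>UNIV. c i * DeltaM p u i * of_real (Areal A \<theta> i j / \<theta>))"
      unfolding Astar_at_rotated_\<theta>[OF u] sum_distrib_left by (intro sum.cong) (use th in auto)
    finally show ?thesis using u0 th D[of j] by (simp add: field_simps)
  qed
  moreover have "(\<Sum>i\<in>UNIV. \<mu> i * (Areal A \<theta> i j / \<theta>)) = \<mu> j" for j
    using \<mu>_eig[of j] th by (simp flip: sum_divide_distrib)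
  ultimately have "\<exists>\<alpha>. \<forall>i. c i * DeltaM p u i = \<alpha> * of_real (\<mu> i)"
    by (intro irreducible_left_fixed_unique[where Q = "\<lambda>i j. Areal A \<theta> i j / \<theta>"]
        Areal_scaled_irreducible[OF th order_refl] \<mu>_pos)
  then obtain \<alpha> where \<alpha>: "\<And>i. c i * DeltaM p u i = \<alpha> * of_real (\<mu> i)" by blast
  have "c i = \<alpha> * (of_real (\<mu> i) * inverse (DeltaM p u i))" for i
    using \<alpha>[of i] D[of i] by (simp add: field_simps)
  then show ?thesis by blast
qed

lemma rotated_right_null:
  assumes u: "u ^ \<tau> = 1"
  shows "(\<Sum>j\<in>UNIV. charmat A (of_real \<theta> * u) i j * (DeltaM p u j * of_real (v j))) = 0"
proof -
  note D = DeltaM_nonzero[OF u]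
  have "(\<Sum>j\<in>UNIV. Astar A (of_real \<theta> * u) i j * (DeltaM p u j * of_real (v j)))
      = u * DeltaM p u i * of_real (\<Sum>j\<in>UNIV. Areal A \<theta> i j * v j)"
    unfolding Astar_at_rotated_\<theta>[OF u] of_real_sum sum_distrib_left by (intro sum.cong) (use D in auto)
  then show ?thesis by (simp add: charmat_right_mult v_eig)
qed

lemma charmat_has_field_derivative:
  assumes "ereal (norm z) < mat_conv_radius A"
  shows "((\<lambda>z. charmat A z i j) has_field_derivative ((if i = j then 1 else 0) - dAstar A z i j)) (at z)"
  unfolding charmat_def
  by (intro DERIV_diff Astar_has_field_derivative assms) (cases "i = j"; auto)

text \<open>The diagonal rotations cancel between the two null vectors, so the denominator of the
  leading coefficient is the same at all rotated points.\<close>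

lemma rotated_derivative_pairing:
  assumes u: "u ^ \<tau> = 1"
  shows "(\<Sum>i\<in>UNIV. \<Sum>j\<in>UNIV. of_real (\<mu> i) * inverse (DeltaM p u i)
      * ((if i = j then 1 else 0) - dAstar A (of_real \<theta> * u) i j) * (DeltaM p u j * of_real (v j)))
    = of_real (1 - dDelta A \<theta>)"
proof -
  note D = DeltaM_nonzero[OF u]
  have "of_real (\<mu> i) * inverse (DeltaM p u i)
      * ((if i = j then 1 else 0) - dAstar A (of_real \<theta> * u) i j) * (DeltaM p u j * of_real (v j))
     = (if i = j then of_real (\<mu> i * v i) else 0) - of_real (\<mu> i * dAreal A \<theta> i j * v j)" for i j
    unfolding dAstar_rotate[OF u] using D[of i] D[of j] by (simp add: field_simps)
  then show ?thesis
    by (simp only: sum_subtractf) (simp add: sum.delta dDelta_eq flip: of_real_sum of_real_mult add: \<mu>v)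
qed
end

section \<open>The stationary distribution\<close>

lemma mg1_T_pos_states:
  assumes "mg1_T B0 B C0 A s t > 0"
  shows "s \<in> mg1_states" "t \<in> mg1_states"
  using assms
  by (cases s; cases t; auto simp: mg1_T_def mg1_states_def split: sum.splits nat.splits if_splits)+

lemma mg1_T_nonneg:
  assumes "\<And>k i j. A k i j \<ge> 0" "\<And>i j. B0 i j \<ge> 0" "\<And>k i j. B k i j \<ge> 0" "\<And>i j. C0 i j \<ge> 0"
  shows "mg1_T B0 B C0 A s t \<ge> 0"
  by (cases s; cases t) (simp add: mg1_T_def assms split: sum.split nat.split)

text \<open>Some state carries mass because the total is 1. By balance the mass of a state is at
  least any single inflow \<open>X s * P s t\<close>, so positivity travels along every
  edge.\<close>

lemma stationary_positive:
  fixes X :: "'s \<Rightarrow> real"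
  assumes irr: "\<And>s t. s \<in> S \<Longrightarrow> t \<in> S \<Longrightarrow> (s, t) \<in> {(s, t). P s t > 0}\<^sup>+"
    and supp: "\<And>s t. P s t > 0 \<Longrightarrow> s \<in> S \<and> t \<in> S" and nn: "\<And>s t. P s t \<ge> 0"
    and X0: "\<And>s. X s \<ge> 0" and X1: "(X has_sum 1) S"
    and stat: "\<And>t. t \<in> S \<Longrightarrow> ((\<lambda>s. X s * P s t) has_sum X t) S" and t: "t \<in> S"
  shows "X t > 0"
proof -
  have "\<exists>s\<in>S. X s > 0"
  proof (rule ccontr)
    assume "\<not> ?thesis"
    then have "X s = 0" if "s \<in> S" for s using X0[of s] that by force
    then have "(X has_sum 0) S" by (rule has_sum_0)
    then show False using X1 has_sum_unique by fastforce
  qed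
  then obtain s where s: "s \<in> S" "X s > 0" by blast
  have step: "X b > 0" if a: "X a > 0" and ab: "P a b > 0" for a b
  proof -
    have "((\<lambda>s. X s * P s b) has_sum X a * P a b) {a}" by (intro has_sum_finiteI) auto
    moreover have "((\<lambda>s. X s * P s b) has_sum X b) S" using stat supp[OF ab] by blast
    ultimately have "X a * P a b \<le> X b"
      using supp[OF ab] X0 nn by (elim has_sum_mono2) auto
    then show ?thesis using a ab by (smt (verit) mult_pos_pos)
  qed
  have "(s, t) \<in> {(s, t). P s t > 0}\<^sup>+" using irr s t by blast
  then show ?thesis by (induction rule: trancl_induct) (use s step in auto)
qed

lemma mg1_balance:
  fixes x0 :: "'a::finite \<Rightarrow> real" and x :: "nat \<Rightarrow> 'b::finite \<Rightarrow> real"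
  assumes stat: "((\<lambda>s. mg1_vec x0 x s * mg1_T B0 B C0 A s (k, Inr j)) has_sum mg1_vec x0 x (k, Inr j)) mg1_states"
    and k: "k \<ge> 1"
  shows "x k j = (\<Sum>i\<in>UNIV. x0 i * B k i j) + (\<Sum>l=1..k+1. \<Sum>i\<in>UNIV. x l i * A (k + 1 - l) i j)"
proof -
  let ?f = "\<lambda>s. mg1_vec x0 x s * mg1_T B0 B C0 A s (k, Inr j)"
  define F1 where "F1 = range (\<lambda>i::'a. (0::nat, Inl i :: 'a + 'b))"
  define F2 where "F2 = (\<lambda>(l, i). (l::nat, Inr i :: 'a + 'b)) ` ({1..k+1} \<times> UNIV)"
  have fin: "finite F1" "finite F2" "F1 \<inter> F2 = {}" by (auto simp: F1_def F2_def)
  have "(?f has_sum (\<Sum>s\<in>F1 \<union> F2. ?f s)) mg1_states"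
  proof (rule has_sum_finite_neutralI)
    show "finite (F1 \<union> F2)" using fin by simp
    show "F1 \<union> F2 \<subseteq> mg1_states" by (auto simp: F1_def F2_def mg1_states_def)
    fix s assume s: "s \<in> mg1_states - (F1 \<union> F2)"
    then obtain l i where li: "s = (l, Inr i)" "l \<ge> 1" by (auto simp: F1_def mg1_states_def)
    \<comment> \<open>Levels drop by at most one per step, so level k receives nothing from levels
      above \<open>k + 1\<close>; this makes the balance sum finite.\<close>
    then have "\<not> l \<le> k + 1" using s by (auto simp: F2_def)
    then show "?f s = 0" using li by (auto simp: mg1_T_def split: nat.splits)
  qed simp
  then have "mg1_vec x0 x (k, Inr j) = (\<Sum>s\<in>F1 \<union> F2. ?f s)"
    using stat has_sum_unique by blast
  also have "\<dots> = (\<Sum>s\<in>F1. ?f s) + (\<Sum>s\<in>F2. ?f s)" by (rule sum.union_disjoint[OF fin])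
  also have "(\<Sum>s\<in>F1. ?f s) = (\<Sum>i\<in>UNIV. ?f (0, Inl i))"
    unfolding F1_def by (subst sum.reindex) (auto simp: inj_on_def)
  also have "\<dots> = (\<Sum>i\<in>UNIV. x0 i * B k i j)"
    using k by (intro sum.cong) (auto simp: mg1_vec_def mg1_T_def split: nat.splits)
  also have "(\<Sum>s\<in>F2. ?f s) = (\<Sum>(l, i)\<in>{1..k+1} \<times> UNIV. ?f (l, Inr i))"
    unfolding F2_def by (subst sum.reindex) (auto simp: inj_on_def case_prod_unfold)
  also have "\<dots> = (\<Sum>(l, i)\<in>{1..k+1} \<times> UNIV. x l i * A (k + 1 - l) i j)"
    using k by (intro sum.cong) (auto simp: mg1_vec_def mg1_T_def split: nat.splits)
  also have "\<dots> = (\<Sum>l=1..k+1. \<Sum>i\<in>UNIV. x l i * A (k + 1 - l) i j)"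
    by (rule sum.cartesian_product[symmetric])
  also have "mg1_vec x0 x (k, Inr j) = x k j" using k by (auto simp: mg1_vec_def split: nat.splits)
  finally show ?thesis .
qed

lemma mg1_levels_summable:
  fixes x :: "nat \<Rightarrow> 'b \<Rightarrow> real" and x0 :: "'a \<Rightarrow> real"
  assumes nn: "\<And>s. mg1_vec x0 x s \<ge> 0" and sum: "(mg1_vec x0 x has_sum 1) mg1_states"
  shows "x (Suc k) j \<ge> 0" "summable (\<lambda>k. x (Suc k) j)"
proof -
  have eq: "mg1_vec x0 x (Suc k, Inr j) = x (Suc k) j" for k by (simp add: mg1_vec_def)
  show nnx: "x (Suc k) j \<ge> 0" for k using nn[of "(Suc k, Inr j)"] by (simp add: eq)
  let ?g = "\<lambda>k. (Suc k, Inr j :: 'a + 'b)"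
  have "mg1_vec x0 x summable_on mg1_states" using sum by (rule has_sum_imp_summable)
  then have "mg1_vec x0 x summable_on range ?g"
    by (rule summable_on_subset_banach) (auto simp: mg1_states_def)
  then have "(mg1_vec x0 x \<circ> ?g) summable_on UNIV"
    by (subst (asm) summable_on_reindex) (auto simp: inj_on_def)
  then have "(\<lambda>k. x (Suc k) j) summable_on UNIV" by (simp add: o_def eq)
  then show "summable (\<lambda>k. x (Suc k) j)" 
    using summable_on_UNIV_nonneg_real_iff[of "\<lambda>k. x (Suc k) j"] nnx by simp
qed

section \<open>Generating functions of the levels and of the tails\<close>

text \<open>Starts at level 1: level 0 has its own phase type and is described by \<open>x0\<close>,
  so the value \<open>x 0\<close> has no meaning.\<close>

definition xgf :: "(nat \<Rightarrow> 'b \<Rightarrow> real) \<Rightarrow> complex \<Rightarrow> 'b \<Rightarrow> complex" where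
  "xgf x z j = (\<Sum>k. of_real (x (Suc k) j) * z ^ Suc k)"

lemma summable_norm_mult_power:
  fixes f :: "nat \<Rightarrow> real" and z :: complex
  assumes "summable f" "\<And>k. f k \<ge> 0" "norm z \<le> 1"
  shows "summable (\<lambda>k. norm (of_real (f k) * z ^ e k))"
proof (rule summable_comparison_test'[OF assms(1)])
  fix k
  have "norm z ^ e k \<le> 1" using assms(3) by (simp add: power_le_one)
  then show "norm (norm (of_real (f k) * z ^ e k)) \<le> f k"
    using assms(2)[of k] by (simp add: norm_mult norm_power mult_left_le)
qed

text \<open>The Cauchy product of the two series: its coefficient of index \<open>m + 2\<close> is
  the inflow from levels at least 1 into level \<open>m + 1\<close>. The offset by one, as A(1)
  keeps the level, accounts for the factor z.\<close>

lemma mg1_generating_identity: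
  fixes x :: "nat \<Rightarrow> 'b::finite \<Rightarrow> real" and x0 :: "'a::finite \<Rightarrow> real"
  assumes xnn: "\<And>k j. x (Suc k) j \<ge> 0" and xsum: "\<And>j. summable (\<lambda>k. x (Suc k) j)"
    and Ann: "\<And>k i j. A k i j \<ge> 0" and Asum: "\<And>i j. summable (\<lambda>k. A k i j)"
    and Bnn: "\<And>k i j. B k i j \<ge> 0" and Bsum: "\<And>i j. summable (\<lambda>k. B (Suc k) i j)"
    and bal: "\<And>k j. k \<ge> 1 \<Longrightarrow>
       x k j = (\<Sum>i\<in>UNIV. x0 i * B k i j) + (\<Sum>l=1..k+1. \<Sum>i\<in>UNIV. x l i * A (k + 1 - l) i j)"
    and z: "norm z \<le> 1"
  shows "(\<Sum>i\<in>UNIV. xgf x z i * charmat A z i j)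
     = z * ((\<Sum>i\<in>UNIV. of_real (x0 i) * Bstar B z i j) - (\<Sum>i\<in>UNIV. of_real (x 1 i * A 0 i j)))"
proof -
  \<comment> \<open>The entry at 0 is set to 0 so that the meaningless \<open>x 0\<close> stays out
    of the Cauchy product.\<close>
  define a where "a = (\<lambda>i l. if l = 0 then 0 else of_real (x l i) * z ^ l)"
  define b where "b = (\<lambda>i l. of_real (A l i j) * z ^ l)"
  have aS: "summable (\<lambda>l. norm (a i (Suc l)))" for i
    unfolding a_def using summable_norm_mult_power[OF xsum xnn z, of _ Suc] by simp
  then have a1: "summable (\<lambda>l. norm (a i l))" for i
    using summable_Suc_iff[of "\<lambda>l. norm (a i l)"] by blast
  have b1: "summable (\<lambda>l. norm (b i l))" for i
    unfolding b_def by (rule summable_norm_mult_power[OF Asum Ann z])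
  have sa: "(\<Sum>l. a i l) = xgf x z i" for i
    using suminf_split_head[OF summable_norm_cancel[OF a1]] by (simp add: a_def xgf_def)
  have sb: "(\<Sum>l. b i l) = Astar A z i j" for i
    by (simp add: b_def Astar_def mult.commute)
  define c where "c = (\<lambda>n. \<Sum>i\<in>UNIV. \<Sum>l\<le>n. a i l * b i (n - l))"
  have c1: "c sums (\<Sum>i\<in>UNIV. xgf x z i * Astar A z i j)"
    unfolding c_def by (intro sums_sum) (use Cauchy_product_sums[OF a1 b1] in \<open>simp add: sa sb\<close>)
  have c_Suc_Suc: "c (m + 2) = z * (of_real (x (Suc m) j) * z ^ Suc m
      - (\<Sum>i\<in>UNIV. of_real (x0 i) * (z ^ Suc m * of_real (B (Suc m) i j))))" for m
  proof -
    have "(\<Sum>l\<le>m+2. a i l * b i (m + 2 - l)) = z ^ (m + 2) * of_real (\<Sum>l=1..m+2. x l i * A (m + 2 - l) i j)" for i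
    proof -
      have "(\<Sum>l\<le>m+2. a i l * b i (m + 2 - l)) = (\<Sum>l=1..m+2. a i l * b i (m + 2 - l))"
        by (rule sum.mono_neutral_right) (auto simp: a_def not_le)
      also have "\<dots> = (\<Sum>l=1..m+2. z ^ (m + 2) * of_real (x l i * A (m + 2 - l) i j))"
      proof (rule sum.cong[OF refl])
        fix l assume l: "l \<in> {1..m+2}"
        have "z ^ (m + 2) = z ^ l * z ^ (m + 2 - l)" using l by (simp flip: power_add)
        then show "a i l * b i (m + 2 - l) = z ^ (m + 2) * of_real (x l i * A (m + 2 - l) i j)"
          using l by (simp add: a_def b_def mult_ac)
      qed
      finally show ?thesis by (simp only: of_real_sum sum_distrib_left)
    qed
    then have "c (m + 2) = z ^ (m + 2) * of_real (\<Sum>i\<in>UNIV. \<Sum>l=1..m+2. x l i * A (m + 2 - l) i j)"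
      unfolding c_def by (simp only: of_real_sum sum_distrib_left)
    also have "(\<Sum>i\<in>UNIV. \<Sum>l=1..m+2. x l i * A (m + 2 - l) i j) = x (Suc m) j - (\<Sum>i\<in>UNIV. x0 i * B (Suc m) i j)"
      using bal[of "Suc m" j] by (subst sum.swap) simp
    finally show ?thesis by (simp add: algebra_simps sum_distrib_left)
  qed
  have "summable (\<lambda>m. norm (of_real (x (Suc m) j) * z ^ Suc m))"
    by (rule summable_norm_mult_power[OF xsum xnn z])
  then have "(\<lambda>m. of_real (x (Suc m) j) * z ^ Suc m) sums xgf x z j"
    unfolding xgf_def by (rule summable_sums[OF summable_norm_cancel])
  moreover have "(\<lambda>m. z ^ Suc m * of_real (B (Suc m) i j)) sums Bstar B z i j" for i
  proof -
    have "summable (\<lambda>m. norm (of_real (B (Suc m) i j) * z ^ Suc m))"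
      by (rule summable_norm_mult_power[OF Bsum Bnn z])
    from summable_sums[OF summable_norm_cancel[OF this]] show ?thesis
      unfolding Bstar_def by (simp add: mult.commute)
  qed
  ultimately have "(\<lambda>m. c (m + 2)) sums (z * (xgf x z j - (\<Sum>i\<in>UNIV. of_real (x0 i) * Bstar B z i j)))"
    unfolding c_Suc_Suc by (intro sums_mult sums_diff sums_sum)
  then have "c sums (z * (xgf x z j - (\<Sum>i\<in>UNIV. of_real (x0 i) * Bstar B z i j)) + (\<Sum>i<2. c i))"
    by (rule sums_iff_shift[THEN iffD1])
  \<comment> \<open>The coefficient of index 0 is 0. The one of index 1 pairs level 1 with A(0), a
    product that no balance equation of a level at least 1 contains; it is the origin of the term
    x(1) A(0).\<close>
  moreover have "(\<Sum>i<2. c i) = z * (\<Sum>i\<in>UNIV. of_real (x 1 i * A 0 i j))"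
    by (simp add: numeral_2_eq_2 c_def a_def b_def sum_distrib_left mult_ac)
  ultimately have "(\<Sum>i\<in>UNIV. xgf x z i * Astar A z i j)
     = z * (xgf x z j - (\<Sum>i\<in>UNIV. of_real (x0 i) * Bstar B z i j)) + z * (\<Sum>i\<in>UNIV. of_real (x 1 i * A 0 i j))"
    using c1 sums_unique2 by metis
  then show ?thesis by (simp add: charmat_left_mult algebra_simps)
qed

text \<open>Continuity up to the boundary, with the point 1 included, by the summable majorant x
  itself.\<close>

lemma xgf_continuous:
  fixes x :: "nat \<Rightarrow> 'b \<Rightarrow> real"
  assumes xnn: "\<And>k. x (Suc k) j \<ge> 0" and xsum: "summable (\<lambda>k. x (Suc k) j)"
  shows "continuous_on (cball 0 1) (\<lambda>z. xgf x z j)"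
proof -
  have "uniform_limit (cball 0 1) (\<lambda>n z. \<Sum>k<n. of_real (x (Suc k) j) * z ^ Suc k) (\<lambda>z. xgf x z j) sequentially"
    unfolding xgf_def
  proof (rule Weierstrass_m_test[OF _ xsum])
    fix k and z :: complex assume "z \<in> cball 0 1"
    then have "norm z ^ Suc k \<le> 1" by (intro power_le_one) auto
    then show "norm (of_real (x (Suc k) j) * z ^ Suc k) \<le> x (Suc k) j"
      using xnn[of k] unfolding norm_mult norm_power by (simp add: mult_left_le del: power_Suc)
  qed
  then show ?thesis
    by (rule uniform_limit_theorem[rotated]) (auto intro!: continuous_intros always_eventually)
qed

lemma xgf_1:
  assumes "summable (\<lambda>k. x (Suc k) j)"
  shows "xgf x 1 j = of_real (xbar x 0 j)"
proof -
  have "(\<lambda>k. complex_of_real (x (Suc k) j)) sums of_real (xbar x 0 j)"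
    unfolding xbar_def using sums_of_real[OF summable_sums[OF assms], where ?'a = complex] by simp
  then show ?thesis by (simp add: xgf_def sums_iff)
qed

lemma xbar_Suc:
  assumes "summable (\<lambda>k. x (Suc k) j)"
  shows "xbar x (Suc k) j = xbar x k j - x (Suc k) j" "summable (\<lambda>l. x (l + k + 1) j)"
proof -
  show s: "summable (\<lambda>l. x (l + k + 1) j)"
    using summable_ignore_initial_segment[OF assms, of k] by simp
  from suminf_split_head[OF this] show "xbar x (Suc k) j = xbar x k j - x (Suc k) j"
    by (simp add: xbar_def)
qed

lemma xbar_bounds:
  assumes "summable (\<lambda>k. x (Suc k) j)" "\<And>k. x (Suc k) j \<ge> 0"
  shows "xbar x k j \<ge> 0" "xbar x (Suc k) j \<le> xbar x k j" "xbar x k j \<le> xbar x 0 j"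
proof -
  show "xbar x k j \<ge> 0" unfolding xbar_def
    by (intro suminf_nonneg xbar_Suc(2)[where x = x and j = j] assms(1)) (use assms(2) in simp)
  show 1: "xbar x (Suc k) j \<le> xbar x k j" for k using xbar_Suc(1)[where x = x and j = j, OF assms(1), of k] assms(2)[of k] by simp
  show "xbar x k j \<le> xbar x 0 j" using 1 by (induction k) (auto intro: order_trans)
qed

text \<open>Abel summation: x(k) is the difference of two consecutive tails, so multiplying the
  series of tails by \<open>z - 1\<close> returns \<open>xgf\<close> up to the constant
  term.\<close>

lemma xbar_generating_function:
  fixes x :: "nat \<Rightarrow> 'b \<Rightarrow> real"
  assumes xsum: "summable (\<lambda>k. x (Suc k) j)" and xnn: "\<And>k. x (Suc k) j \<ge> 0" and z: "norm z < 1"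
  shows "(\<lambda>k. of_real (xbar x k j) * z ^ k) sums ((xgf x z j - of_real (xbar x 0 j)) / (z - 1))"
proof -
  have "summable (\<lambda>k. of_real (xbar x k j) * z ^ k)"
  proof (rule summable_comparison_test'[OF summable_mult[OF summable_geometric, of "norm z" "xbar x 0 j"]])
    show "norm (of_real (xbar x k j) * z ^ k) \<le> xbar x 0 j * norm z ^ k" for k
      using xbar_bounds[where x = x and j = j, OF xsum xnn, of k] by (simp add: norm_mult norm_power mult_right_mono)
  qed (use z in simp)
  then have F: "(\<lambda>k. of_real (xbar x k j) * z ^ k) sums (\<Sum>k. of_real (xbar x k j) * z ^ k)" (is "_ sums ?F")
    by (rule summable_sums)
  have "(\<lambda>k. of_real (xbar x (Suc k) j) * z ^ Suc k) sums (?F - of_real (xbar x 0 j))"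
    using F by (subst sums_Suc_iff) simp
  from sums_diff[OF sums_mult[OF F, of z] this]
  have "(\<lambda>k. of_real (x (Suc k) j) * z ^ Suc k) sums (z * ?F - (?F - of_real (xbar x 0 j)))"
    by (simp add: xbar_Suc(1)[where x = x and j = j, OF xsum] algebra_simps)
  then have "xgf x z j = z * ?F - (?F - of_real (xbar x 0 j))"
    by (simp add: xgf_def sums_iff)
  then have "(xgf x z j - of_real (xbar x 0 j)) / (z - 1) = ?F"
    using z by (subst nonzero_divide_eq_eq) (auto simp: algebra_simps)
  then show ?thesis using F by simp
qed

lemma norm_Bstar_le:
  assumes "\<And>k i j. B k i j \<ge> 0" "norm z < r" "mat_conv_radius (\<lambda>k. if k = 0 then (\<lambda>i j. 0) else B k) = ereal r"
  shows "norm (Bstar B z i j) \<le> norm (Bstar B (of_real (norm z)) i j)"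
proof -
  have s: "summable (\<lambda>k. norm (of_real (B (Suc k) i j) * w ^ Suc k))" if "norm w < r" for w :: complex
  proof -
    have "ereal (norm w) < mat_conv_radius (\<lambda>k. if k = 0 then (\<lambda>i j. 0) else B k)"
      unfolding assms(3) using that by simp
    from mat_power_series_summable(1)[OF this, of i j] show ?thesis
      by (subst (asm) summable_Suc_iff[symmetric]) simp
  qed
  have "norm (Bstar B z i j) \<le> (\<Sum>k. norm (of_real (B (Suc k) i j) * z ^ Suc k))"
    using summable_norm[OF s[OF assms(2)]] by (simp add: Bstar_def mult.commute)
  also have "\<dots> = norm (Bstar B (of_real (norm z)) i j)"
  proof -
    have "(\<lambda>k. complex_of_real (norm (of_real (B (Suc k) i j) * z ^ Suc k))) sums
        of_real (\<Sum>k. norm (of_real (B (Suc k) i j) * z ^ Suc k))"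
      by (intro sums_of_real summable_sums s assms(2))
    then have "Bstar B (of_real (norm z)) i j = of_real (\<Sum>k. norm (of_real (B (Suc k) i j) * z ^ Suc k))"
      using assms(1) by (simp add: Bstar_def sums_iff norm_mult norm_power mult.commute)
    moreover have "(\<Sum>k. norm (of_real (B (Suc k) i j) * z ^ Suc k)) \<ge> 0"
      by (intro suminf_nonneg s assms(2)) auto
    ultimately show ?thesis by simp
  qed
  finally show ?thesis .
qed

section \<open>Meromorphic continuation of the stationary distribution\<close>

text \<open>On the radius the continuation agrees with the power series, whose nonnegative
  coefficients provide bounds; this makes such bounds usable for excluding poles.\<close>

lemma frequently_radial:
  fixes z0 :: complex
  assumes "z0 \<noteq> 0" "d > 0" "\<And>t. 1 - d < t \<Longrightarrow> t < 1 \<Longrightarrow> 0 < t \<Longrightarrow> P (of_real t * z0)"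
  shows "\<exists>\<^sub>F z in at z0. P z"
  unfolding frequently_at
proof (intro allI impI)
  fix e :: real assume e: "e > 0"
  \<comment> \<open>The relative distance \<open>1 - t\<close>: below d for the hypothesis, below 1
    to keep t positive, and small enough to stay within e of z0.\<close>
  define s where "s = min (min (d / 2) (1 / 2)) (e / (2 * norm z0))"
  have n: "norm z0 > 0" using assms(1) by simp
  have s: "s > 0" "s < d" "s < 1" "s * norm z0 < e"
  proof -
    show "s > 0" "s < d" "s < 1" using assms(2) e n by (auto simp: s_def)
    have "s * norm z0 \<le> e / (2 * norm z0) * norm z0" using n by (intro mult_right_mono) (auto simp: s_def)
    also have "\<dots> < e" using n e by simp
    finally show "s * norm z0 < e" .
  qed
  have "of_real (1 - s) * z0 - z0 = of_real (- s) * z0" by (simp add: algebra_simps)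
  then have "dist (of_real (1 - s) * z0) z0 = s * norm z0"
    using s(1) by (simp only: dist_norm norm_mult norm_of_real)
  then show "\<exists>x\<in>UNIV. x \<noteq> z0 \<and> dist x z0 < e \<and> P x"
    using s n assms(3)[of "1 - s"] by (intro bexI[of _ "of_real (1 - s) * z0"]) auto
qed

locale mg1_stationary = mg1_kernel A \<pi> \<mu> v \<theta> \<tau> p
  for A :: "nat \<Rightarrow> 'b::finite \<Rightarrow> 'b \<Rightarrow> real" and \<pi> \<mu> v \<theta> \<tau> p +
  fixes B :: "nat \<Rightarrow> 'a::finite \<Rightarrow> 'b \<Rightarrow> real" and x0 :: "'a \<Rightarrow> real" and x :: "nat \<Rightarrow> 'b \<Rightarrow> real"
    and Bext :: "complex \<Rightarrow> 'a \<Rightarrow> 'b \<Rightarrow> complex" and U :: "complex set" and m :: nat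
  assumes Bnn: "B k a j \<ge> 0" and Bsum: "summable (\<lambda>k. B (Suc k) a j)"
    and x0_pos: "x0 a > 0" and xnn: "x (Suc k) j \<ge> 0" and xsum: "summable (\<lambda>k. x (Suc k) j)"
    and bal: "k \<ge> 1 \<Longrightarrow>
       x k j = (\<Sum>a\<in>UNIV. x0 a * B k a j) + (\<Sum>l=1..k+1. \<Sum>i\<in>UNIV. x l i * A (k + 1 - l) i j)"
    and B_radius: "mat_conv_radius (\<lambda>k. if k = 0 then (\<lambda>i j. 0) else B k) = ereal \<theta>"
    and U: "open U" "cball 0 \<theta> \<subseteq> U"
    and Bext_mero: "(\<lambda>z. Bext z a j) meromorphic_on U"
    and Bext_eq: "z \<in> ball 0 \<theta> \<Longrightarrow> Bext z a j = Bstar B z a j"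
    and m_pos: "m \<ge> 1"
    and Blim: "\<exists>Bt. Bt \<noteq> (\<lambda>i j. 0) \<and> (\<forall>i j. Im (Bt i j) = 0 \<and> Re (Bt i j) \<ge> 0) \<and>
                  (\<forall>i j. ((\<lambda>z. (1 - z / of_real \<theta>) ^ m * Bext z i j) \<longlongrightarrow> Bt i j)
                          (at (of_real \<theta>)))"
begin

lemma \<theta>_pos: "\<theta> > 0" using \<theta>_gt_1 by simp

lemma Bext_mero_at: "norm z \<le> \<theta> \<Longrightarrow> (\<lambda>z. Bext z a j) meromorphic_on {z}"
  using meromorphic_on_subset[OF Bext_mero, of "{z}"] U(2) by auto

text \<open>Nonnegativity of the coefficients makes the pole at \<open>\<theta>\<close> dominate all others on the circle.\<close>

lemma Bext_limit_exists:
  assumes z0: "norm z0 = \<theta>"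
  shows "\<exists>L. ((\<lambda>z. (1 - z / z0) ^ m * Bext z a j) \<longlongrightarrow> L) (at z0)"
proof -
  have z00: "z0 \<noteq> 0" using z0 \<theta>_pos by auto
  obtain L where L: "((\<lambda>z. (1 - z / of_real \<theta>) ^ m * Bext z a j) \<longlongrightarrow> L) (at (of_real \<theta>))"
    using Blim by blast
  have "\<forall>\<^sub>F z in at (of_real \<theta>). norm ((1 - z / of_real \<theta>) ^ m * Bext z a j) < norm L + 1"
    using tendsto_norm[OF L] by (rule order_tendstoD) simp
  then obtain d where d: "d > 0" "\<And>z. z \<noteq> of_real \<theta> \<Longrightarrow> dist z (of_real \<theta>) < d \<Longrightarrow>
      norm ((1 - z / of_real \<theta>) ^ m * Bext z a j) < norm L + 1"
    unfolding eventually_at by auto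
  show ?thesis
  proof (rule meromorphic_frequently_bounded_tendsto)
    show "(\<lambda>z. (1 - z / z0) ^ m * Bext z a j) meromorphic_on {z0}"
      by (intro meromorphic_intros Bext_mero_at) (use z0 in auto)
    show "\<exists>\<^sub>F z in at z0. norm ((1 - z / z0) ^ m * Bext z a j) \<le> norm L + 1"
    proof (rule frequently_radial[OF z00, of "d / \<theta>"])
      fix t :: real assume t: "1 - d / \<theta> < t" "t < 1" "0 < t"
      have nt: "norm (of_real t * z0) = t * \<theta>" using t z0 by (simp add: norm_mult)
      have lt: "t * \<theta> < \<theta>" using t \<theta>_pos by simp
      have "norm (Bext (of_real t * z0) a j) = norm (Bstar B (of_real t * z0) a j)"
        using nt lt by (subst Bext_eq) auto
      also have "\<dots> \<le> norm (Bstar B (of_real (t * \<theta>)) a j)"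
        using norm_Bstar_le[OF Bnn _ B_radius, of "of_real t * z0" a j] nt lt by simp
      also have "\<dots> = norm (Bext (of_real (t * \<theta>)) a j)"
        using lt t \<theta>_pos by (subst Bext_eq) (auto simp: norm_mult)
      finally have le: "norm (Bext (of_real t * z0) a j) \<le> norm (Bext (of_real (t * \<theta>)) a j)" .
      have "norm ((1 - of_real t * z0 / z0) ^ m * Bext (of_real t * z0) a j)
          = norm ((1 - of_real t :: complex) ^ m) * norm (Bext (of_real t * z0) a j)"
        using z00 by (simp add: norm_mult)
      also have "\<dots> \<le> norm ((1 - of_real t :: complex) ^ m) * norm (Bext (of_real (t * \<theta>)) a j)"
        by (intro mult_left_mono le) auto
      also have "\<dots> = norm ((1 - of_real (t * \<theta>) / of_real \<theta>) ^ m * Bext (of_real (t * \<theta>)) a j)"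
        using \<theta>_pos by (simp add: norm_mult)
      also have "\<dots> \<le> norm L + 1"
      proof (rule less_imp_le, rule d(2))
        show "complex_of_real (t * \<theta>) \<noteq> of_real \<theta>" using lt by (metis less_irrefl of_real_eq_iff)
        have "dist (complex_of_real (t * \<theta>)) (of_real \<theta>) = \<theta> - t * \<theta>"
          using lt by (simp only: dist_of_real dist_real_def)
        also have "\<dots> < d" using t(1) \<theta>_pos by (simp add: field_simps)
        finally show "dist (complex_of_real (t * \<theta>)) (of_real \<theta>) < d" .
      qed
      finally show "norm ((1 - of_real t * z0 / z0) ^ m * Bext (of_real t * z0) a j) \<le> norm L + 1" .
    qed (use d \<theta>_pos in auto)
  qed
qed

text \<open>\<open>Btilde\<close> is defined through \<open>Lim\<close>, which is informative only
  where a limit exists; by the radial bound that holds at every point of the circle.\<close>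

lemma Btilde_tendsto:
  assumes "norm z0 = \<theta>"
  shows "((\<lambda>z. (1 - z / z0) ^ m * Bext z a j) \<longlongrightarrow> Btilde Bext m z0 a j) (at z0)"
proof -
  obtain L where L: "((\<lambda>z. (1 - z / z0) ^ m * Bext z a j) \<longlongrightarrow> L) (at z0)"
    using Bext_limit_exists[OF assms] by blast
  then have "Btilde Bext m z0 a j = L" unfolding Btilde_def by (intro tendsto_Lim) auto
  then show ?thesis using L by simp
qed

lemma Bext_continuous_inside:
  assumes "norm z0 < \<theta>"
  shows "(\<lambda>z. Bext z a j) \<midarrow>z0\<rightarrow> Bstar B z0 a j"
proof -
  let ?c = "\<lambda>k. complex_of_real ((if k = 0 then (\<lambda>i j. 0) else B k) a j)"
  have s: "summable (\<lambda>k. ?c k * z ^ k)" if "norm z < \<theta>" for z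
    using mat_power_series_summable(2)[of z "\<lambda>k. if k = 0 then (\<lambda>i j. 0) else B k" a j] that B_radius by simp
  have eq: "(\<Sum>k. ?c k * z ^ k) = Bstar B z a j" if "norm z < \<theta>" for z
    using suminf_split_head[OF s[OF that]] by (simp add: Bstar_def mult.commute)
  obtain K where K: "norm z0 < K" "K < \<theta>" using dense[OF assms] by blast
  have Kp: "K > 0" using K(1) norm_ge_zero[of z0] by linarith
  have "isCont (\<lambda>z. \<Sum>k. ?c k * z ^ k) z0"
    by (rule isCont_powser[of _ "of_real K"]) (use K Kp s in auto)
  then have "(\<lambda>z. \<Sum>k. ?c k * z ^ k) \<midarrow>z0\<rightarrow> Bstar B z0 a j"
    using eq[OF assms] by (simp add: isCont_def)
  moreover have "\<forall>\<^sub>F z in at z0. (\<Sum>k. ?c k * z ^ k) = Bext z a j"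
  proof -
    have "\<forall>\<^sub>F z in at z0. z \<in> ball 0 \<theta>"
      using assms by (intro eventually_at_in_open') auto
    then show ?thesis by eventually_elim (use eq Bext_eq in auto)
  qed
  ultimately show ?thesis by (rule Lim_transform_eventually)
qed

section \<open>The continued solution and its leading coefficients on the circle\<close>

definition rhs :: "complex \<Rightarrow> 'b \<Rightarrow> complex" where
  "rhs z j = z * ((\<Sum>a\<in>UNIV. of_real (x0 a) * Bext z a j) - (\<Sum>i\<in>UNIV. of_real (x 1 i * A 0 i j)))"

lemma meromorphic_extension_exists:
  obtains w where "\<And>z0 i. norm z0 \<le> \<theta> \<Longrightarrow> (\<lambda>z. w z i) meromorphic_on {z0}"
    "\<And>z0. norm z0 \<le> \<theta> \<Longrightarrow> \<forall>\<^sub>F z in at z0. left_nondegenerate (charmat A z) \<and>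
        (\<forall>j. (\<Sum>i\<in>UNIV. w z i * charmat A z i j) = rhs z j)"
proof -
  obtain e where e: "e > 0" "ball 0 (\<theta> + e) \<subseteq> U" by (rule open_enlarge_cball[OF \<theta>_pos U])
  obtain K where K: "\<theta> < K" "ereal K < mat_conv_radius A" using ereal_dense2[OF \<theta>_less] by auto
  \<comment> \<open>A radius beyond \<theta> within which A* converges and B* is still
    meromorphic.\<close>
  define R where "R = min K (\<theta> + e)"
  have R: "R > \<theta>" "ball 0 R \<subseteq> U" using K(1) e by (auto simp: R_def)
  have "ereal R \<le> ereal K" by (simp add: R_def)
  then have R3: "ereal R \<le> mat_conv_radius A" using K(2) by (meson less_imp_le order_trans)
  \<comment> \<open>Any point of the annulus serves as the regular point from which the determinant
    is seen not to vanish identically.\<close>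
  obtain \<xi> where \<xi>: "1 < \<xi>" "\<xi> < \<theta>" using dense[OF \<theta>_gt_1] by blast
  have hol: "(\<lambda>z. charmat A z i j) holomorphic_on ball 0 R" for i j
  proof -
    have "(\<lambda>z. charmat A z i j) field_differentiable (at z)" if "z \<in> ball 0 R" for z
    proof -
      have "ereal (norm z) < ereal R" using that by simp
      then have "ereal (norm z) < mat_conv_radius A" using R3 by (rule less_le_trans)
      from charmat_has_field_derivative[OF this] show ?thesis by (auto simp: field_differentiable_def)
    qed
    then show ?thesis by (simp add: holomorphic_on_def field_differentiable_at_within)
  qed
  have mero: "(\<lambda>z. rhs z j) meromorphic_on ball 0 R" for j
    unfolding rhs_def by (intro meromorphic_intros meromorphic_on_subset[OF Bext_mero] R)
  have nd: "left_nondegenerate (charmat A (of_real \<xi>))"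
    by (rule charmat_nondegenerate_between) (use \<xi> in auto)
  have \<xi>R: "complex_of_real \<xi> \<in> ball 0 R" using \<xi> R(1) by simp
  obtain w where w: "\<And>i. (\<lambda>z. w z i) meromorphic_on ball 0 R"
    "\<And>z0. z0 \<in> ball 0 R \<Longrightarrow> \<forall>\<^sub>F z in at z0. left_nondegenerate (charmat A z) \<and>
        (\<forall>j. (\<Sum>i\<in>UNIV. w z i * charmat A z i j) = rhs z j)"
    by (rule meromorphic_left_solution[where M = "charmat A" and b = rhs, OF open_ball connected_ball hol mero \<xi>R nd]) blast
  show ?thesis
  proof (rule that)
    show "(\<lambda>z. w z i) meromorphic_on {z0}" if "norm z0 \<le> \<theta>" for z0 i
      using that R(1) by (intro meromorphic_on_subset[OF w(1)]) auto
    show "\<forall>\<^sub>F z in at z0. left_nondegenerate (charmat A z) \<and>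
        (\<forall>j. (\<Sum>i\<in>UNIV. w z i * charmat A z i j) = rhs z j)" if "norm z0 \<le> \<theta>" for z0
      using that R(1) by (intro w(2)) auto
  qed
qed

text \<open>The summand of \<open>c_hat\<close> at u without the phase \<open>u ^ l\<close> and
  without \<open>\<theta> * u - 1\<close>; the latter enters when w is divided by
  \<open>z - 1\<close> to pass to the tails.\<close>

definition pole_coeff :: "complex \<Rightarrow> 'b \<Rightarrow> complex" where
  "pole_coeff u j = (\<Sum>a\<in>UNIV. \<Sum>k\<in>UNIV. of_real (x0 a) * Btilde Bext m (of_real \<theta> * u) a k
       * DeltaM p u k * of_real (v k)) / of_real (dDelta A \<theta> - 1) * of_real (\<mu> j) * inverse (DeltaM p u j)"

definition circle_coeff :: "complex \<Rightarrow> 'b \<Rightarrow> complex" where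
  "circle_coeff z0 j = (let u = z0 / of_real \<theta> in if u ^ \<tau> = 1 then pole_coeff u j else 0)"

text \<open>Where the matrix is nonsingular, w inherits a pole of order at most m from the right
  side, so the limit with exponent \<open>Suc m\<close> is 0. At a rotated \<theta> the
  one-dimensional null space can raise the order by one and supplies the coefficient.\<close>

lemma solution_circle_limit:
  assumes z0: "norm z0 = \<theta>"
    and mero: "\<And>i. (\<lambda>z. w z i) meromorphic_on {z0}"
    and ev: "\<forall>\<^sub>F z in at z0. \<forall>j. (\<Sum>i\<in>UNIV. w z i * charmat A z i j) = rhs z j"
  shows "((\<lambda>z. (1 - z / z0) ^ Suc m * w z j) \<longlongrightarrow> circle_coeff z0 j) (at z0)"
proof -
  have z00: "z0 \<noteq> 0" using z0 \<theta>_pos by auto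
  have rad: "ereal (norm z0) < mat_conv_radius A" using z0 \<theta>_less by simp
  define bt where "bt = (\<lambda>k. \<Sum>a\<in>UNIV. of_real (x0 a) * Btilde Bext m z0 a k)"
  define \<beta> where "\<beta> = (\<lambda>k. (- z0) ^ m * (z0 * bt k))"
  have \<beta>: "((\<lambda>z. (z - z0) ^ m * rhs z k) \<longlongrightarrow> \<beta> k) (at z0)" for k
  proof -
    have lim: "((\<lambda>z. (- z0) ^ m * (z * ((\<Sum>a\<in>UNIV. of_real (x0 a) * ((1 - z / z0) ^ m * Bext z a k))
         - (1 - z / z0) ^ m * (\<Sum>i\<in>UNIV. of_real (x 1 i * A 0 i k))))) \<longlongrightarrow>
       (- z0) ^ m * (z0 * ((\<Sum>a\<in>UNIV. of_real (x0 a) * Btilde Bext m z0 a k)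
         - (1 - z0 / z0) ^ m * (\<Sum>i\<in>UNIV. of_real (x 1 i * A 0 i k))))) (at z0)"
      by (intro tendsto_intros Btilde_tendsto z0 z00)
    have eq: "(- z0) ^ m * (z * ((\<Sum>a\<in>UNIV. of_real (x0 a) * ((1 - z / z0) ^ m * Bext z a k))
         - (1 - z / z0) ^ m * (\<Sum>i\<in>UNIV. of_real (x 1 i * A 0 i k)))) = (z - z0) ^ m * rhs z k" for z
      unfolding rhs_def power_minus_root_eq[OF z00, of z m]
      by (simp add: sum_distrib_left right_diff_distrib mult_ac)
    \<comment> \<open>Because \<open>m \<ge> 1\<close>, the regular term x(1) A(0) disappears from
      the leading coefficient.\<close>
    have "(- z0) ^ m * (z0 * ((\<Sum>a\<in>UNIV. of_real (x0 a) * Btilde Bext m z0 a k)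
         - (1 - z0 / z0) ^ m * (\<Sum>i\<in>UNIV. of_real (x 1 i * A 0 i k)))) = \<beta> k"
      using z00 m_pos by (simp add: \<beta>_def bt_def power_0_left)
    then show ?thesis using lim unfolding eq by simp
  qed
  have conv: "(1 - z / z0) ^ Suc m = (- 1 / z0) ^ Suc m * (z - z0) ^ Suc m" for z
    by (rule one_minus_div_power_eq[OF z00])
  show ?thesis
  proof (cases "(z0 / of_real \<theta>) ^ \<tau> = 1")
    case True
    define u where "u = z0 / of_real \<theta>"
    have u: "u ^ \<tau> = 1" and zu: "z0 = of_real \<theta> * u" using True \<theta>_pos by (auto simp: u_def)
    let ?\<beta>v = "\<Sum>k\<in>UNIV. \<beta> k * (DeltaM p u k * of_real (v k))"
      and ?btv = "\<Sum>k\<in>UNIV. bt k * (DeltaM p u k * of_real (v k))"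
      and ?\<mu> = "of_real (\<mu> j) * inverse (DeltaM p u j)"
    have "((\<lambda>z. (z - z0) ^ Suc m * w z j) \<longlongrightarrow> ?\<beta>v / of_real (1 - dDelta A \<theta>) * ?\<mu>) (at z0)"
    proof (rule simple_null_pole_limit[OF mero charmat_has_field_derivative[OF rad] ev \<beta>])
      show "\<exists>\<alpha>. \<forall>i. c i = \<alpha> * (of_real (\<mu> i) * inverse (DeltaM p u i))"
        if "\<And>j. (\<Sum>i\<in>UNIV. c i * charmat A z0 i j) = 0" for c
        using that unfolding zu by (rule rotated_left_null[OF u])
      show "(\<Sum>j\<in>UNIV. charmat A z0 i j * (DeltaM p u j * of_real (v j))) = 0" for i
        unfolding zu by (rule rotated_right_null[OF u])
      show "complex_of_real (1 - dDelta A \<theta>) = (\<Sum>i\<in>UNIV. \<Sum>j\<in>UNIV. of_real (\<mu> i) * inverse (DeltaM p u i)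
          * ((if i = j then 1 else 0) - dAstar A z0 i j) * (DeltaM p u j * of_real (v j)))"
        unfolding zu by (rule rotated_derivative_pairing[OF u, symmetric])
      show "complex_of_real (1 - dDelta A \<theta>) \<noteq> 0" 
        using dDelta_gt_1 by (simp del: of_real_diff)
    qed
    from tendsto_mult_left[OF this, of "(- 1 / z0) ^ Suc m"]
    have "((\<lambda>z. (1 - z / z0) ^ Suc m * w z j) \<longlongrightarrow> (- 1 / z0) ^ Suc m * (?\<beta>v / of_real (1 - dDelta A \<theta>) * ?\<mu>)) (at z0)"
      unfolding conv by (simp only: mult.assoc)
    moreover have "(- 1 / z0) ^ Suc m * (?\<beta>v / of_real (1 - dDelta A \<theta>) * ?\<mu>) = circle_coeff z0 j"
    proof -
      \<comment> \<open>Passing between powers of \<open>z - z0\<close> and of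
        \<open>1 - z / z0\<close> leaves the factor -1, which turns
        \<open>1 - dDelta A \<theta>\<close> into \<open>dDelta A \<theta> - 1\<close>.\<close>
      have p1: "(- 1 / z0) ^ Suc m * ((- z0) ^ m * z0) = - 1"
      proof -
        have "(- 1 / z0) ^ Suc m * ((- z0) ^ m * z0) = ((- 1 / z0) * (- z0)) ^ m * ((- 1 / z0) * z0)"
          unfolding power_mult_distrib by simp
        then show ?thesis using z00 by simp
      qed
      have "?\<beta>v = (- z0) ^ m * z0 * ?btv"
        by (simp add: \<beta>_def sum_distrib_left mult.assoc)
      then have "(- 1 / z0) ^ Suc m * (?\<beta>v / of_real (1 - dDelta A \<theta>) * ?\<mu>)
        = ((- 1 / z0) ^ Suc m * ((- z0) ^ m * z0)) * (?btv / of_real (1 - dDelta A \<theta>) * ?\<mu>)"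
        by (simp only: times_divide_eq_right times_divide_eq_left mult.assoc)
      also have "\<dots> = ?btv / of_real (dDelta A \<theta> - 1) * ?\<mu>"
      proof -
        have "complex_of_real (1 - dDelta A \<theta>) = - of_real (dDelta A \<theta> - 1)" by simp
        then show ?thesis unfolding p1 by (simp only: divide_minus_right minus_mult_left minus_minus mult_1 minus_mult_minus) simp
      qed
      also have "?btv = (\<Sum>a\<in>UNIV. \<Sum>k\<in>UNIV. of_real (x0 a) * Btilde Bext m (of_real \<theta> * u) a k
       * DeltaM p u k * of_real (v k))"
        unfolding bt_def sum_distrib_right zu[symmetric] by (subst sum.swap) (simp only: mult.assoc)
      finally show ?thesis using True by (simp add: circle_coeff_def pole_coeff_def u_def Let_def mult.assoc)
    qed
    ultimately show ?thesis by simp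
  next
    case False
    have nd: "left_nondegenerate (charmat A z0)"
      unfolding left_nondegenerate_def using circle_left_null_root_of_unity[OF z0] False by blast
    have cont: "((\<lambda>z. charmat A z i j) \<longlongrightarrow> charmat A z0 i j) (at z0)" for i j
      using DERIV_isCont[OF charmat_has_field_derivative[OF rad]] by (simp add: isCont_def)
    obtain c where c: "\<And>i. ((\<lambda>z. (z - z0) ^ m * w z i) \<longlongrightarrow> c i) (at z0)"
      using nondegenerate_pole_order[where M = "charmat A", OF mero cont ev \<beta> nd] by blast
    have "((\<lambda>z. (z - z0) ^ Suc m * w z j) \<longlongrightarrow> 0) (at z0)"
      by (rule mult_power_tendsto_0[OF c]) simp
    from tendsto_mult_left[OF this, of "(- 1 / z0) ^ Suc m"] show ?thesis
      unfolding conv using False by (simp add: circle_coeff_def Let_def mult.assoc)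
  qed
qed
end

section \<open>From the continued solution to the tails\<close>

context mg1_stationary
begin

lemma solution_eq_xgf:
  assumes nd: "left_nondegenerate (charmat A z)" and w: "\<And>j. (\<Sum>i\<in>UNIV. w i * charmat A z i j) = rhs z j"
    and z: "norm z < 1"
  shows "w = xgf x z"
proof (rule left_nondegenerate_unique[OF nd])
  fix j
  have "z \<in> ball 0 \<theta>" using z \<theta>_gt_1 by simp
  then have "rhs z j = z * ((\<Sum>a\<in>UNIV. of_real (x0 a) * Bstar B z a j) - (\<Sum>i\<in>UNIV. of_real (x 1 i * A 0 i j)))"
    by (simp add: rhs_def Bext_eq)
  also have "\<dots> = (\<Sum>i\<in>UNIV. xgf x z i * charmat A z i j)"
    by (rule mg1_generating_identity[symmetric, OF xnn xsum nonneg summable_A Bnn Bsum bal]) (use z in simp_all)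
  finally show "(\<Sum>i\<in>UNIV. w i * charmat A z i j) = (\<Sum>i\<in>UNIV. xgf x z i * charmat A z i j)"
    using w by simp
qed

lemma islimpt_unit_ball:
  fixes z0 :: complex
  assumes "norm z0 \<le> 1"
  shows "z0 islimpt ball 0 1"
  using islimpt_ball[of z0 0 1] assms by simp

text \<open>The matrix may be singular at z0, and z0 may lie on the unit circle. Approached from the
  open disc, w agrees with the continuous function \<open>xgf\<close>, so it is bounded along that
  approach and has no pole; its limit can be read off along the same approach.\<close>

lemma solution_regular_in_unit_disc:
  assumes z0: "norm z0 \<le> 1" and mero: "(\<lambda>z. w z j) meromorphic_on {z0}"
    and ev: "\<forall>\<^sub>F z in at z0. norm z < 1 \<longrightarrow> w z j = xgf x z j"
  shows "((\<lambda>z. w z j) \<longlongrightarrow> xgf x z0 j) (at z0)"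
proof -
  have cont: "continuous_on (cball 0 1) (\<lambda>z. xgf x z j)" by (rule xgf_continuous[OF xnn xsum])
  have "((\<lambda>z. xgf x z j) \<longlongrightarrow> xgf x z0 j) (at z0 within cball 0 1)"
    using cont z0 by (simp add: continuous_on)
  then have lim: "((\<lambda>z. xgf x z j) \<longlongrightarrow> xgf x z0 j) (at z0 within ball 0 1)"
    by (rule tendsto_within_subset) auto
  have nb: "at z0 within ball 0 1 \<noteq> bot"
    using islimpt_unit_ball[OF z0] by (simp add: trivial_limit_within)
  have evw: "\<forall>\<^sub>F z in at z0 within ball 0 1. xgf x z j = w z j"
    using ev unfolding eventually_at_filter by (auto elim!: eventually_mono)
  then have limw: "((\<lambda>z. w z j) \<longlongrightarrow> xgf x z0 j) (at z0 within ball 0 1)"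
    by (rule Lim_transform_eventually[OF lim])
  have "\<exists>\<^sub>F z in at z0. norm (w z j) \<le> norm (xgf x z0 j) + 1"
  proof -
    have "\<forall>\<^sub>F z in at z0 within ball 0 1. norm (w z j) < norm (xgf x z0 j) + 1"
      using tendsto_norm[OF limw] by (rule order_tendstoD) simp
    then have "\<exists>\<^sub>F z in at z0 within ball 0 1. norm (w z j) < norm (xgf x z0 j) + 1"
      using nb by (rule eventually_frequently[rotated])
    then have "\<exists>\<^sub>F z in at z0. norm (w z j) < norm (xgf x z0 j) + 1"
      by (auto simp: frequently_at)
    then show ?thesis by (rule frequently_elim1) simp
  qed
  then obtain L where L: "((\<lambda>z. w z j) \<longlongrightarrow> L) (at z0)"
    using meromorphic_frequently_bounded_tendsto[OF mero] by blast
  then have "((\<lambda>z. w z j) \<longlongrightarrow> L) (at z0 within ball 0 1)" by (rule tendsto_within_subset) simp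
  then have "L = xgf x z0 j" using limw nb tendsto_unique by blast
  then show ?thesis using L by simp
qed

lemma roots_of_unity_finite: "finite {u::complex. u ^ \<tau> = 1}"
  using \<tau>_pos by (intro finite_roots_unity) auto

text \<open>The generating function of the tails is w minus a constant, divided by
  \<open>z - 1\<close>. Since \<theta> exceeds 1, the division only rescales the leading
  coefficients on the circle.\<close>

lemma xbar_asymptotics:
  "(\<lambda>k. of_real (xbar x k j) - of_real (real k ^ m / fact m) *
      (\<Sum>u\<in>{u. u ^ \<tau> = 1}. pole_coeff u j / (of_real \<theta> * u - 1) / (of_real \<theta> * u) ^ k))
     \<in> O(\<lambda>k. complex_of_real (real k ^ (m - 1) / \<theta> ^ k))"
proof -
  obtain w where wm: "\<And>z0 i. norm z0 \<le> \<theta> \<Longrightarrow> (\<lambda>z. w z i) meromorphic_on {z0}"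
    and we: "\<And>z0. norm z0 \<le> \<theta> \<Longrightarrow> \<forall>\<^sub>F z in at z0. left_nondegenerate (charmat A z) \<and>
        (\<forall>j. (\<Sum>i\<in>UNIV. w z i * charmat A z i j) = rhs z j)"
    by (rule meromorphic_extension_exists) blast
  have we1: "\<forall>\<^sub>F z in at z0. norm z < 1 \<longrightarrow> w z j = xgf x z j" if "norm z0 \<le> \<theta>" for z0
    using we[OF that] by eventually_elim (metis solution_eq_xgf)
  have we2: "\<forall>\<^sub>F z in at z0. \<forall>j. (\<Sum>i\<in>UNIV. w z i * charmat A z i j) = rhs z j" if "norm z0 \<le> \<theta>" for z0
    using we[OF that] by eventually_elim blast
  define s where "s = complex_of_real (xbar x 0 j)"
  define F where "F = (\<lambda>z. (w z j - s) / (z - 1))"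
  have in1: "((\<lambda>z. w z j) \<longlongrightarrow> xgf x z0 j) (at z0)" if "norm z0 \<le> 1" for z0
    by (rule solution_regular_in_unit_disc[where w = w and j = j, OF that wm we1]) (use that \<theta>_gt_1 in auto)
  \<comment> \<open>Two regimes: boundedness of the probability generating function up to radius 1,
    nonsingularity of the matrix beyond it.\<close>
  have wreg: "\<exists>L. ((\<lambda>z. w z j) \<longlongrightarrow> L) (at z0)" if z0: "norm z0 < \<theta>" for z0
  proof (cases "norm z0 \<le> 1")
    case True then show ?thesis using in1 by blast
  next
    case False
    have rad: "ereal (norm z0) < mat_conv_radius A" using z0 less_radius[of "norm z0"] by simp
    have nd: "left_nondegenerate (charmat A z0)"
      using charmat_nondegenerate_between False z0 by simp
    have cont: "((\<lambda>z. charmat A z i j) \<longlongrightarrow> charmat A z0 i j) (at z0)" for i j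
      using DERIV_isCont[OF charmat_has_field_derivative[OF rad]] by (simp add: isCont_def)
    have rl: "((\<lambda>z. (z - z0) ^ 0 * rhs z k) \<longlongrightarrow>
       z0 * ((\<Sum>a\<in>UNIV. of_real (x0 a) * Bstar B z0 a k) - (\<Sum>i\<in>UNIV. of_real (x 1 i * A 0 i k)))) (at z0)" for k
      unfolding rhs_def power_0 mult_1 by (intro tendsto_intros Bext_continuous_inside z0)
    have "norm z0 \<le> \<theta>" using z0 by simp
    from nondegenerate_pole_order[where M = "charmat A" and w = w and b = rhs, OF wm[OF this] cont we2[OF this] rl nd]
    obtain c where "\<And>i. ((\<lambda>z. (z - z0) ^ 0 * w z i) \<longlongrightarrow> c i) (at z0)" by blast
    then have "((\<lambda>z. w z j) \<longlongrightarrow> c j) (at z0)" by simp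
    then show ?thesis by blast
  qed
  have Fmero1: "F meromorphic_on {z0}" if "norm z0 \<le> \<theta>" for z0
    unfolding F_def by (intro meromorphic_intros wm that)
  have Fmero: "F meromorphic_on cball 0 \<theta>"
    by (subst meromorphic_on_meromorphic_at) (use Fmero1 in auto)
  have Freg: "\<exists>L. (F \<longlongrightarrow> L) (at z0)" if z0: "norm z0 < \<theta>" for z0
  proof (cases "z0 = 1")
    case True
    show ?thesis
    proof (rule meromorphic_removable_if_mult_tendsto_0)
      show "F meromorphic_on {z0}" using Fmero1 z0 by simp
      \<comment> \<open>At 1 the numerator tends to 0, because s is the total mass of the levels
        from 1 on; the division by \<open>z - 1\<close> therefore creates no pole.\<close>
      have "((\<lambda>z. w z j - s) \<longlongrightarrow> xgf x z0 j - s) (at z0)"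
        by (intro tendsto_intros in1) (use True in simp)
      moreover have "xgf x z0 j - s = 0" using True xgf_1[where x = x and j = j, OF xsum] by (simp add: s_def)
      moreover have "\<forall>\<^sub>F z in at z0. w z j - s = (z - z0) * F z"
        by (rule eventually_mono[OF eventually_neq_at_within[of z0 z0 UNIV]]) (use True in \<open>simp add: F_def\<close>)
      ultimately show "((\<lambda>z. (z - z0) * F z) \<longlongrightarrow> 0) (at z0)"
        using Lim_transform_eventually by fastforce
    qed
  next
    case False
    obtain L where L: "((\<lambda>z. w z j) \<longlongrightarrow> L) (at z0)" using wreg[OF z0] by blast
    have "(F \<longlongrightarrow> (L - s) / (z0 - 1)) (at z0)"
      unfolding F_def by (intro tendsto_intros L) (use False in simp)
    then show ?thesis by blast
  qed
  have "\<forall>\<^sub>F z::complex in at 0. norm z < 1"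
    by (auto simp: eventually_at dist_norm intro: exI[of _ 1])
  moreover have "\<forall>\<^sub>F z in at 0. norm z < 1 \<longrightarrow> w z j = xgf x z j" using we1[of 0] \<theta>_pos by simp
  ultimately have Fser: "\<forall>\<^sub>F z in at 0. (\<lambda>k. of_real (xbar x k j) * z ^ k) sums F z"
  proof eventually_elim
    case (elim z)
    then show ?case using xbar_generating_function[where x = x and j = j and z = z, OF xsum xnn] by (simp add: F_def s_def)
  qed
  define C where "C = (\<lambda>z0. circle_coeff z0 j / (z0 - 1))"
  have Flim: "((\<lambda>z. (1 - z / z0) ^ Suc m * F z) \<longlongrightarrow> C z0) (at z0)" if z0: "norm z0 = \<theta>" for z0
  proof -
    have z1: "z0 \<noteq> 1" "z0 \<noteq> 0" using z0 \<theta>_gt_1 by auto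
    have "((\<lambda>z. (1 - z / z0) ^ Suc m * w z j) \<longlongrightarrow> circle_coeff z0 j) (at z0)"
      by (rule solution_circle_limit[OF z0 wm we2]) (use z0 in auto)
    moreover have "((\<lambda>z. (1 - z / z0) ^ Suc m) \<longlongrightarrow> (1 - z0 / z0) ^ Suc m) (at z0)"
      using z1 by (intro tendsto_intros)
    ultimately have "((\<lambda>z. ((1 - z / z0) ^ Suc m * w z j - (1 - z / z0) ^ Suc m * s) / (z - 1)) \<longlongrightarrow>
        (circle_coeff z0 j - (1 - z0 / z0) ^ Suc m * s) / (z0 - 1)) (at z0)"
      using z1 by (intro tendsto_intros) auto
    moreover have "((1 - z / z0) ^ Suc m * w z j - (1 - z / z0) ^ Suc m * s) / (z - 1) = (1 - z / z0) ^ Suc m * F z" for z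
      by (simp only: F_def right_diff_distrib times_divide_eq_right)
    ultimately show ?thesis using z1 by (simp add: C_def)
  qed
  define P where "P = (\<lambda>u. complex_of_real \<theta> * u) ` {u. u ^ \<tau> = 1}"
  have u1: "norm u = 1" if "u ^ \<tau> = 1" for u :: complex
    using power_eq_1_iff[OF that] \<tau>_pos by simp
  have P: "finite P" "\<And>z. z \<in> P \<Longrightarrow> norm z = \<theta>" "\<And>z. norm z = \<theta> \<Longrightarrow> z \<notin> P \<Longrightarrow> C z = 0"
  proof -
    show "finite P" unfolding P_def by (intro finite_imageI roots_of_unity_finite)
    show "norm z = \<theta>" if "z \<in> P" for z using that u1 \<theta>_pos by (auto simp: P_def norm_mult)
    show "C z = 0" if "z \<notin> P" for z
    proof -
      have "(z / of_real \<theta>) ^ \<tau> \<noteq> 1"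
      proof
        assume "(z / of_real \<theta>) ^ \<tau> = 1"
        then have "of_real \<theta> * (z / of_real \<theta>) \<in> P" unfolding P_def by blast
        then show False using that \<theta>_pos by simp
      qed
      then show ?thesis by (simp add: C_def circle_coeff_def Let_def)
    qed
  qed
  have "(\<Sum>z\<in>P. C z / z ^ k) = (\<Sum>u\<in>{u. u ^ \<tau> = 1}. pole_coeff u j / (of_real \<theta> * u - 1) / (of_real \<theta> * u) ^ k)" for k
    unfolding P_def using \<theta>_pos
    by (subst sum.reindex) (auto simp: inj_on_def C_def circle_coeff_def Let_def intro!: sum.cong)
  moreover have "disc_series \<theta> (\<lambda>k. of_real (xbar x k j)) F"
    using Fmero Freg Fser by (simp add: disc_series_def)
  ultimately show ?thesis using circle_poles_coeff_asymp[OF \<theta>_pos _ Flim P m_pos] by simp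
qed

end

section \<open>The oscillating leading coefficient\<close>

lemma omega_power: "omega n ^ k = exp (2 * of_real pi * \<i> * of_nat k / of_nat n)"
  unfolding omega_def by (simp flip: exp_of_nat_mult) (simp add: mult_ac)

lemma omega_power_eq_1: "n \<ge> 1 \<Longrightarrow> omega n ^ n = 1"
  unfolding omega_power by (simp add: exp_two_pi_i')

lemma norm_omega: "norm (omega n) = 1"
  unfolding omega_def by (simp add: norm_exp_eq_Re)

lemma inj_on_omega_power: "n \<ge> 1 \<Longrightarrow> inj_on (\<lambda>k. omega n ^ k) {0..<n}"
  unfolding omega_power by (auto simp: inj_on_def complex_root_unity_eq cong_def)

lemma root_of_unity_omega:
  assumes "n \<ge> 1" "u ^ n = 1"
  obtains k where "k < n" "u = omega n ^ k"
  using assms complex_roots_unity[of n] by (auto simp: omega_power)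

lemma omega_power_reduce:
  assumes "n \<ge> 1" "g dvd n" "g dvd k"
  shows "omega n ^ k = omega (n div g) ^ (k div g)"
proof -
  obtain n' k' where "n = g * n'" "k = g * k'" using assms by (auto elim!: dvdE)
  moreover have "g \<noteq> 0" using assms by auto
  ultimately show ?thesis by (simp add: omega_power mult.assoc)
qed

lemma sum_inverse_powers_root_of_unity:
  fixes u :: complex
  assumes "u ^ n = 1" "u \<noteq> 1"
  shows "(\<Sum>i<n. 1 / u ^ (l + i)) = 0"
proof -
  have "(\<Sum>i<n. 1 / u ^ (l + i)) = 1 / u ^ l * (\<Sum>i<n. (1 / u) ^ i)"
    by (simp add: sum_distrib_left power_add power_divide)
  also have "(\<Sum>i<n. (1 / u) ^ i) = 0"
    using assms by (subst geometric_sum) (auto simp: power_divide)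
  finally show ?thesis by simp
qed

section \<open>Matching the index sets of the theorem with roots of unity\<close>

context mg1_stationary
begin

definition Hs :: "nat set" where "Hs = Hset x0 x A Bext v p \<tau> \<theta>"
definition \<tau>' :: nat where "\<tau>' = tau_prime \<tau> Hs"
definition etas :: "nat set" where "etas = Eta_set \<theta> \<tau>' (Pset \<theta> \<tau> Hs (Zset Bext \<theta> m))"
definition \<tau>h :: nat where "\<tau>h = tau_hat \<tau>' etas"
definition limit_coeff :: "nat \<Rightarrow> 'b \<Rightarrow> complex" where "limit_coeff = c_hat x0 A Bext m v \<mu> p \<theta> \<tau>' etas"

text \<open>The only factor of \<open>pole_coeff\<close> that can vanish: the root u contributes to
  the leading term exactly when \<open>numer u\<close> is nonzero.\<close>

definition numer :: "complex \<Rightarrow> complex" where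
  "numer u = (\<Sum>a\<in>UNIV. \<Sum>k\<in>UNIV. of_real (x0 a) * Btilde Bext m (of_real \<theta> * u) a k
       * DeltaM p u k * of_real (v k))"

lemma pole_coeff_numer: "pole_coeff u j = numer u / of_real (dDelta A \<theta> - 1) * of_real (\<mu> j) * inverse (DeltaM p u j)"
  by (simp add: pole_coeff_def numer_def)

text \<open>Multiplied by \<open>(1 - z / z0) ^ m\<close>, the function \<open>cfun\<close> tends to
  \<open>numer\<close> over a nonzero constant, so \<open>numer\<close> must vanish wherever
  \<open>cfun\<close> itself tends to 0. The index 0 belongs to the set by definition.\<close>

lemma numer_imp_H:
  assumes nz: "numer (omega \<tau> ^ \<nu>) \<noteq> 0" and \<nu>: "\<nu> < \<tau>"
  shows "\<nu> \<in> Hs"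
proof (rule ccontr)
  assume "\<nu> \<notin> Hs"
  define u where "u = omega \<tau> ^ \<nu>"
  define z0 where "z0 = of_real \<theta> * u"
  define d where "d = (z0 - 1) * complex_of_real (dDelta A \<theta> - 1)"
  have nz0: "norm z0 = \<theta>" using \<theta>_pos by (simp add: z0_def u_def norm_mult norm_power norm_omega)
  have z00: "z0 \<noteq> 0" "z0 \<noteq> 1" using nz0 \<theta>_gt_1 by auto
  have d0: "d \<noteq> 0" using z00 dDelta_gt_1 by (simp add: d_def del: of_real_diff)
  have "((cfun x0 x A Bext v p \<tau> \<theta> \<nu>) \<longlongrightarrow> 0) (at z0)"
    using \<open>\<nu> \<notin> Hs\<close> \<nu> by (cases "\<nu> = 0") (auto simp: Hs_def Hset_def z0_def u_def)
  then have "((\<lambda>z. (1 - z / z0) ^ m * cfun x0 x A Bext v p \<tau> \<theta> \<nu> z) \<longlongrightarrow> (1 - z0 / z0) ^ m * 0) (at z0)"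
    using z00 by (intro tendsto_intros)
  then have lim0: "((\<lambda>z. (1 - z / z0) ^ m * cfun x0 x A Bext v p \<tau> \<theta> \<nu> z) \<longlongrightarrow> 0) (at z0)" by simp
  have "((\<lambda>z. (\<Sum>k\<in>UNIV. ((\<Sum>a\<in>UNIV. of_real (x0 a) * ((1 - z / z0) ^ m * Bext z a k))
       - (1 - z / z0) ^ m * (\<Sum>i\<in>UNIV. of_real (x 1 i * A 0 i k))) * DeltaM p u k * of_real (v k)) / d) \<longlongrightarrow>
     (\<Sum>k\<in>UNIV. ((\<Sum>a\<in>UNIV. of_real (x0 a) * Btilde Bext m z0 a k)
       - (1 - z0 / z0) ^ m * (\<Sum>i\<in>UNIV. of_real (x 1 i * A 0 i k))) * DeltaM p u k * of_real (v k)) / d) (at z0)"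
    by (intro tendsto_intros Btilde_tendsto nz0 z00 d0)
  moreover have "(\<Sum>k\<in>UNIV. ((\<Sum>a\<in>UNIV. of_real (x0 a) * ((1 - z / z0) ^ m * Bext z a k))
       - (1 - z / z0) ^ m * (\<Sum>i\<in>UNIV. of_real (x 1 i * A 0 i k))) * DeltaM p u k * of_real (v k)) / d
     = (1 - z / z0) ^ m * cfun x0 x A Bext v p \<tau> \<theta> \<nu> z" for z
  proof -
    have "((\<Sum>a\<in>UNIV. of_real (x0 a) * ((1 - z / z0) ^ m * Bext z a k))
       - (1 - z / z0) ^ m * (\<Sum>i\<in>UNIV. of_real (x 1 i * A 0 i k))) * DeltaM p u k * of_real (v k)
      = (1 - z / z0) ^ m * (((\<Sum>a\<in>UNIV. of_real (x0 a) * Bext z a k) - (\<Sum>i\<in>UNIV. of_real (x 1 i * A 0 i k)))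
         * DeltaM p u k * of_real (v k))" for k
      by (simp add: sum_distrib_left algebra_simps)
    then show ?thesis
      by (simp only: cfun_def u_def d_def z0_def sum_distrib_left times_divide_eq_right)
  qed
  moreover have "(\<Sum>k\<in>UNIV. ((\<Sum>a\<in>UNIV. of_real (x0 a) * Btilde Bext m z0 a k)
       - (1 - z0 / z0) ^ m * (\<Sum>i\<in>UNIV. of_real (x 1 i * A 0 i k))) * DeltaM p u k * of_real (v k)) = numer u"
    unfolding numer_def z0_def[symmetric] using z00 m_pos
    by (subst sum.swap) (simp add: power_0_left sum_distrib_right)
  ultimately have "((\<lambda>z. (1 - z / z0) ^ m * cfun x0 x A Bext v p \<tau> \<theta> \<nu> z) \<longlongrightarrow> numer u / d) (at z0)" by simp
  from tendsto_unique[OF _ this lim0] have "numer u = 0" using d0 by simp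
  then show False using nz by (simp add: u_def)
qed

lemma numer_imp_Z:
  assumes "numer u \<noteq> 0" "norm u = 1"
  shows "u \<in> Zset Bext \<theta> m"
proof -
  have "norm (of_real \<theta> * u) = \<theta>" using assms \<theta>_pos by (simp add: norm_mult)
  from Btilde_tendsto[OF this] have "\<forall>a j. ((\<lambda>z. (1 - z / (of_real \<theta> * u)) ^ m * Bext z a j) \<longlongrightarrow> Btilde Bext m (of_real \<theta> * u) a j) (at (of_real \<theta> * u))"
    by blast
  moreover have "Btilde Bext m (of_real \<theta> * u) \<noteq> (\<lambda>i j. 0)"
    using assms(1) by (auto simp: numer_def)
  ultimately show ?thesis using assms(2) unfolding Zset_def by blast
qed

lemma numer_1_pos: "numer 1 \<in> \<real>" "Re (numer 1) > 0"
proof -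
  obtain Bt where Bt: "Bt \<noteq> (\<lambda>i j. 0)" "\<And>i j. Im (Bt i j) = 0" "\<And>i j. Re (Bt i j) \<ge> 0"
     and lim: "\<And>i j. ((\<lambda>z. (1 - z / of_real \<theta>) ^ m * Bext z i j) \<longlongrightarrow> Bt i j) (at (of_real \<theta>))"
    using Blim by blast
  have eq: "Btilde Bext m (of_real \<theta> * 1) a k = of_real (Re (Bt a k))" for a k
  proof -
    have "Btilde Bext m (of_real \<theta>) a k = Bt a k"
      unfolding Btilde_def by (intro tendsto_Lim lim) auto
    then show ?thesis using Bt(2) by (simp add: complex_eq_iff)
  qed
  have n1: "numer 1 = of_real (\<Sum>a\<in>UNIV. \<Sum>k\<in>UNIV. x0 a * Re (Bt a k) * v k)"
    unfolding numer_def eq by (simp add: DeltaM_def)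
  show "numer 1 \<in> \<real>" unfolding n1 by (rule Reals_of_real)
  obtain a k where ak: "Bt a k \<noteq> 0" using Bt(1) by blast
  then have "Re (Bt a k) \<noteq> 0" using Bt(2)[of a k] by (auto simp: complex_eq_iff)
  then have "Re (Bt a k) > 0" using Bt(3)[of a k] by simp
  then have pos: "x0 a * Re (Bt a k) * v k > 0" using x0_pos v_pos by simp
  have nn: "x0 a * Re (Bt a k) * v k \<ge> 0" for a k using x0_pos[of a] v_pos[of k] Bt(3)[of a k] by simp
  have "(\<Sum>k\<in>UNIV. x0 a * Re (Bt a k) * v k) > 0" by (rule sum_pos2[of _ k]) (use pos nn in auto)
  then have "(\<Sum>a\<in>UNIV. \<Sum>k\<in>UNIV. x0 a * Re (Bt a k) * v k) > 0"
    by (rule sum_pos2[of UNIV a "\<lambda>a. \<Sum>k\<in>UNIV. x0 a * Re (Bt a k) * v k", rotated 2]) (use nn in \<open>auto intro: sum_nonneg\<close>)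
  then show "Re (numer 1) > 0" unfolding n1 by simp
qed

lemma \<tau>'_props:
  defines "g \<equiv> Gcd (({\<tau>} \<union> Hs) - {0})"
  shows "g dvd \<tau>" "\<nu> \<in> Hs \<Longrightarrow> g dvd \<nu>" "\<tau>' = \<tau> div g" "\<tau>' \<ge> 1" "g \<ge> 1"
proof -
  show 1: "g dvd \<tau>" unfolding g_def by (rule Gcd_dvd) (use \<tau>_pos in auto)
  show "g dvd \<nu>" if "\<nu> \<in> Hs" using that unfolding g_def by (cases "\<nu> = 0") (auto intro: Gcd_dvd)
  show 2: "\<tau>' = \<tau> div g" by (simp add: \<tau>'_def tau_prime_def g_def)
  show g1: "g \<ge> 1" using 1 \<tau>_pos by (cases g) auto
  show "\<tau>' \<ge> 1" unfolding 2 using 1 \<tau>_pos g1 by (auto elim!: dvdE)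
qed

lemma etas_subset: "etas \<subseteq> {0..<\<tau>'}" by (auto simp: etas_def Eta_set_def)

lemma etas_root: "\<eta> \<in> etas \<Longrightarrow> (omega \<tau>' ^ \<eta>) ^ \<tau> = 1"
proof -
  obtain q where "\<tau> = \<tau>' * q"
    using \<tau>'_props(1,3) by (metis dvd_div_mult_self)
  then show ?thesis
    by (metis mult.commute mult.left_commute omega_power_eq_1 power_mult power_one \<tau>'_props(4))
qed

text \<open>A contributing index passes both tests, the one for A and the one for B. Dividing it by
  the common gcd turns the power of \<open>omega \<tau>\<close> into one of
  \<open>omega \<tau>'\<close>. Indices in \<open>etas\<close> with vanishing \<open>numer\<close>
  merely add zero terms.\<close>

lemma numer_imp_etas:
  assumes u: "u ^ \<tau> = 1" and nz: "numer u \<noteq> 0"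
  shows "\<exists>\<eta>\<in>etas. u = omega \<tau>' ^ \<eta>"
proof -
  obtain \<nu> where \<nu>: "\<nu> < \<tau>" "u = omega \<tau> ^ \<nu>" using root_of_unity_omega[OF \<tau>_pos u] by blast
  have H: "\<nu> \<in> Hs" using numer_imp_H nz \<nu> by simp
  have n1: "norm u = 1" by (simp add: \<nu> norm_power norm_omega)
  have Z: "u \<in> Zset Bext \<theta> m" by (rule numer_imp_Z[OF nz n1])
  let ?g = "Gcd (({\<tau>} \<union> Hs) - {0})"
  have eq: "u = omega \<tau>' ^ (\<nu> div ?g)"
    unfolding \<nu>(2) \<tau>'_props(3) by (rule omega_power_reduce[OF \<tau>_pos \<tau>'_props(1) \<tau>'_props(2)[OF H]])
  have "\<nu> div ?g < \<tau>'"
    by (rule less_mult_imp_div_less) (use \<nu>(1) \<tau>'_props(1,3) in simp)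
  moreover have "of_real \<theta> * u \<in> Pset \<theta> \<tau> Hs (Zset Bext \<theta> m)"
    using H Z \<nu>(2) by (auto simp: Pset_def)
  ultimately show ?thesis using eq by (intro bexI[of _ "\<nu> div ?g"]) (auto simp: etas_def Eta_set_def)
qed

text \<open>The sum can be extended from \<open>etas\<close> to all \<tau>-th roots of unity, since
  the added roots have \<open>numer\<close> equal to 0.\<close>

lemma limit_coeff_eq: "limit_coeff l j = (\<Sum>u\<in>{u. u ^ \<tau> = 1}. pole_coeff u j / (of_real \<theta> * u - 1) / u ^ l)"
proof -
  have "limit_coeff l j = (\<Sum>\<eta>\<in>etas. pole_coeff (omega \<tau>' ^ \<eta>) j / (of_real \<theta> * omega \<tau>' ^ \<eta> - 1) / (omega \<tau>' ^ \<eta>) ^ l)"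
    unfolding limit_coeff_def c_hat_def
    by (intro sum.cong refl) (simp add: pole_coeff_def divide_simps)
  also have "\<dots> = (\<Sum>u\<in>(\<lambda>\<eta>. omega \<tau>' ^ \<eta>) ` etas. pole_coeff u j / (of_real \<theta> * u - 1) / u ^ l)"
    using inj_on_subset[OF inj_on_omega_power[OF \<tau>'_props(4)] etas_subset] by (simp add: sum.reindex)
  also have "\<dots> = (\<Sum>u\<in>{u. u ^ \<tau> = 1}. pole_coeff u j / (of_real \<theta> * u - 1) / u ^ l)"
  proof (rule sum.mono_neutral_left[OF roots_of_unity_finite])
    show "(\<lambda>\<eta>. omega \<tau>' ^ \<eta>) ` etas \<subseteq> {u. u ^ \<tau> = 1}" using etas_root by auto
    show "\<forall>u\<in>{u. u ^ \<tau> = 1} - (\<lambda>\<eta>. omega \<tau>' ^ \<eta>) ` etas. pole_coeff u j / (of_real \<theta> * u - 1) / u ^ l = 0"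
      using numer_imp_etas by (auto simp: pole_coeff_numer)
  qed
  finally show ?thesis .
qed

text \<open>Every exponent in \<open>etas\<close> is a multiple of the gcd that was divided out of
  \<open>\<tau>'\<close>, so times \<open>\<tau>h\<close> it is a multiple of
  \<open>\<tau>'\<close>. Hence the phases of the leading term depend on the level only modulo
  \<open>\<tau>h\<close>.\<close>

lemma \<tau>h_props: "\<tau>h \<ge> 1" "u ^ \<tau> = 1 \<Longrightarrow> numer u \<noteq> 0 \<Longrightarrow> u ^ \<tau>h = 1"
proof -
  define g where "g = Gcd (etas \<union> {\<tau>'})"
  have 1: "g dvd \<tau>'" "\<eta> \<in> etas \<Longrightarrow> g dvd \<eta>" for \<eta> unfolding g_def by (rule Gcd_dvd, simp)+
  have eq: "\<tau>h = \<tau>' div g" by (simp add: \<tau>h_def tau_hat_def g_def)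
  show "\<tau>h \<ge> 1" unfolding eq using 1(1) \<tau>'_props(4) by (auto elim!: dvdE)
  assume "u ^ \<tau> = 1" "numer u \<noteq> 0"
  then obtain \<eta> where \<eta>: "\<eta> \<in> etas" "u = omega \<tau>' ^ \<eta>" using numer_imp_etas by blast
  obtain q where q: "\<eta> = g * q" using 1(2)[OF \<eta>(1)] by (elim dvdE)
  have "\<eta> * \<tau>h = \<tau>' * q" using 1(1) unfolding eq q by (metis dvd_div_mult_self mult.assoc mult.commute)
  then show "u ^ \<tau>h = 1"
    unfolding \<eta>(2) by (metis omega_power_eq_1 power_mult power_one \<tau>'_props(4))
qed

end

section \<open>Limits of the rescaled tails along residue classes\<close>

context mg1_stationary
begin

lemma subsequence_at_top: "filterlim (\<lambda>n. n * \<tau>h + l) at_top at_top"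
proof (rule filterlim_at_top_mono[OF filterlim_ident], rule always_eventually, rule allI)
  fix n show "n \<le> n * \<tau>h + l" using \<tau>h_props(1) by (simp add: trans_le_add1)
qed

lemma xbar_limit_coeff_bigo:
  "(\<lambda>n. of_real (xbar x (n * \<tau>h + l) j)
      - of_real (real (n * \<tau>h + l) ^ m / fact m / \<theta> ^ (n * \<tau>h + l)) * limit_coeff l j)
    \<in> O(\<lambda>n. complex_of_real (real (n * \<tau>h + l) ^ (m - 1) / \<theta> ^ (n * \<tau>h + l)))"
proof -
  have eq: "of_real (real k ^ m / fact m) *
      (\<Sum>u\<in>{u. u ^ \<tau> = 1}. pole_coeff u j / (of_real \<theta> * u - 1) / (of_real \<theta> * u) ^ k)
     = of_real (real k ^ m / fact m / \<theta> ^ k) * limit_coeff l j" if k: "k = n * \<tau>h + l" for k n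
  proof -
    have *: "pole_coeff u j / (of_real \<theta> * u - 1) / (of_real \<theta> * u) ^ k
        = pole_coeff u j / (of_real \<theta> * u - 1) / u ^ l / of_real (\<theta> ^ k)" if u: "u ^ \<tau> = 1" for u
    proof (cases "numer u = 0")
      case True then show ?thesis by (simp add: pole_coeff_numer)
    next
      case False
      \<comment> \<open>Along the residue class the phase of each contributing root is constant,
        which turns the oscillating sum into \<open>limit_coeff\<close>.\<close>
      have "u ^ k = (u ^ \<tau>h) ^ n * u ^ l" unfolding k by (simp add: power_add mult.commute flip: power_mult)
      then have "u ^ k = u ^ l" using \<tau>h_props(2)[OF u False] by simp
      then show ?thesis by (simp add: power_mult_distrib)
    qed
    have "(\<Sum>u\<in>{u. u ^ \<tau> = 1}. pole_coeff u j / (of_real \<theta> * u - 1) / (of_real \<theta> * u) ^ k)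
       = limit_coeff l j / of_real (\<theta> ^ k)"
      unfolding limit_coeff_eq sum_divide_distrib by (rule sum.cong[OF refl]) (simp only: mem_Collect_eq *)
    then show ?thesis by simp
  qed
  show ?thesis
    using landau_o.big.compose[OF xbar_asymptotics[of j] subsequence_at_top[of l]] by (simp only: eq[OF refl])
qed

text \<open>The tail divided by its predicted size \<open>k ^ m / (fact m * \<theta> ^ k)\<close>,
  so that its limits are the coefficients themselves.\<close>

definition scaled_tail :: "nat \<Rightarrow> 'b \<Rightarrow> real" where
  "scaled_tail k j = xbar x k j * \<theta> ^ k * fact m / real k ^ m"

lemma scaled_tail_tendsto: "(\<lambda>n. complex_of_real (scaled_tail (n * \<tau>h + l) j)) \<longlonglongrightarrow> limit_coeff l j"
proof -
  define k where "k = (\<lambda>n. n * \<tau>h + l)"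
  have kt: "filterlim k at_top at_top" unfolding k_def by (rule subsequence_at_top)
  obtain c where c: "\<forall>\<^sub>F n in sequentially. norm (of_real (xbar x (k n) j) - of_real (real (k n) ^ m / fact m / \<theta> ^ k n) * limit_coeff l j)
      \<le> c * norm (complex_of_real (real (k n) ^ (m - 1) / \<theta> ^ k n))"
    using landau_o.bigE[OF xbar_limit_coeff_bigo[of l j]] unfolding k_def by blast
  have k1: "\<forall>\<^sub>F n in sequentially. k n \<ge> 1" using kt by (simp add: filterlim_at_top)
  have "(\<lambda>n. complex_of_real (scaled_tail (k n) j) - limit_coeff l j) \<longlonglongrightarrow> 0"
  proof (rule Lim_null_comparison)
    show "\<forall>\<^sub>F n in sequentially. norm (complex_of_real (scaled_tail (k n) j) - limit_coeff l j)
       \<le> c * fact m * (1 / real (k n))"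
      using c k1
    proof eventually_elim
      case (elim n)
      let ?k = "k n"
      have kp: "real ?k > 0" using elim(2) by simp
      define f where "f = \<theta> ^ ?k * fact m / real ?k ^ m"
      have f0: "f > 0" using kp \<theta>_pos by (simp add: f_def)
      have "complex_of_real (scaled_tail ?k j) - limit_coeff l j
          = of_real f * (of_real (xbar x ?k j) - of_real (real ?k ^ m / fact m / \<theta> ^ ?k) * limit_coeff l j)"
      proof -
        have "f * (real ?k ^ m / fact m / \<theta> ^ ?k) = 1" using kp \<theta>_pos by (simp add: f_def)
        then have "complex_of_real f * of_real (real ?k ^ m / fact m / \<theta> ^ ?k) = 1" by (metis of_real_1 of_real_mult)
        then have "of_real f * (of_real (xbar x ?k j) - of_real (real ?k ^ m / fact m / \<theta> ^ ?k) * limit_coeff l j)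
          = of_real f * of_real (xbar x ?k j) - limit_coeff l j"
          by (simp only: right_diff_distrib mult.assoc[symmetric] mult_1)
        moreover have "scaled_tail ?k j = f * xbar x ?k j" by (simp add: f_def scaled_tail_def)
        ultimately show ?thesis by (simp only: of_real_mult)
      qed
      then have "norm (complex_of_real (scaled_tail ?k j) - limit_coeff l j)
          = f * norm (of_real (xbar x ?k j) - of_real (real ?k ^ m / fact m / \<theta> ^ ?k) * limit_coeff l j)"
        using f0 by (simp only: norm_mult norm_of_real abs_of_pos)
      also have "\<dots> \<le> f * (c * norm (complex_of_real (real ?k ^ (m - 1) / \<theta> ^ ?k)))"
        using f0 elim(1) by (intro mult_left_mono) auto
      also have "norm (complex_of_real (real ?k ^ (m - 1) / \<theta> ^ ?k)) = real ?k ^ (m - 1) / \<theta> ^ ?k"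
        using \<theta>_pos by (simp only: norm_of_real) simp
      \<comment> \<open>The error term is smaller than the main term by one power of k, which leaves
        \<open>1 / k\<close>.\<close>
      also have "f * (c * (real ?k ^ (m - 1) / \<theta> ^ ?k)) = c * fact m * (1 / real ?k)"
      proof -
        have "real ?k ^ m = real ?k * real ?k ^ (m - 1)" using m_pos by (metis power_eq_if not_one_le_zero)
        then show ?thesis using kp \<theta>_pos by (simp add: f_def)
      qed
      finally show ?case .
    qed
    have "filterlim (\<lambda>n. real (k n)) at_top sequentially"
      by (rule filterlim_compose[OF filterlim_real_sequentially kt])
    then have "(\<lambda>n. 1 / real (k n)) \<longlonglongrightarrow> 0"
      by (intro tendsto_divide_0[OF tendsto_const] filterlim_at_top_imp_at_infinity)
    then have "(\<lambda>n. c * fact m * (1 / real (k n))) \<longlonglongrightarrow> c * fact m * 0" by (intro tendsto_intros)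
    then show "(\<lambda>n. c * fact m * (1 / real (k n))) \<longlonglongrightarrow> 0" by simp
  qed
  then show ?thesis unfolding k_def using Lim_null by blast
qed

lemma limit_coeff_real_nonneg: "Im (limit_coeff l j) = 0" "Re (limit_coeff l j) \<ge> 0"
proof -
  have "(\<lambda>n. 0) \<longlonglongrightarrow> Im (limit_coeff l j)"
    using tendsto_Im[OF scaled_tail_tendsto[of l j]] by simp
  then show "Im (limit_coeff l j) = 0" using LIMSEQ_unique tendsto_const by blast
  show "Re (limit_coeff l j) \<ge> 0"
  proof (rule LIMSEQ_le_const[OF tendsto_Re[OF scaled_tail_tendsto[of l j]]], intro exI allI impI)
    fix n
    show "0 \<le> Re (complex_of_real (scaled_tail (n * \<tau>h + l) j))"
      using xbar_bounds(1)[where x = x and j = j, OF xsum xnn] \<theta>_pos by (simp add: scaled_tail_def)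
  qed
qed

text \<open>Monotonicity of the tails in the limit; \<theta> is the quotient of consecutive
  scalings. Coefficients and limits are available for every l, so no wrap-around modulo
  \<open>\<tau>h\<close> occurs.\<close>

lemma limit_coeff_Suc_le: "Re (limit_coeff (Suc l) j) \<le> \<theta> * Re (limit_coeff l j)"
proof (rule LIMSEQ_le)
  show "(\<lambda>n. scaled_tail (n * \<tau>h + Suc l) j) \<longlonglongrightarrow> Re (limit_coeff (Suc l) j)"
    using tendsto_Re[OF scaled_tail_tendsto[of "Suc l" j]] by simp
  show "(\<lambda>n. \<theta> * scaled_tail (n * \<tau>h + l) j) \<longlonglongrightarrow> \<theta> * Re (limit_coeff l j)"
    using tendsto_mult_left[OF tendsto_Re[OF scaled_tail_tendsto[of l j]], of \<theta>] by simp
  have "scaled_tail (Suc k) j \<le> \<theta> * scaled_tail k j" if "k \<ge> 1" for k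
  proof -
    have "scaled_tail (Suc k) j \<le> xbar x k j * \<theta> ^ Suc k * fact m / real k ^ m"
      unfolding scaled_tail_def
      using xbar_bounds[where x = x and j = j, OF xsum xnn, of k] that \<theta>_pos
      by (intro frac_le mult_right_mono power_mono) auto
    then show ?thesis by (simp add: scaled_tail_def mult_ac)
  qed
  moreover have "n * \<tau>h + l \<ge> 1" if "n \<ge> 1" for n using that \<tau>h_props(1) by (simp add: trans_le_add1)
  ultimately show "\<exists>N. \<forall>n\<ge>N. scaled_tail (n * \<tau>h + Suc l) j \<le> \<theta> * scaled_tail (n * \<tau>h + l) j"
    by (intro exI[of _ 1]) simp
qed

text \<open>Averaging over a period keeps only the pole at \<open>\<theta>\<close>.\<close>

lemma limit_coeff_period_sum: "(\<Sum>i<\<tau>h. limit_coeff (l + i) j) = of_nat \<tau>h * (pole_coeff 1 j / (of_real \<theta> - 1))"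
proof -
  have "(\<Sum>i<\<tau>h. limit_coeff (l + i) j)
      = (\<Sum>u\<in>{u. u ^ \<tau> = 1}. pole_coeff u j / (of_real \<theta> * u - 1) * (\<Sum>i<\<tau>h. 1 / u ^ (l + i)))"
    unfolding limit_coeff_eq by (subst sum.swap) (simp add: sum_distrib_left)
  also have "\<dots> = (\<Sum>u\<in>{u::complex. u ^ \<tau> = 1}. if u = 1 then of_nat \<tau>h * (pole_coeff 1 j / (of_real \<theta> - 1)) else 0)"
  proof (rule sum.cong[OF refl])
    fix u :: complex assume u: "u \<in> {u. u ^ \<tau> = 1}"
    show "pole_coeff u j / (of_real \<theta> * u - 1) * (\<Sum>i<\<tau>h. 1 / u ^ (l + i))
        = (if u = 1 then of_nat \<tau>h * (pole_coeff 1 j / (of_real \<theta> - 1)) else 0)"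
    proof (cases "u = 1 \<or> numer u = 0")
      case True then show ?thesis by (auto simp: pole_coeff_numer)
    next
      case False
      then have "(\<Sum>i<\<tau>h. 1 / u ^ (l + i)) = 0"
        using \<tau>h_props(2) u by (intro sum_inverse_powers_root_of_unity) auto
      then show ?thesis using False by simp
    qed
  qed
  also have "\<dots> = of_nat \<tau>h * (pole_coeff 1 j / (of_real \<theta> - 1))"
    using roots_of_unity_finite by (simp add: sum.delta)
  finally show ?thesis .
qed

lemma limit_coeff_pos: "Re (limit_coeff l j) > 0"
proof (rule ccontr)
  assume "\<not> ?thesis"
  then have 0: "Re (limit_coeff l j) = 0" using limit_coeff_real_nonneg(2)[of l j] by simp
  have z: "Re (limit_coeff (l + i) j) = 0" for i
  proof (induction i)
    case (Suc i)
    then show ?case using limit_coeff_Suc_le[of "l + i" j] limit_coeff_real_nonneg(2)[of "Suc (l + i)" j] by simp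
  qed (use 0 in simp)
  have "Re (\<Sum>i<\<tau>h. limit_coeff (l + i) j) = 0" by (simp add: z)
  moreover have "Re (of_nat \<tau>h * (pole_coeff 1 j / (of_real \<theta> - 1))) > 0"
  proof -
    obtain r where r: "numer 1 = of_real r" "r > 0" using numer_1_pos by (auto elim!: Reals_cases)
    have "of_nat \<tau>h * (pole_coeff 1 j / (of_real \<theta> - 1))
       = complex_of_real (real \<tau>h * (r / (dDelta A \<theta> - 1) * \<mu> j / (\<theta> - 1)))"
      by (simp add: pole_coeff_numer r DeltaM_def)
    also have "Re \<dots> > 0"
      using \<tau>h_props(1) r(2) dDelta_gt_1 \<mu>_pos[of j] \<theta>_gt_1 by simp
    finally show ?thesis .
  qed
  ultimately show False unfolding limit_coeff_period_sum by linarith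
qed

lemma xbar_limit_coeff_real_bigo:
  "(\<lambda>n. xbar x (n * \<tau>h + l) j
      - real (n * \<tau>h + l) ^ m / fact m / \<theta> ^ (n * \<tau>h + l) * Re (limit_coeff l j))
    \<in> O(\<lambda>n. real (n * \<tau>h + l) ^ (m - 1) / \<theta> ^ (n * \<tau>h + l))"
proof -
  have c: "limit_coeff l j = of_real (Re (limit_coeff l j))" using limit_coeff_real_nonneg(1) by (simp add: complex_eq_iff)
  have "(\<lambda>n. complex_of_real (xbar x (n * \<tau>h + l) j
      - real (n * \<tau>h + l) ^ m / fact m / \<theta> ^ (n * \<tau>h + l) * Re (limit_coeff l j)))
    \<in> O(\<lambda>n. complex_of_real (real (n * \<tau>h + l) ^ (m - 1) / \<theta> ^ (n * \<tau>h + l)))"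
    using xbar_limit_coeff_bigo[of l j] by (subst (asm) c) (simp only: of_real_diff of_real_mult)
  then show ?thesis by (simp only: landau_o.big.of_real_iff)
qed

end

section \<open>Reduction of the theorem to the stationary setting\<close>

theorem theorem3p4:
  fixes B0 :: "'a::finite \<Rightarrow> 'a \<Rightarrow> real"
    and B :: "nat \<Rightarrow> 'a \<Rightarrow> 'b::finite \<Rightarrow> real"
    and C0 :: "'b \<Rightarrow> 'a \<Rightarrow> real"
    and A :: "nat \<Rightarrow> 'b \<Rightarrow> 'b \<Rightarrow> real"
    and x0 :: "'a \<Rightarrow> real" and x :: "nat \<Rightarrow> 'b \<Rightarrow> real"
    and pi :: "'b \<Rightarrow> real"
    and rA :: ereal and rB :: real and \<theta> :: real
    and Bext :: "complex \<Rightarrow> 'a \<Rightarrow> 'b \<Rightarrow> complex" and U :: "complex set" and mB :: nat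
    and mu v :: "'b \<Rightarrow> real"
    and tau :: nat and p :: "'b \<Rightarrow> nat"
    and S T X Asum Gam H tau' Eta tauhat chat
  defines "S \<equiv> (mg1_states :: (nat \<times> ('a + 'b)) set)"
    and "T \<equiv> mg1_T B0 B C0 A"
    and "X \<equiv> mg1_vec x0 x"
    and "Asum \<equiv> (\<lambda>i j. \<Sum>k. A k i j)"
    and "Gam \<equiv> (\<lambda>i j. Astar A (complex_of_real \<theta>) i j / complex_of_real \<theta>)"
    and "H \<equiv> Hset x0 x A Bext v p tau \<theta>"
    and "tau' \<equiv> tau_prime tau H"
    and "Eta \<equiv> Eta_set \<theta> tau' (Pset \<theta> tau H (Zset Bext rB mB))"
    and "tauhat \<equiv> tau_hat tau' Eta"
    and "chat \<equiv> c_hat x0 A Bext mB v mu p \<theta> tau' Eta"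
  assumes nonnegA: "\<forall>k i j. A k i j \<ge> 0"
    and nonnegB0: "\<forall>i j. B0 i j \<ge> 0"
    and nonnegB: "\<forall>k i j. B k i j \<ge> 0"
    and nonnegC0: "\<forall>i j. C0 i j \<ge> 0"
    and A_summable: "\<forall>i j. summable (\<lambda>k. A k i j)"
    and A_stoch: "\<forall>i. (\<Sum>j\<in>UNIV. Asum i j) = 1"
    and B_summable: "\<forall>i j. summable (\<lambda>k. B (Suc k) i j)"
    and B_stoch: "\<forall>i. (\<Sum>j\<in>UNIV. B0 i j) + (\<Sum>j\<in>UNIV. \<Sum>k. B (Suc k) i j) = 1"
    and T_stoch: "\<forall>s\<in>S. (T s has_sum 1) S"
    and pi_stat: "\<forall>j. (\<Sum>i\<in>UNIV. pi i * Asum i j) = pi j"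
    and pi_norm: "(\<Sum>i\<in>UNIV. pi i) = 1"
    and A1a: "\<forall>s\<in>S. \<forall>t\<in>S. (s, t) \<in> {(s, t). T s t > 0}\<^sup>+"
    and A1b: "\<forall>i j. (i, j) \<in> {(i, j). Asum i j > 0}\<^sup>+"
    and A1c_summable: "\<forall>i j. summable (\<lambda>k. real k * A k i j)"
    and A1c: "(\<Sum>i\<in>UNIV. pi i * (\<Sum>j\<in>UNIV. \<Sum>k. real k * A k i j)) < 1"
    and A1d: "\<forall>i j. summable (\<lambda>k. real k * B k i j)"
    and rA_def: "mat_conv_radius A = rA"
    and rB_def: "mat_conv_radius (\<lambda>k. if k = 0 then (\<lambda>i j. 0) else B k) = ereal rB"
    and A2: "rA > 1" "rB > 1"
    and A3: "1 < \<theta>" "ereal \<theta> < rA" "delta (Astar A (complex_of_real \<theta>)) = complex_of_real \<theta>"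
    and A4_open: "open U" "cball 0 rB \<subseteq> U"
    and A4_mero: "\<forall>i j. (\<lambda>z. Bext z i j) meromorphic_on U"
    and A4_ext: "\<forall>z\<in>ball 0 rB. \<forall>i j. Bext z i j = Bstar B z i j"
    and A4_mB: "mB \<ge> 1"
    and A4_lim: "\<exists>Bt. Bt \<noteq> (\<lambda>i j. 0) \<and> (\<forall>i j. Im (Bt i j) = 0 \<and> Re (Bt i j) \<ge> 0) \<and>
                  (\<forall>i j. ((\<lambda>z. (1 - z / of_real rB) ^ mB * Bext z i j) \<longlongrightarrow> Bt i j)
                          (at (of_real rB)))"
    and A5: "finite (Zset Bext rB mB)"
    and x_nonneg: "\<forall>s. X s \<ge> 0"
    and x_norm: "(X has_sum 1) S"
    and x_stat: "\<forall>t\<in>S. ((\<lambda>s. X s * T s t) has_sum X t) S"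
    and mu_pos: "\<forall>j. mu j > 0" and v_pos: "\<forall>j. v j > 0"
    and mu_eig: "\<forall>j. (\<Sum>i\<in>UNIV. complex_of_real (mu i) * Gam i j) = delta Gam * complex_of_real (mu j)"
    and v_eig: "\<forall>i. (\<Sum>j\<in>UNIV. Gam i j * complex_of_real (v j)) = delta Gam * complex_of_real (v i)"
    and mu_norm: "(\<Sum>j\<in>UNIV. mu j) = 1"
    and muv_norm: "(\<Sum>j\<in>UNIV. mu j * v j) = 1"
    and tau_pos: "tau \<ge> 1"
    and tau_def: "\<forall>j. int tau = Gcd {k. k \<noteq> 0 \<and> ((0, j), (k, j)) \<in> (MAP_step A)\<^sup>+}"
    and p_range: "\<forall>j. p j < tau"
    and p_prop: "\<forall>k i j. k \<ge> -1 \<and> A (nat (k + 1)) i j > 0 \<longrightarrow>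
                   k mod int tau = (int (p j) - int (p i)) mod int tau"
    and theta_eq: "\<theta> = rB"
  shows "\<forall>l < tauhat. \<forall>j.
           Im (chat l j) = 0 \<and> Re (chat l j) > 0 \<and>
           (\<lambda>n. xbar x (n * tauhat + l) j
                 - real (n * tauhat + l) ^ mB / fact mB / \<theta> ^ (n * tauhat + l) * Re (chat l j))
             \<in> O(\<lambda>n. real (n * tauhat + l) ^ (mB - 1) / \<theta> ^ (n * tauhat + l))"
proof -
  have th: "\<theta> > 0" "ereal \<bar>\<theta>\<bar> < mat_conv_radius A" "ereal \<theta> < mat_conv_radius A"
    using A3 rA_def by auto
  have Gam_eq: "Gam i j = of_real (Areal A \<theta> i j / \<theta>)" for i j
    unfolding Gam_def using Astar_of_real[OF th(2), of i j] by simp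
  have Ann: "Areal A \<theta> i j \<ge> 0" for i j
    unfolding Areal_def
    by (intro suminf_nonneg mat_power_series_summable_real th(2)) (use nonnegA th(1) in simp)
  \<comment> \<open>\<open>delta\<close> is a definite description, so its value has to be pinned
    down: any row of the equation for the positive vector v shows that it is real and nonnegative.
    Comparison with the Perron root of A*(\<theta>), which is \<theta> by assumption, then gives
    \<open>\<theta> * r = \<theta>\<close>.\<close>
  obtain r where r: "delta Gam = of_real r" "r \<ge> 0"
  proof -
    fix i :: 'b
    have "of_real (\<Sum>j\<in>UNIV. Areal A \<theta> i j / \<theta> * v j) = delta Gam * of_real (v i)"
      using v_eig[rule_format, of i] by (simp add: Gam_eq)
    then have "delta Gam = of_real ((\<Sum>j\<in>UNIV. Areal A \<theta> i j / \<theta> * v j) / v i)"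
      using v_pos[rule_format, of i] by (simp add: field_simps)
    moreover have "(\<Sum>j\<in>UNIV. Areal A \<theta> i j / \<theta> * v j) / v i \<ge> 0"
      using v_pos Ann th(1) by (auto intro!: divide_nonneg_pos sum_nonneg mult_nonneg_nonneg simp: less_imp_le)
    ultimately show thesis by (rule that)
  qed
  have ve: "(\<Sum>j\<in>UNIV. Areal A \<theta> i j * v j) = \<theta> * r * v i" for i
  proof -
    have "complex_of_real (\<Sum>j\<in>UNIV. Areal A \<theta> i j / \<theta> * v j) = of_real (r * v i)"
      using v_eig[rule_format, of i] by (simp add: Gam_eq r)
    then have "(\<Sum>j\<in>UNIV. Areal A \<theta> i j / \<theta> * v j) = r * v i" by (simp only: of_real_eq_iff)
    then show ?thesis using th(1) by (simp add: field_simps flip: sum_divide_distrib)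
  qed
  have me: "(\<Sum>i\<in>UNIV. mu i * Areal A \<theta> i j) = \<theta> * r * mu j" for j
  proof -
    have "complex_of_real (\<Sum>i\<in>UNIV. mu i * (Areal A \<theta> i j / \<theta>)) = of_real (r * mu j)"
      using mu_eig[rule_format, of j] by (simp add: Gam_eq r)
    then have "(\<Sum>i\<in>UNIV. mu i * (Areal A \<theta> i j / \<theta>)) = r * mu j" by (simp only: of_real_eq_iff)
    then show ?thesis using th(1) by (simp add: field_simps flip: sum_divide_distrib)
  qed
  have "delta (\<lambda>i j. of_real (Areal A \<theta> i j)) = of_real (\<theta> * r)"
    by (rule delta_eqI[where h = v]) (use Ann v_pos th(1) r(2) ve in auto)
  moreover have "Astar A (complex_of_real \<theta>) = (\<lambda>i j. of_real (Areal A \<theta> i j))"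
    using Astar_of_real[OF th(2)] by blast
  ultimately have "complex_of_real (\<theta> * r) = of_real \<theta>" using A3(3) by simp
  then have "\<theta> * r = \<theta>" by (simp only: of_real_eq_iff)
  then have r1: "\<theta> * r * y = \<theta> * y" for y by simp
  have X0: "mg1_vec x0 x s \<ge> 0" for s using x_nonneg unfolding X_def by blast
  have X1: "(mg1_vec x0 x has_sum 1) mg1_states" using x_norm by (simp add: X_def S_def)
  have pos: "mg1_vec x0 x t > 0" if "t \<in> mg1_states" for t
  proof (rule stationary_positive[where S = mg1_states and P = "mg1_T B0 B C0 A", OF _ _ _ X0 X1 _ that])
    show "(s, t) \<in> {(s, t). mg1_T B0 B C0 A s t > 0}\<^sup>+" if "s \<in> mg1_states" "t \<in> mg1_states" for s t
      using A1a that by (simp add: S_def T_def)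
    show "s \<in> mg1_states \<and> t \<in> mg1_states" if "mg1_T B0 B C0 A s t > 0" for s t
      using mg1_T_pos_states[OF that] by simp
    show "mg1_T B0 B C0 A s t \<ge> 0" for s t
      by (rule mg1_T_nonneg) (use nonnegA nonnegB nonnegB0 nonnegC0 in auto)
    show "((\<lambda>s. mg1_vec x0 x s * mg1_T B0 B C0 A s t) has_sum mg1_vec x0 x t) mg1_states" if "t \<in> mg1_states" for t
      using x_stat that by (simp add: S_def T_def X_def)
  qed
  \<comment> \<open>Strict positivity at level 0 is what makes the numerator of the pole at \<theta>
    positive.\<close>
  have x0_pos: "x0 a > 0" for a
    using pos[of "(0, Inl a)"] by (simp add: mg1_states_def mg1_vec_def)
  have bal: "x k j = (\<Sum>a\<in>UNIV. x0 a * B k a j) + (\<Sum>l=1..k+1. \<Sum>i\<in>UNIV. x l i * A (k + 1 - l) i j)"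
    if "k \<ge> 1" for k j
    by (rule mg1_balance[OF _ that]) (use x_stat that in \<open>auto simp: S_def T_def X_def mg1_states_def\<close>)
  have p_mod: "d mod int tau = (int (p j) - int (p i)) mod int tau"
    if "d \<ge> -1" "A (nat (d + 1)) i j > 0" for d i j
    using p_prop that by blast
  interpret mg1_stationary A pi mu v \<theta> tau p B x0 x Bext U mB
  proof (unfold_locales)
    show "A k i j \<ge> 0" "B k a j \<ge> 0" for k i j a using nonnegA nonnegB by simp_all
    show "summable (\<lambda>k. A k i j)" "summable (\<lambda>k. B (Suc k) a j)" "summable (\<lambda>k. real k * A k i j)" for i j a
      using A_summable B_summable A1c_summable by simp_all
    show "(\<Sum>j\<in>UNIV. \<Sum>k. A k i j) = 1" for i using A_stoch by (simp add: Asum_def)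
    show "(\<Sum>i\<in>UNIV. pi i * (\<Sum>k. A k i j)) = pi j" for j using pi_stat by (simp add: Asum_def)
    show "irreducible_mat (\<lambda>i j. \<Sum>k. A k i j)"
      using A1b by (simp add: irreducible_mat_def Asum_def)
    show "mu i > 0" "v i > 0" for i using mu_pos v_pos by simp_all
    show "(\<Sum>i\<in>UNIV. mu i * Areal A \<theta> i j) = \<theta> * mu j" "(\<Sum>j\<in>UNIV. Areal A \<theta> i j * v j) = \<theta> * v i" for i j
      using me ve r1 by simp_all
    show "int tau = Gcd {k. k \<noteq> 0 \<and> ((0, j), (k, j)) \<in> (MAP_step A)\<^sup>+}" for j
      using tau_def by blast
    show "x (Suc k) j \<ge> 0" "summable (\<lambda>k. x (Suc k) j)" for k j
      by (rule mg1_levels_summable[OF X0 X1])+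
    show "mat_conv_radius (\<lambda>k. if k = 0 then (\<lambda>i j. 0) else B k) = ereal \<theta>"
      using rB_def theta_eq by simp
    show "cball 0 \<theta> \<subseteq> U" using A4_open theta_eq by simp
    show "(\<lambda>z. Bext z a j) meromorphic_on U" for a j using A4_mero by blast
    show "Bext z a j = Bstar B z a j" if "z \<in> ball 0 \<theta>" for z a j using A4_ext that theta_eq by blast
    show "\<exists>Bt. Bt \<noteq> (\<lambda>i j. 0) \<and> (\<forall>i j. Im (Bt i j) = 0 \<and> Re (Bt i j) \<ge> 0) \<and>
        (\<forall>i j. ((\<lambda>z. (1 - z / of_real \<theta>) ^ mB * Bext z i j) \<longlongrightarrow> Bt i j) (at (of_real \<theta>)))"
      unfolding theta_eq by (rule A4_lim)
  qed (fact pi_norm A1c A3 th muv_norm tau_pos p_mod x0_pos bal A4_open A4_mB)+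
  \<comment> \<open>The locale builds its index sets with \<theta> in place of \<open>rB\<close>, so
    they agree with those of the theorem by \<open>theta_eq\<close>.\<close>
  have "H = Hs" by (simp add: H_def Hs_def)
  then have "tau' = \<tau>'" by (simp add: tau'_def \<tau>'_def)
  then have Eta: "Eta = etas" using \<open>H = Hs\<close> by (simp add: Eta_def etas_def flip: theta_eq)
  then have tauhat: "tauhat = \<tau>h" using \<open>tau' = \<tau>'\<close> by (simp add: tauhat_def \<tau>h_def)
  have chat: "chat = limit_coeff" using \<open>tau' = \<tau>'\<close> Eta by (simp add: chat_def limit_coeff_def)
  show ?thesis
    unfolding tauhat chat
    using limit_coeff_real_nonneg(1) limit_coeff_pos xbar_limit_coeff_real_bigo by blast
qed

end
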